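(* (Poincaré inequality on $\mathcal O$.) Suppose that $\mu_\infty(\complement\mathcal O)>0$ and that $S_\infty$ is uniformly exponentially stable. If $-\underline L_{\mathcal O}$ admits a bounded holomorphic functional calculus on $\overline{\mathsf R(D^H_{\mathcal O})}$, then there is a constant $C$ such that for all $u\in\mathring W^{1,2}_H(\mathcal O,\mu_\infty)$ we have $$\|u\|_{L^2(\mathcal O,\mu_\infty)}\le C\,\|D^H_{\mathcal O}u\|_{L^2(\mathcal O,\mu_\infty;H)}.$$
   Context: Setting and standing assumptions. $E$ is a real Banach space, $H$ is a real Hilbert space with inner product $[\cdot,\cdot]$, and $i:H\to E$ is a bounded injective linear operator. $W^H$ is an $H$-cylindrical Brownian motion on a probability space $(\Omega,\mathbb P)$: a linear map $W^H:L^2(\mathbb R_+;H)\to L^2(\Omega,\mathbb P)$ such that each $W^Hf$ is centred Gaussian and $\mathbb E(W^Hf\,W^Hg)=\int_0^\infty [f(t),g(t)]\,dt$. $S$ is a $C_0$-semigroup on $E$ with generator $A$. It is assumed that (1) there is a centred Gaussian Radon measure $\mu_\infty$ on $E$ with $\int_E\langle x,x^*\rangle^2\,d\mu_\infty(x)=\int_0^\infty\|i^*S^*(t)x^*\|_H^2\,dt$ for all $x^*\in E^*$ (equivalently, $dX=AX\,dt+dW^H$ has an invariant measure), and (2) the Ornstein-Uhlenbeck semigroup $P(t)f(x)=\mathbb E f(X^x(t))$, $X^x(t)=S(t)x+\int_0^tS(t-s)\,i\,dW^H(s)$, which extends to a $C_0$-contraction semigroup on $L^2(E,\mu_\infty)$,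 is analytic on (the complexification of) $L^2(E,\mu_\infty)$. $\mathcal O\subseteq E$ is a nonempty open set with $\mu_\infty(\mathcal O)>0$, and $\complement\mathcal O=E\setminus\mathcal O$. Gradient. $H_\infty$ is the closure in $L^2(E,\mu_\infty)$ of the functions $\langle\cdot,x^*\rangle$, $x^*\in E^*$; $i_\infty:H_\infty\to E$, $i_\infty h=\int_Eh(x)x\,d\mu_\infty(x)$, is injective and has adjoint $i_\infty^*x^*=\langle\cdot,x^*\rangle$; $\phi_h$ denotes $h\in H_\infty$ viewed as a function. The operator $Ui_\infty^*x^*:=i^*x^*$ from $H_\infty$ to $H$ is closable; $U$ denotes its closure. For $f=\varphi(\phi_{h_1},\dots,\phi_{h_n})$ with $\varphi\in C^1_{\rm b}(\mathbb R^n)$, $h_j\in\mathsf D(U)$, put $D^Hf=\sum_j\partial_j\varphi(\phi_{h_1},\dots,\phi_{h_n})\otimes Uh_j$; $D^H$ is closable from $L^2(E,\mu_\infty)$ to $L^2(E,\mu_\infty;H)$ and $D^H$ also denotes its closure, with domain $\mathsf D(D^H)$. $S_\infty$ and $B$. $S$ maps $H_\infty$ (identified with $i_\infty(H_\infty)\subseteq E$) into itself and restricts to a $C_0$-contraction semigroup $S_\infty$ on $H_\infty$, with generator $A_\infty$. There is a unique bounded operator $B$ on $H$ with $iBi^*x^*=-i_\infty A_\infty^*i_\infty^*x^*$ for all $x^*\in\mathsf D(A^* )$; it satisfies $B+B^*=I$ and $[Bh,h]=\frac12\|h\|_H^2$. $B$ acts pointwise on $H$-valued functions. Operators on $\mathcal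 O$. For $f$ on $\mathcal O$, $\widetilde f$ is its extension by $0$ to $E$. $\mathsf D(D^H_{\mathcal O})=\mathring W^{1,2}_H(\mathcal O,\mu_\infty):=\{f\in L^2(\mathcal O,\mu_\infty):\widetilde f\in\mathsf D(D^H),\ D^H\widetilde f=0\ \mu_\infty\text{-a.e. on }\complement\mathcal O\}$ and $D^H_{\mathcal O}f:=D^H\widetilde f\in L^2(\mathcal O,\mu_\infty;H)$; this is closed and densely defined, with adjoint $D_{\mathcal O}^{H*}$. On $L^2(\mathcal O,\mu_\infty;H)$ the operator $-D^H_{\mathcal O}D_{\mathcal O}^{H*}B$, with domain $\{F: BF\in\mathsf D(D_{\mathcal O}^{H*}),\ D_{\mathcal O}^{H*}BF\in\mathsf D(D^H_{\mathcal O})\}$, generates a bounded analytic semigroup which leaves $\overline{\mathsf R(D^H_{\mathcal O})}$ (the closure of the range of $D^H_{\mathcal O}$) invariant; $\underline L_{\mathcal O}$ denotes its part in $\overline{\mathsf R(D^H_{\mathcal O})}$, i.e. the generator of the restricted semigroup. Functional calculus. A sectorial operator $T$ on a Banach space $F$ admits a bounded holomorphic functional calculus if for some $\theta\in(0,\frac12\pi)$ its Dunford calculus extends to a bounded homomorphism $H^\infty(\Sigma_\theta)\to\mathcal L(F)$, $f\mapsto f(T)$, where $\Sigma_\theta=\{z\in\mathbb C\setminus\{0\}:|\arg z|<\theta\}$. Complexifications are used where needed. *)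

theory Defs
  imports "HOL-Probability.Probability" "HOL-Library.Function_Algebras"
begin

text \<open>
  The spaces \<open>L\<^sup>2(\<mu>; H)\<close> depend on the term \<open>\<mu>\<close> and so are not types. A normed space is given here
  by a pair \<open>(X, p)\<close>: a linear subspace \<open>X\<close> of a type of class \<^class>\<open>real_vector\<close> and a seminorm
  \<open>p\<close> on \<open>X\<close>; it stands for the quotient of \<open>X\<close> by the elements of seminorm zero. For
  \<open>L\<^sup>2\<close> these are the functions vanishing almost everywhere. All equations between vectors are
  read modulo this subspace. The Banach space \<open>E\<close> itself is \<open>(UNIV, norm)\<close>. Unbounded operators
  are graphs, i.e. sets of pairs of representatives.
\<close>

instantiation "fun" :: (type, real_vector) real_vector
begin

definition scaleR_fun :: "real \<Rightarrow> ('a \<Rightarrow> 'b) \<Rightarrow> 'a \<Rightarrow> 'b"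
  where "scaleR_fun c f = (\<lambda>x. c *\<^sub>R f x)"

instance
  by standard (auto simp: scaleR_fun_def fun_eq_iff scaleR_add_right scaleR_add_left)

end


section \<open>Operators on seminormed spaces\<close>

definition seq_closure :: "'v::real_vector set \<Rightarrow> ('v \<Rightarrow> real) \<Rightarrow> 'v set \<Rightarrow> 'v set"
  where "seq_closure X p A =
    {x \<in> X. \<exists>s::nat \<Rightarrow> 'v. (\<forall>n. s n \<in> A) \<and> (\<lambda>n. p (s n - x)) \<longlonglongrightarrow> 0}"

definition op_closure ::
    "'v::real_vector set \<Rightarrow> ('v \<Rightarrow> real) \<Rightarrow> 'w::real_vector set \<Rightarrow> ('w \<Rightarrow> real) \<Rightarrow> ('v \<times> 'w) set \<Rightarrow> ('v \<times> 'w) set"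
  where "op_closure X p Y q G = seq_closure (X \<times> Y) (\<lambda>(x, y). p x + q y) G"

definition bounded_op :: "'v::real_vector set \<Rightarrow> ('v \<Rightarrow> real) \<Rightarrow> ('v \<Rightarrow> 'v) \<Rightarrow> bool"
  where "bounded_op X p T \<longleftrightarrow>
    (\<forall>x\<in>X. T x \<in> X) \<and>
    (\<forall>x\<in>X. \<forall>y\<in>X. \<forall>a b. p (T (a *\<^sub>R x + b *\<^sub>R y) - (a *\<^sub>R T x + b *\<^sub>R T y)) = 0) \<and>
    (\<exists>C. \<forall>x\<in>X. p (T x) \<le> C * p x)"

definition c0_semigroup :: "'v::real_vector set \<Rightarrow> ('v \<Rightarrow> real) \<Rightarrow> (real \<Rightarrow> 'v \<Rightarrow> 'v) \<Rightarrow> bool"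
  where "c0_semigroup X p S \<longleftrightarrow>
    (\<forall>t\<ge>0. bounded_op X p (S t)) \<and>
    (\<forall>x\<in>X. p (S 0 x - x) = 0) \<and>
    (\<forall>s\<ge>0. \<forall>t\<ge>0. \<forall>x\<in>X. p (S (s + t) x - S s (S t x)) = 0) \<and>
    (\<forall>x\<in>X. ((\<lambda>t. p (S t x - x)) \<longlongrightarrow> 0) (at_right 0))"

definition c0_contraction_semigroup :: "'v::real_vector set \<Rightarrow> ('v \<Rightarrow> real) \<Rightarrow> (real \<Rightarrow> 'v \<Rightarrow> 'v) \<Rightarrow> bool"
  where "c0_contraction_semigroup X p S \<longleftrightarrow>
    c0_semigroup X p S \<and> (\<forall>t\<ge>0. \<forall>x\<in>X. p (S t x) \<le> p x)"

definition uniformly_exp_stable :: "'v::real_vector set \<Rightarrow> ('v \<Rightarrow> real) \<Rightarrow> (real \<Rightarrow> 'v \<Rightarrow> 'v) \<Rightarrow> bool"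
  where "uniformly_exp_stable X p S \<longleftrightarrow>
    (\<exists>M \<omega>. \<omega> > 0 \<and> (\<forall>t\<ge>0. \<forall>x\<in>X. p (S t x) \<le> M * exp (- \<omega> * t) * p x))"

definition semigroup_generator ::
    "'v::real_vector set \<Rightarrow> ('v \<Rightarrow> real) \<Rightarrow> (real \<Rightarrow> 'v \<Rightarrow> 'v) \<Rightarrow> ('v \<times> 'v) set"
  where "semigroup_generator X p S =
    {(x, y). x \<in> X \<and> y \<in> X \<and> ((\<lambda>t. p ((1 / t) *\<^sub>R (S t x - x) - y)) \<longlongrightarrow> 0) (at_right 0)}"

definition adjoint_graph ::
    "'v set \<Rightarrow> ('v \<Rightarrow> 'v \<Rightarrow> real) \<Rightarrow> 'w set \<Rightarrow> ('w \<Rightarrow> 'w \<Rightarrow> real) \<Rightarrow> ('v \<times> 'w) set \<Rightarrow> ('w \<times> 'v) set"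
  where "adjoint_graph X ip Y iq T =
    {(y, x). y \<in> Y \<and> x \<in> X \<and> (\<forall>(u, v)\<in>T. iq v y = ip u x)}"

definition dual_graph :: "('e::real_normed_vector \<times> 'e) set \<Rightarrow> (('e \<Rightarrow>\<^sub>L real) \<times> ('e \<Rightarrow>\<^sub>L real)) set"
  where "dual_graph T = {(xs, ys). \<forall>(x, y)\<in>T. blinfun_apply xs y = blinfun_apply ys x}"

definition part_in :: "'v set \<Rightarrow> ('v \<times> 'v) set \<Rightarrow> ('v \<times> 'v) set"
  where "part_in Y T = {(x, y) \<in> T. x \<in> Y \<and> y \<in> Y}"

definition neg_op :: "('v \<times> 'w::uminus) set \<Rightarrow> ('v \<times> 'w) set"
  where "neg_op T = {(x, - y) | x y. (x, y) \<in> T}"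

text \<open>
  The Bochner integral, as in \<^const>\<open>has_bochner_integral\<close>, but for a seminormed space and without
  the second-countability of the target type. The measurability condition makes the
  non-negative integrals meaningful.
\<close>

definition has_bochner_integral_in ::
    "'v::real_vector set \<Rightarrow> ('v \<Rightarrow> real) \<Rightarrow> 'a measure \<Rightarrow> ('a \<Rightarrow> 'v) \<Rightarrow> 'v \<Rightarrow> bool"
  where "has_bochner_integral_in X p M f v \<longleftrightarrow>
    (\<forall>t\<in>space M. f t \<in> X) \<and> v \<in> X \<and>
    (\<exists>s::nat \<Rightarrow> 'a \<Rightarrow> 'v.
      (\<forall>n. Bochner_Integration.simple_bochner_integrable M (s n) \<and> (\<forall>t\<in>space M. s n t \<in> X) \<and>
           (\<lambda>t. p (f t - s n t)) \<in> borel_measurable M) \<and>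
      (\<lambda>n. \<integral>\<^sup>+t. ennreal (p (f t - s n t)) \<partial>M) \<longlonglongrightarrow> 0 \<and>
      (\<lambda>n. p (Bochner_Integration.simple_bochner_integral M (s n) - v)) \<longlonglongrightarrow> 0)"


section \<open>Complexification, analyticity and functional calculus\<close>

text \<open>
  The complexification of a Hilbert space \<open>(X, p)\<close> is \<open>X \<times> X\<close>, where \<open>(x, y)\<close> stands for
  \<open>x + iy\<close>, with complex multiplication \<open>cmult\<close> and norm \<open>cnorm p\<close>.
\<close>

definition cmult :: "complex \<Rightarrow> 'v::real_vector \<times> 'v \<Rightarrow> 'v \<times> 'v"
  where "cmult z = (\<lambda>(x, y). (Re z *\<^sub>R x - Im z *\<^sub>R y, Re z *\<^sub>R y + Im z *\<^sub>R x))"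

definition cnorm :: "('v \<Rightarrow> real) \<Rightarrow> 'v \<times> 'v \<Rightarrow> real"
  where "cnorm p = (\<lambda>(x, y). sqrt ((p x)\<^sup>2 + (p y)\<^sup>2))"

definition complexify_graph :: "('v \<times> 'v) set \<Rightarrow> (('v \<times> 'v) \<times> ('v \<times> 'v)) set"
  where "complexify_graph T = {((x, y), (u, v)) | x y u v. (x, u) \<in> T \<and> (y, v) \<in> T}"

definition bounded_cop ::
    "('v::real_vector \<times> 'v) set \<Rightarrow> ('v \<times> 'v \<Rightarrow> real) \<Rightarrow> ('v \<times> 'v \<Rightarrow> 'v \<times> 'v) \<Rightarrow> bool"
  where "bounded_cop Z q T \<longleftrightarrow>
    bounded_op Z q T \<and> (\<forall>c. \<forall>x\<in>Z. q (T (cmult c x) - cmult c (T x)) = 0)"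

definition sector :: "real \<Rightarrow> complex set"
  where "sector \<theta> = {z. z \<noteq> 0 \<and> \<bar>Arg z\<bar> < \<theta>}"

definition analytic_semigroup :: "'v::real_vector set \<Rightarrow> ('v \<Rightarrow> real) \<Rightarrow> (real \<Rightarrow> 'v \<Rightarrow> 'v) \<Rightarrow> bool"
  where "analytic_semigroup X p P \<longleftrightarrow>
    (\<exists>\<theta> Q. 0 < \<theta> \<and> \<theta> \<le> pi / 2 \<and>
      (\<forall>z\<in>sector \<theta>. bounded_cop (X \<times> X) (cnorm p) (Q z)) \<and>
      (\<forall>t>0. \<forall>x\<in>X. \<forall>y\<in>X. cnorm p (Q (complex_of_real t) (x, y) - (P t x, P t y)) = 0) \<and>
      (\<forall>z\<in>sector \<theta>. \<forall>w\<in>sector \<theta>. \<forall>x\<in>X \<times> X. cnorm p (Q (z + w) x - Q z (Q w x)) = 0) \<and>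
      (\<forall>x\<in>X \<times> X. \<forall>z\<in>sector \<theta>. \<exists>d\<in>X \<times> X.
        ((\<lambda>w. cnorm p (cmult (1 / (w - z)) (Q w x - Q z x) - d)) \<longlongrightarrow> 0) (at z)) \<and>
      (\<forall>x\<in>X \<times> X. \<forall>\<theta>'. 0 < \<theta>' \<and> \<theta>' < \<theta> \<longrightarrow>
        ((\<lambda>z. cnorm p (Q z x - x)) \<longlongrightarrow> 0) (at 0 within sector \<theta>')))"

text \<open>
  \<open>sectorial_of_angle Z q T \<omega>\<close>: the spectrum of \<open>T\<close> lies in the closed sector of angle \<open>\<omega>\<close>, and
  \<open>z R(z, T)\<close> is uniformly bounded outside every larger sector. The choice in \<open>resolvent\<close> is
  irrelevant: its value is determined up to seminorm zero.
\<close>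

definition sectorial_of_angle ::
    "('v::real_vector \<times> 'v) set \<Rightarrow> ('v \<times> 'v \<Rightarrow> real) \<Rightarrow> (('v \<times> 'v) \<times> ('v \<times> 'v)) set \<Rightarrow> real \<Rightarrow> bool"
  where "sectorial_of_angle Z q T \<omega> \<longleftrightarrow>
    0 \<le> \<omega> \<and> \<omega> < pi \<and>
    (\<forall>\<nu>. \<omega> < \<nu> \<and> \<nu> < pi \<longrightarrow>
      (\<exists>C. \<forall>z. z \<noteq> 0 \<and> \<nu> \<le> \<bar>Arg z\<bar> \<longrightarrow> (\<forall>y\<in>Z.
        (\<exists>x\<in>Z. (x, cmult z x - y) \<in> T) \<and>
        (\<forall>x\<in>Z. (x, cmult z x - y) \<in> T \<longrightarrow> norm z * q x \<le> C * q y))))"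

definition resolvent ::
    "('v::real_vector \<times> 'v) set \<Rightarrow> (('v \<times> 'v) \<times> ('v \<times> 'v)) set \<Rightarrow> complex \<Rightarrow> 'v \<times> 'v \<Rightarrow> 'v \<times> 'v"
  where "resolvent Z T z y = (SOME x. x \<in> Z \<and> (x, cmult z x - y) \<in> T)"

definition Hinfty :: "real \<Rightarrow> (complex \<Rightarrow> complex) set"
  where "Hinfty \<theta> = {f. f holomorphic_on sector \<theta> \<and> bounded (f ` sector \<theta>)}"

definition Hinfty0 :: "real \<Rightarrow> (complex \<Rightarrow> complex) set"
  where "Hinfty0 \<theta> = {f. f holomorphic_on sector \<theta> \<and>
    (\<exists>C \<epsilon>. \<epsilon> > 0 \<and> (\<forall>z\<in>sector \<theta>. norm (f z) \<le> C * (norm z / (1 + (norm z)\<^sup>2)) powr \<epsilon>))}"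

text \<open>
  The Dunford integral \<open>1/(2\<pi>i) \<integral> f(z) R(z, T) x dz\<close> over the boundary of the sector of angle \<open>\<nu>\<close>,
  with the sector on the left: inwards along the ray of argument \<open>\<nu>\<close>, then outwards along the ray
  of argument \<open>- \<nu>\<close>.
\<close>

definition has_dunford_integral ::
    "('v::real_vector \<times> 'v) set \<Rightarrow> ('v \<times> 'v \<Rightarrow> real) \<Rightarrow> (('v \<times> 'v) \<times> ('v \<times> 'v)) set \<Rightarrow> real \<Rightarrow>
      (complex \<Rightarrow> complex) \<Rightarrow> 'v \<times> 'v \<Rightarrow> 'v \<times> 'v \<Rightarrow> bool"
  where "has_dunford_integral Z q T \<nu> f x v \<longleftrightarrow>
    has_bochner_integral_in Z q (restrict_space lborel {0<..})
      (\<lambda>r. cmult (f (rcis r (- \<nu>)) * cis (- \<nu>) / (2 * pi * \<i>)) (resolvent Z T (rcis r (- \<nu>)) x)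
         - cmult (f (rcis r \<nu>) * cis \<nu> / (2 * pi * \<i>)) (resolvent Z T (rcis r \<nu>) x)) v"

definition bounded_Hinfty_calculus :: "'v::real_vector set \<Rightarrow> ('v \<Rightarrow> real) \<Rightarrow> ('v \<times> 'v) set \<Rightarrow> bool"
  where "bounded_Hinfty_calculus X p T \<longleftrightarrow>
    (let Z = X \<times> X; q = cnorm p; Tc = complexify_graph T in
      \<exists>\<omega> \<theta> \<Phi>. \<omega> < \<theta> \<and> 0 < \<theta> \<and> \<theta> < pi / 2 \<and> sectorial_of_angle Z q Tc \<omega> \<and>
        (\<forall>f\<in>Hinfty \<theta>. bounded_cop Z q (\<Phi> f)) \<and>
        (\<forall>f\<in>Hinfty \<theta>. \<forall>g\<in>Hinfty \<theta>. \<forall>x\<in>Z.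
          q (\<Phi> (\<lambda>z. f z + g z) x - (\<Phi> f x + \<Phi> g x)) = 0 \<and>
          q (\<Phi> (\<lambda>z. f z * g z) x - \<Phi> f (\<Phi> g x)) = 0) \<and>
        (\<forall>f\<in>Hinfty \<theta>. \<forall>c. \<forall>x\<in>Z. q (\<Phi> (\<lambda>z. c * f z) x - cmult c (\<Phi> f x)) = 0) \<and>
        (\<exists>C. \<forall>f\<in>Hinfty \<theta>. \<forall>x\<in>Z. q (\<Phi> f x) \<le> C * (SUP z\<in>sector \<theta>. norm (f z)) * q x) \<and>
        (\<forall>f\<in>Hinfty0 \<theta>. \<forall>\<nu>. \<omega> < \<nu> \<and> \<nu> < \<theta> \<longrightarrow>
          (\<forall>x\<in>Z. has_dunford_integral Z q Tc \<nu> f x (\<Phi> f x))))"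


section \<open>Hilbert-space-valued square-integrable functions\<close>

definition strongly_measurable :: "'a measure \<Rightarrow> ('a \<Rightarrow> 'b::topological_space) \<Rightarrow> bool"
  where "strongly_measurable M f \<longleftrightarrow>
    (\<exists>s::nat \<Rightarrow> 'a \<Rightarrow> 'b. (\<forall>n. simple_function M (s n)) \<and> (\<forall>x\<in>space M. (\<lambda>n. s n x) \<longlonglongrightarrow> f x))"

definition L2 :: "'a measure \<Rightarrow> ('a \<Rightarrow> 'b::real_inner) set"
  where "L2 M = {f. strongly_measurable M f \<and> integrable M (\<lambda>x. (norm (f x))\<^sup>2)}"

definition L2norm :: "'a measure \<Rightarrow> ('a \<Rightarrow> 'b::real_inner) \<Rightarrow> real"
  where "L2norm M f = sqrt (\<integral>x. (norm (f x))\<^sup>2 \<partial>M)"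

definition L2inner :: "'a measure \<Rightarrow> ('a \<Rightarrow> 'b::real_inner) \<Rightarrow> ('a \<Rightarrow> 'b) \<Rightarrow> real"
  where "L2inner M f g = (\<integral>x. f x \<bullet> g x \<partial>M)"


section \<open>Gaussian measures, cylindrical Brownian motion and stochastic integrals\<close>

definition centred_gaussian :: "'a measure \<Rightarrow> ('a \<Rightarrow> real) \<Rightarrow> bool"
  where "centred_gaussian M X \<longleftrightarrow> X \<in> borel_measurable M \<and>
    ((AE x in M. X x = 0) \<or>
     (\<exists>\<sigma>>0. distributed M lborel X (\<lambda>x. ennreal (normal_density 0 \<sigma> x))))"

definition centred_gaussian_radon_measure :: "'e::real_normed_vector measure \<Rightarrow> bool"
  where "centred_gaussian_radon_measure \<mu> \<longleftrightarrow>
    prob_space \<mu> \<and> sets \<mu> = sets borel \<and>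
    (\<forall>A\<in>sets \<mu>. \<forall>\<epsilon>>0. \<exists>K. compact K \<and> K \<subseteq> A \<and> measure \<mu> (A - K) < \<epsilon>) \<and>
    (\<forall>xs :: 'e \<Rightarrow>\<^sub>L real. centred_gaussian \<mu> (blinfun_apply xs))"

definition half_line :: "real measure"
  where "half_line = restrict_space lborel {0..}"

definition cylindrical_brownian_motion ::
    "'w measure \<Rightarrow> ((real \<Rightarrow> 'h::{real_inner,complete_space}) \<Rightarrow> 'w \<Rightarrow> real) \<Rightarrow> bool"
  where "cylindrical_brownian_motion \<Omega> W \<longleftrightarrow>
    prob_space \<Omega> \<and>
    (\<forall>f\<in>L2 half_line. W f \<in> L2 \<Omega> \<and> centred_gaussian \<Omega> (W f)) \<and>
    (\<forall>f\<in>L2 half_line. \<forall>g\<in>L2 half_line. \<forall>a b.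
      AE \<omega> in \<Omega>. W (a *\<^sub>R f + b *\<^sub>R g) \<omega> = a * W f \<omega> + b * W g \<omega>) \<and>
    (\<forall>f\<in>L2 half_line. \<forall>g\<in>L2 half_line. (\<integral>\<omega>. W f \<omega> * W g \<omega> \<partial>\<Omega>) = L2inner half_line f g)"

text \<open>
  \<open>hadjoint T xs\<close> is \<open>T\<^sup>* x\<^sup>*\<close> for a bounded operator \<open>T\<close> from \<open>H\<close> to \<open>E\<close>, where the dual of \<open>H\<close> is
  identified with \<open>H\<close> by the Riesz theorem. Thus \<open>i\<^sup>* S\<^sup>*(t) x\<^sup>*\<close> is \<open>hadjoint (S t \<circ> i) xs\<close>.
\<close>

definition hadjoint :: "('h::real_inner \<Rightarrow> 'e::real_normed_vector) \<Rightarrow> ('e \<Rightarrow>\<^sub>L real) \<Rightarrow> 'h"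
  where "hadjoint T xs = (THE g. \<forall>h. g \<bullet> h = blinfun_apply xs (T h))"

text \<open>
  \<open>Y\<close> is the stochastic integral of \<open>\<Psi>\<close> over \<open>(0, t)\<close>: for all \<open>x\<^sup>*\<close>, almost surely
  \<open>\<langle>Y, x\<^sup>*\<rangle> = W (\<chi> \<Psi>\<^sup>* x\<^sup>*)\<close>, \<open>\<chi>\<close> being the indicator of \<open>[0, t]\<close>.
\<close>

definition has_stochastic_integral ::
    "'w measure \<Rightarrow> ((real \<Rightarrow> 'h::{real_inner,complete_space}) \<Rightarrow> 'w \<Rightarrow> real) \<Rightarrow> real \<Rightarrow>
      (real \<Rightarrow> 'h \<Rightarrow> 'e::banach) \<Rightarrow> ('w \<Rightarrow> 'e) \<Rightarrow> bool"
  where "has_stochastic_integral \<Omega> W t \<Psi> Y \<longleftrightarrow>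
    strongly_measurable \<Omega> Y \<and>
    (\<forall>xs. (\<lambda>s. indicator {0..t} s *\<^sub>R hadjoint (\<Psi> s) xs) \<in> L2 half_line \<and>
      (AE \<omega> in \<Omega>. blinfun_apply xs (Y \<omega>) = W (\<lambda>s. indicator {0..t} s *\<^sub>R hadjoint (\<Psi> s) xs) \<omega>))"

text \<open>
  \<open>Z t\<close> is the stochastic convolution, so that \<open>S t x + Z t \<omega>\<close> is the process \<open>X\<^sup>x(t)\<close>; \<open>P\<close> is
  the extension to \<open>L\<^sup>2(E, \<mu>)\<close> of the semigroup given on bounded Borel functions by
  \<open>P(t)f(x) = E f(X\<^sup>x(t))\<close>.
\<close>

definition ornstein_uhlenbeck_semigroup ::
    "'w measure \<Rightarrow> (real \<Rightarrow> 'e::banach \<Rightarrow> 'e) \<Rightarrow> (real \<Rightarrow> 'w \<Rightarrow> 'e) \<Rightarrow> 'e measure \<Rightarrow>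
      (real \<Rightarrow> ('e \<Rightarrow> real) \<Rightarrow> 'e \<Rightarrow> real) \<Rightarrow> bool"
  where "ornstein_uhlenbeck_semigroup \<Omega> S Z \<mu> P \<longleftrightarrow>
    c0_contraction_semigroup (L2 \<mu>) (L2norm \<mu>) P \<and>
    (\<forall>t\<ge>0. \<forall>f\<in>borel_measurable borel. bounded (range f) \<longrightarrow>
      (AE x in \<mu>. P t f x = (\<integral>\<omega>. f (S t x + Z t \<omega>) \<partial>\<Omega>)))"


section \<open>The gradient \<open>D\<^sup>H\<close>\<close>

definition H_infty :: "'e::real_normed_vector measure \<Rightarrow> ('e \<Rightarrow> real) set"
  where "H_infty \<mu> = seq_closure (L2 \<mu>) (L2norm \<mu>) (range blinfun_apply)"

definition U_op ::
    "'e::banach measure \<Rightarrow> ('h::{real_inner,complete_space} \<Rightarrow> 'e) \<Rightarrow> (('e \<Rightarrow> real) \<times> 'h) set"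
  where "U_op \<mu> i = op_closure (H_infty \<mu>) (L2norm \<mu>) UNIV norm
    {(blinfun_apply xs, hadjoint i xs) | xs. True}"

text \<open>
  \<open>C1b n \<phi> d\<phi>\<close>: \<open>\<phi>\<close> belongs to \<open>C\<^sub>b\<^sup>1(\<real>\<^sup>n)\<close> and \<open>d\<phi> j\<close> is its \<open>j\<close>-th partial derivative. Functions on
  \<open>\<real>\<^sup>n\<close> are encoded as functions on \<open>nat \<Rightarrow> real\<close> (with the product topology) which depend only on
  the coordinates below \<open>n\<close>.
\<close>

definition C1b :: "nat \<Rightarrow> ((nat \<Rightarrow> real) \<Rightarrow> real) \<Rightarrow> (nat \<Rightarrow> (nat \<Rightarrow> real) \<Rightarrow> real) \<Rightarrow> bool"
  where "C1b n \<phi> d\<phi> \<longleftrightarrow>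
    (\<forall>x y. (\<forall>j<n. x j = y j) \<longrightarrow> \<phi> x = \<phi> y) \<and>
    continuous_on UNIV \<phi> \<and> bounded (range \<phi>) \<and>
    (\<forall>j<n. (\<forall>x. ((\<lambda>s. \<phi> (x(j := s))) has_real_derivative d\<phi> j x) (at (x j))) \<and>
      continuous_on UNIV (d\<phi> j) \<and> bounded (range (d\<phi> j)))"

definition cylindrical_gradient ::
    "(('e \<Rightarrow> real) \<times> 'h::real_inner) set \<Rightarrow> (('e \<Rightarrow> real) \<times> ('e \<Rightarrow> 'h)) set"
  where "cylindrical_gradient U =
    {(\<lambda>x. \<phi> (\<lambda>j. h j x), \<lambda>x. \<Sum>j<n. d\<phi> j (\<lambda>k. h k x) *\<^sub>R Uh j) | n \<phi> d\<phi> h Uh.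
      C1b n \<phi> d\<phi> \<and> (\<forall>j<n. (h j, Uh j) \<in> U)}"

definition D_H ::
    "'e::banach measure \<Rightarrow> ('h::{real_inner,complete_space} \<Rightarrow> 'e) \<Rightarrow> (('e \<Rightarrow> real) \<times> ('e \<Rightarrow> 'h)) set"
  where "D_H \<mu> i =
    op_closure (L2 \<mu>) (L2norm \<mu>) (L2 \<mu>) (L2norm \<mu>) (cylindrical_gradient (U_op \<mu> i))"


section \<open>Operators on an open set\<close>

definition ext_zero :: "'a set \<Rightarrow> ('a \<Rightarrow> 'b::zero) \<Rightarrow> 'a \<Rightarrow> 'b"
  where "ext_zero A f = (\<lambda>x. if x \<in> A then f x else 0)"

text \<open>\<open>L\<^sup>2(A, \<mu>)\<close> is \<open>L2 (restrict_space \<mu> A)\<close>; the values of its elements outside \<open>A\<close> are irrelevant.\<close>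

definition W12_ring ::
    "'e::banach measure \<Rightarrow> ('h::{real_inner,complete_space} \<Rightarrow> 'e) \<Rightarrow> 'e set \<Rightarrow> ('e \<Rightarrow> real) set"
  where "W12_ring \<mu> i A =
    {f \<in> L2 (restrict_space \<mu> A).
      \<exists>G. (ext_zero A f, G) \<in> D_H \<mu> i \<and> (AE x in \<mu>. x \<notin> A \<longrightarrow> G x = 0)}"

definition D_O ::
    "'e::banach measure \<Rightarrow> ('h::{real_inner,complete_space} \<Rightarrow> 'e) \<Rightarrow> 'e set \<Rightarrow>
      (('e \<Rightarrow> real) \<times> ('e \<Rightarrow> 'h)) set"
  where "D_O \<mu> i A =
    {(f, F). f \<in> W12_ring \<mu> i A \<and> F \<in> L2 (restrict_space \<mu> A) \<and>
      (\<exists>G. (ext_zero A f, G) \<in> D_H \<mu> i \<and> (AE x in \<mu>. x \<notin> A \<longrightarrow> G x = 0) \<and>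
        (AE x in restrict_space \<mu> A. F x = G x))}"

definition D_O_adj ::
    "'e::banach measure \<Rightarrow> ('h::{real_inner,complete_space} \<Rightarrow> 'e) \<Rightarrow> 'e set \<Rightarrow>
      (('e \<Rightarrow> 'h) \<times> ('e \<Rightarrow> real)) set"
  where "D_O_adj \<mu> i A =
    adjoint_graph (L2 (restrict_space \<mu> A)) (L2inner (restrict_space \<mu> A))
      (L2 (restrict_space \<mu> A)) (L2inner (restrict_space \<mu> A)) (D_O \<mu> i A)"

definition range_closure ::
    "'e::banach measure \<Rightarrow> ('h::{real_inner,complete_space} \<Rightarrow> 'e) \<Rightarrow> 'e set \<Rightarrow> ('e \<Rightarrow> 'h) set"
  where "range_closure \<mu> i A =
    seq_closure (L2 (restrict_space \<mu> A)) (L2norm (restrict_space \<mu> A)) (Range (D_O \<mu> i A))"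

definition L_O ::
    "'e::banach measure \<Rightarrow> ('h::{real_inner,complete_space} \<Rightarrow> 'e) \<Rightarrow> 'e set \<Rightarrow> ('h \<Rightarrow> 'h) \<Rightarrow>
      (('e \<Rightarrow> 'h) \<times> ('e \<Rightarrow> 'h)) set"
  where "L_O \<mu> i A B = part_in (range_closure \<mu> i A)
    (neg_op {(F, G). F \<in> L2 (restrict_space \<mu> A) \<and>
      (\<exists>g. (\<lambda>x. B (F x), g) \<in> D_O_adj \<mu> i A \<and> (g, G) \<in> D_O \<mu> i A)})"

end

theory Submission
  imports Defs
begin

text \<open>
  The inequality holds on all of \<open>E\<close> for functions with mean zero, and it passes to \<open>\<O>\<close> because a
  function vanishing on a set of positive measure has its mean controlled by its variance.

  For a linear functional \<open>x\<^sup>*\<close> choose \<open>T\<close> such that the norm of \<open>S\<^sub>\<infinity>(T)\<close> is at most \<open>1/2\<close>, and let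
  \<open>y\<^sup>*\<close> be the weak integral of \<open>S\<^sup>*(s) x\<^sup>*\<close> over \<open>(0, T)\<close>. Then \<open>A\<^sup>* y\<^sup>* = S\<^sup>*(T) x\<^sup>* - x\<^sup>*\<close>, so pairing the
  defining relation of \<open>B\<close> at \<open>y\<^sup>*\<close> with \<open>x\<^sup>*\<close> bounds half the variance of \<open>x\<^sup>*\<close> by
  \<open>[B i\<^sup>* y\<^sup>*, i\<^sup>* x\<^sup>*]\<close>; the covariance formula bounds the norm of \<open>i\<^sup>* y\<^sup>*\<close> by \<open>sqrt T\<close> times the
  standard deviation of \<open>x\<^sup>*\<close>. Hence the standard deviation is at most a constant times the norm of
  \<open>i\<^sup>* x\<^sup>*\<close>, and this extends to the domain of \<open>U\<close>.

  For a cylindrical function \<open>f = \<phi>(h\<^sub>1, \<dots>, h\<^sub>n)\<close> rotate \<open>(X, Y)\<close>, two independent copies of the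
  Gaussian vector \<open>(h\<^sub>1, \<dots>, h\<^sub>n)\<close>, through the angle \<open>\<pi>/2\<close> in \<open>K\<close> equal steps. By rotation
  invariance the increments of \<open>\<phi>\<close> over the steps are identically distributed, and as \<open>K\<close> tends to infinity the
  variance of \<open>f\<close> is bounded by a multiple of the expectation of \<open>(\<Sum>\<^sub>j \<partial>\<^sub>j\<phi>(X) Y\<^sub>j)\<^sup>2\<close>. For fixed \<open>X\<close> the
  sum is an element of the domain of \<open>U\<close>, to which the linear estimate applies.
\<close>

section \<open>Semi-inner product spaces\<close>

text \<open>The relation defining \<open>B\<close> only provides some \<open>k\<close> that
  represents the adjoint of the generator of \<open>S_inf\<close>; nothing ties \<open>k\<close> to
  the adjoint of A directly. The link is made by testing: on the domain of the generator of
  \<open>S_inf\<close>, pairing with \<open>k\<close> and pairing with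
  \<open>dual_S T xs - xs\<close> are the same limit of difference quotients, and that domain is
  dense. Density is proved for abstract semi-inner product spaces because \<open>H_infty\<close>
  consists of representatives, its vectors being determined only up to seminorm zero.

  In the nonlinear step the laws of rotated vectors are compared through characteristic functions,
  since the covariance of the Gaussian vector may be degenerate and then no density exists. No
  derivative is integrated over the angle: all increments have the law of the first, so only the
  difference quotient at angle 0 has to be controlled, for which continuous and bounded partial
  derivatives suffice.

  The final constant is \<open>sqrt (1 + 1 / prob (- \<O>)) * (pi * (2 * K * sqrt T))\<close>, where
  \<open>K\<close> bounds \<open>B\<close>.\<close>

locale semi_inner_product =
  fixes X :: "'v::real_vector set" and ip :: "'v \<Rightarrow> 'v \<Rightarrow> real"
  assumes subspace: "subspace X"
    and commute: "x \<in> X \<Longrightarrow> y \<in> X \<Longrightarrow> ip x y = ip y x"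
    and add_left: "x \<in> X \<Longrightarrow> y \<in> X \<Longrightarrow> z \<in> X \<Longrightarrow> ip (x + y) z = ip x z + ip y z"
    and scale_left: "x \<in> X \<Longrightarrow> y \<in> X \<Longrightarrow> ip (a *\<^sub>R x) y = a * ip x y"
    and nonneg: "x \<in> X \<Longrightarrow> 0 \<le> ip x x"
begin

definition nm :: "'v \<Rightarrow> real" where "nm x = sqrt (ip x x)"

lemma mem [simp, intro]:
  "0 \<in> X" "x \<in> X \<Longrightarrow> y \<in> X \<Longrightarrow> x + y \<in> X" "x \<in> X \<Longrightarrow> y \<in> X \<Longrightarrow> x - y \<in> X" "x \<in> X \<Longrightarrow> a *\<^sub>R x \<in> X"
  "x \<in> X \<Longrightarrow> - x \<in> X"
  using subspace by (auto simp: subspace_0 subspace_add subspace_diff subspace_scale subspace_neg)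

lemma diff_left: "x \<in> X \<Longrightarrow> y \<in> X \<Longrightarrow> z \<in> X \<Longrightarrow> ip (x - y) z = ip x z - ip y z"
  using add_left[of x "(-1) *\<^sub>R y" z] scale_left[of y z "-1"] by simp

lemma add_right: "x \<in> X \<Longrightarrow> y \<in> X \<Longrightarrow> z \<in> X \<Longrightarrow> ip z (x + y) = ip z x + ip z y"
  and diff_right: "x \<in> X \<Longrightarrow> y \<in> X \<Longrightarrow> z \<in> X \<Longrightarrow> ip z (x - y) = ip z x - ip z y"
  and scale_right: "x \<in> X \<Longrightarrow> z \<in> X \<Longrightarrow> ip z (a *\<^sub>R x) = a * ip z x"
  using commute[of z] by (simp_all add: add_left diff_left scale_left)

lemmas ip_simps = add_left diff_left scale_left add_right diff_right scale_right

lemma nm_nonneg [simp]: "x \<in> X \<Longrightarrow> 0 \<le> nm x"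
  by (simp add: nm_def nonneg)

lemma nm_sq: "x \<in> X \<Longrightarrow> (nm x)\<^sup>2 = ip x x"
  by (simp add: nm_def nonneg)

lemma Cauchy_Schwarz:
  assumes "x \<in> X" "y \<in> X" shows "\<bar>ip x y\<bar> \<le> nm x * nm y"
proof -
  have pos: "0 \<le> ip x x + 2 * r * ip x y + r\<^sup>2 * ip y y" for r
    using nonneg[of "x + r *\<^sub>R y"] assms commute[of y x]
    by (simp add: ip_simps power2_eq_square algebra_simps)
  have "(ip x y)\<^sup>2 \<le> ip x x * ip y y"
  proof (cases "ip y y = 0")
    case True
    have "ip x y = 0"
    proof (rule ccontr)
      assume "ip x y \<noteq> 0"
      \<comment> \<open>The quadratic is affine here because its leading coefficient vanishes, and
        the chosen value of \<open>r\<close> makes it equal to -1.\<close>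
      then show False
        using pos[of "- (ip x x + 1) / (2 * ip x y)"] True by (simp add: field_simps)
    qed
    then show ?thesis using nonneg assms by simp
  next
    case False
    then have p: "ip y y > 0" using nonneg[of y] assms by linarith
    show ?thesis using pos[of "- ip x y / ip y y"] p
      by (simp add: field_simps power2_eq_square)
  qed
  then have "sqrt ((ip x y)\<^sup>2) \<le> sqrt (ip x x * ip y y)" by (rule real_sqrt_le_mono)
  then show ?thesis by (simp add: nm_def real_sqrt_mult)
qed

lemma nm_triangle: "x \<in> X \<Longrightarrow> y \<in> X \<Longrightarrow> nm (x + y) \<le> nm x + nm y"
proof -
  assume x: "x \<in> X" and y: "y \<in> X"
  have "(nm (x + y))\<^sup>2 = (nm x)\<^sup>2 + 2 * ip x y + (nm y)\<^sup>2"
    using x y commute[of y x] by (simp add: nm_sq ip_simps)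
  also have "\<dots> \<le> (nm x + nm y)\<^sup>2"
    using Cauchy_Schwarz[OF x y] by (simp add: power2_sum)
  finally show ?thesis using x y by (meson add_nonneg_nonneg nm_nonneg power2_le_imp_le)
qed

lemma nm_scale: "x \<in> X \<Longrightarrow> nm (a *\<^sub>R x) = \<bar>a\<bar> * nm x"
  by (simp add: nm_def ip_simps real_sqrt_mult flip: mult.assoc)

lemma nm_minus: "x \<in> X \<Longrightarrow> y \<in> X \<Longrightarrow> nm (x - y) = nm (y - x)"
  using nm_scale[of "x - y" "-1"] by simp

lemma nm_triangle_diff: "x \<in> X \<Longrightarrow> y \<in> X \<Longrightarrow> z \<in> X \<Longrightarrow> nm (x - z) \<le> nm (x - y) + nm (y - z)"
  using nm_triangle[of "x - y" "y - z"] by simp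

lemma nm_diff_abs: "x \<in> X \<Longrightarrow> y \<in> X \<Longrightarrow> \<bar>nm x - nm y\<bar> \<le> nm (x - y)"
  using nm_triangle[of "x - y" y] nm_triangle[of "y - x" x] nm_minus[of x y] by fastforce

text \<open>Equations between vectors hold only up to seminorm zero; under \<open>ip\<close> they
  become true equations between numbers, and the semigroup laws are used in that form.\<close>

lemma nm_zero_ip: "x \<in> X \<Longrightarrow> y \<in> X \<Longrightarrow> nm (x - y) = 0 \<Longrightarrow> z \<in> X \<Longrightarrow> ip x z = ip y z"
  using Cauchy_Schwarz[of "x - y" z] by (simp add: ip_simps)

text \<open>Put \<open>z = x\<close>. Vectors obtained weakly, such as means of orbits, are
  accessible only through their pairings, and this is how their seminorm is estimated.\<close>

lemma nm_le_of_dual: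
  assumes "x \<in> X" "0 \<le> c" "\<And>z. z \<in> X \<Longrightarrow> \<bar>ip x z\<bar> \<le> c * nm z"
  shows "nm x \<le> c"
proof (cases "nm x = 0")
  case False
  then have "0 < nm x" using assms(1) nm_nonneg[of x] by linarith
  moreover have "nm x * nm x \<le> c * nm x"
    using assms(3)[OF assms(1)] nm_sq[OF assms(1)] by (simp add: power2_eq_square)
  ultimately show ?thesis by simp
qed (use assms in simp)

lemma tendsto_nm:
  assumes "\<And>n. s n \<in> X" "x \<in> X" "((\<lambda>n. nm (s n - x)) \<longlongrightarrow> 0) F"
  shows "((\<lambda>n. nm (s n)) \<longlongrightarrow> nm x) F"
proof (rule Lim_transform2[OF tendsto_const])
  have "((\<lambda>n. norm (nm x - nm (s n))) \<longlongrightarrow> 0) F"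
    by (rule tendsto_sandwich[OF _ _ tendsto_const assms(3)])
       (use nm_diff_abs[OF assms(2,1)] nm_minus[OF assms(2,1)] in auto)
  then show "((\<lambda>n. nm x - nm (s n)) \<longlongrightarrow> 0) F"
    by (rule tendsto_norm_zero_cancel)
qed

lemma tendsto_ip:
  assumes "\<forall>\<^sub>F n in F. s n \<in> X" "x \<in> X" "z \<in> X" "((\<lambda>n. nm (s n - x)) \<longlongrightarrow> 0) F"
  shows "((\<lambda>n. ip (s n) z) \<longlongrightarrow> ip x z) F"
proof -
  have "((\<lambda>n. ip (s n) z - ip x z) \<longlongrightarrow> 0) F"
  proof (rule Lim_null_comparison)
    show "((\<lambda>n. nm (s n - x) * nm z) \<longlongrightarrow> 0) F"
      using tendsto_mult_left_zero[OF assms(4)] .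
    show "\<forall>\<^sub>F n in F. norm (ip (s n) z - ip x z) \<le> nm (s n - x) * nm z"
      using assms(1) by eventually_elim (use Cauchy_Schwarz assms in \<open>auto simp flip: diff_left\<close>)
  qed
  then show ?thesis by (simp add: LIM_zero_iff)
qed

end

locale complete_semi_inner_product = semi_inner_product +
  assumes complete: "(\<And>n. s n \<in> X) \<Longrightarrow>
     (\<And>e. e > 0 \<Longrightarrow> \<exists>N. \<forall>m\<ge>N. \<forall>n\<ge>N. sqrt (ip (s m - s n) (s m - s n)) < e) \<Longrightarrow>
     \<exists>x\<in>X. (\<lambda>n::nat. sqrt (ip (s n - x) (s n - x))) \<longlonglongrightarrow> 0"
begin

text \<open>The representing vector minimises \<open>ip x x - 2 * f x\<close>.\<close>

lemma Riesz:
  assumes lin: "\<And>x y. x \<in> X \<Longrightarrow> y \<in> X \<Longrightarrow> f (x + y) = f x + f y"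
      "\<And>a x. x \<in> X \<Longrightarrow> f (a *\<^sub>R x) = a * f x"
    and bd: "\<And>x. x \<in> X \<Longrightarrow> \<bar>f x\<bar> \<le> C * nm x"
  obtains g where "g \<in> X" "\<And>x. x \<in> X \<Longrightarrow> f x = ip x g"
proof -
  define J where "J x = ip x x - 2 * f x" for x
  define m where "m = Inf (J ` X)"
  have bddJ: "- C\<^sup>2 \<le> J x" if "x \<in> X" for x
  proof -
    have "0 \<le> (nm x - C)\<^sup>2" by simp
    then show ?thesis using bd[OF that] nm_sq[OF that]
      by (simp add: J_def power2_diff mult.commute)
  qed
  have m_le: "m \<le> J x" if "x \<in> X" for x
    unfolding m_def by (rule cInf_lower) (use that bddJ in \<open>auto simp: bdd_below_def\<close>)
  have "\<exists>x\<in>X. J x < m + 1 / real (Suc n)" for n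
  proof -
    have "Inf (J ` X) < m + 1 / real (Suc n)" by (simp add: m_def)
    moreover have "J ` X \<noteq> {}" using mem(1) by blast
    ultimately show ?thesis using cInf_lessD[of "J ` X"] by blast
  qed
  then obtain s where s: "\<And>n. s n \<in> X" "\<And>n. J (s n) < m + 1 / real (Suc n)" by metis
  \<comment> \<open>Parallelogram identity: at the midpoint \<open>J\<close> is the mean of its two
    values less a quarter of \<open>(nm (x - y))\<^sup>2\<close>, yet still at least
    \<open>m\<close>. Hence a minimising sequence is Cauchy.\<close>
  have par: "(nm (x - y))\<^sup>2 \<le> 2 * (J x - m) + 2 * (J y - m)" if x: "x \<in> X" and y: "y \<in> X" for x y
  proof -
    have "m \<le> J ((1/2) *\<^sub>R (x + y))" using m_le x y by simp
    also have "\<dots> = (J x + J y) / 2 - (nm (x - y))\<^sup>2 / 4"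
      using x y commute[of y x] by (simp add: J_def ip_simps lin nm_sq field_simps)
    finally show ?thesis by (simp add: field_simps)
  qed
  have "\<exists>N. \<forall>m\<ge>N. \<forall>n\<ge>N. sqrt (ip (s m - s n) (s m - s n)) < e" if "e > 0" for e
  proof -
    have "0 < e\<^sup>2 / 4" using that by simp
    from nat_approx_posE[OF this] obtain N where N: "1 / real (Suc N) < e\<^sup>2 / 4" .
    have "nm (s k - s l) < e" if kl: "k \<ge> N" "l \<ge> N" for k l
    proof -
      have "1 / real (Suc k) \<le> 1 / real (Suc N)" "1 / real (Suc l) \<le> 1 / real (Suc N)"
        using kl by (auto simp: field_simps)
      then have "J (s k) - m < e\<^sup>2 / 4" "J (s l) - m < e\<^sup>2 / 4"
        using s(2)[of k] s(2)[of l] N by (smt (verit))+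
      then have "(nm (s k - s l))\<^sup>2 < e\<^sup>2"
        using par[OF s(1) s(1), of k l] by simp
      then show ?thesis using \<open>e > 0\<close> by (simp add: power_less_imp_less_base)
    qed
    then show ?thesis unfolding nm_def by blast
  qed
  from complete[of s, OF s(1) this] obtain g where g: "g \<in> X" and lim: "(\<lambda>n. nm (s n - g)) \<longlonglongrightarrow> 0"
    unfolding nm_def by blast
  have Jg: "J g \<le> m"
  proof (rule LIMSEQ_le_const2)
    show "(\<lambda>n. J g + 0) \<longlonglongrightarrow> J g" by simp
  next
    show "\<exists>N. \<forall>n\<ge>N. J g + 0 \<le> m"
    proof -
      have "(\<lambda>n. J (s n)) \<longlonglongrightarrow> J g"
      proof -
        have f0: "(\<lambda>n. f (s n - g)) \<longlonglongrightarrow> 0"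
          by (rule Lim_null_comparison[where g = "\<lambda>n. C * nm (s n - g)"])
             (use bd s g tendsto_mult_right_zero[OF lim, of C] in auto)
        have "(\<lambda>n. (nm (s n - g))\<^sup>2 + 2 * ip (s n) g - 2 * ip g g - 2 * f (s n - g) + J g)
           \<longlonglongrightarrow> 0\<^sup>2 + 2 * ip g g - 2 * ip g g - 2 * 0 + J g"
          by (intro tendsto_intros lim f0 tendsto_ip) (use s g lim in auto)
        moreover have "(nm (s n - g))\<^sup>2 + 2 * ip (s n) g - 2 * ip g g - 2 * f (s n - g) + J g = J (s n)" for n
        proof -
          have "f (s n - g) = f (s n) - f g"
            using lin(1)[of "s n" "(-1) *\<^sub>R g"] lin(2)[of g "-1"] s(1)[of n] g by simp
          then show ?thesis
          using s(1)[of n] g commute[of g "s n"] by (simp add: J_def nm_sq ip_simps)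
        qed
        ultimately show ?thesis by simp
      qed
      moreover have "(\<lambda>n. m + 1 / real (Suc n)) \<longlonglongrightarrow> m + 0"
        by (intro tendsto_intros LIMSEQ_Suc[OF lim_1_over_n])
      ultimately have "J g \<le> m + 0" by (rule LIMSEQ_le) (use s(2) less_imp_le in blast)
      then show ?thesis by simp
    qed
  qed
  have "f x = ip x g" if x: "x \<in> X" for x
  proof -
    have q: "0 \<le> 2 * r * (ip x g - f x) + r\<^sup>2 * ip x x" for r
    proof -
      have "J g \<le> J (g + r *\<^sub>R x)" using Jg m_le[of "g + r *\<^sub>R x"] g x by auto
      then show ?thesis using g x commute[of g x]
        by (simp add: J_def ip_simps lin power2_eq_square algebra_simps)
    qed
    define d where "d = ip x g - f x"
    \<comment> \<open>The quadratic in \<open>r\<close> has its minimum at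
      \<open>- d / ip x x\<close>; the added 1 keeps the denominator positive when \<open>x\<close>
      has seminorm zero.\<close>
    define r where "r = - d / (ip x x + 1)"
    have p: "ip x x + 1 > 0" using nonneg[OF x] by simp
    have "r * (r * (ip x x + 1)) = r * (- d)" using p by (simp add: r_def)
    then have rd: "r\<^sup>2 * ip x x = - d * r - r\<^sup>2"
      by (simp add: power2_eq_square algebra_simps)
    have "0 \<le> d * r - r\<^sup>2" using q[of r] rd unfolding d_def by (simp add: algebra_simps)
    moreover have "d * r = - (d\<^sup>2 / (ip x x + 1))" by (simp add: r_def power2_eq_square)
    ultimately have "d\<^sup>2 / (ip x x + 1) \<le> 0"
      using zero_le_power2[of r] by linarith
    then have "d = 0" using p by (simp add: divide_le_0_iff)
    then show ?thesis by (simp add: d_def)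
  qed
  with g show ?thesis using that by blast
qed

text \<open>
  The mean of the orbit over \<open>(0, t)\<close>, an element of the domain, is obtained weakly from the Riesz
  theorem; this avoids integrals of functions with values in a seminormed space.
\<close>

lemma c0_contraction_semigroup_generator_dense:
  assumes S: "c0_contraction_semigroup X nm S" and h: "h \<in> X" and e: "0 < e"
  obtains u v where "(u, v) \<in> semigroup_generator X nm S" "nm (u - h) < e"
proof -
  have S_mem [simp, intro]: "S t x \<in> X" if "0 \<le> t" "x \<in> X" for t x
    using S that by (auto simp: c0_contraction_semigroup_def c0_semigroup_def bounded_op_def)
  have S_lin: "nm (S t (a *\<^sub>R x + b *\<^sub>R y) - (a *\<^sub>R S t x + b *\<^sub>R S t y)) = 0"
    if "0 \<le> t" "x \<in> X" "y \<in> X" for t x y a b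
    using S that by (auto simp: c0_contraction_semigroup_def c0_semigroup_def bounded_op_def)
  have S_con: "nm (S t x) \<le> nm x" if "0 \<le> t" "x \<in> X" for t x
    using S that by (auto simp: c0_contraction_semigroup_def)
  have ip_lin: "ip (S t (a *\<^sub>R x + b *\<^sub>R y)) z = a * ip (S t x) z + b * ip (S t y) z"
    if "0 \<le> t" "x \<in> X" "y \<in> X" "z \<in> X" for t x y z a b
    using nm_zero_ip[OF _ _ S_lin[OF that(1-3), of a b] that(4)] that by (simp add: ip_simps)
  have ip_0: "ip (S 0 x) z = ip x z" if "x \<in> X" "z \<in> X" for x z
    using S that by (intro nm_zero_ip) (auto simp: c0_contraction_semigroup_def c0_semigroup_def)
  have ip_add: "ip (S (s + t) x) z = ip (S s (S t x)) z" if "0 \<le> s" "0 \<le> t" "x \<in> X" "z \<in> X" for s t x z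
    using S that by (intro nm_zero_ip) (auto simp: c0_contraction_semigroup_def c0_semigroup_def)
  have ip_diff: "ip (S t x - S t y) z = ip (S t (x - y)) z"
    if "0 \<le> t" "x \<in> X" "y \<in> X" "z \<in> X" for t x y z
    using ip_lin[of t x y z 1 "-1"] that by (simp add: ip_simps)
  \<comment> \<open>Contractivity reduces an increment of the orbit at time \<open>t\<close> to one
    at time 0. This yields weak continuity and, later, the error of the means over short
    windows.\<close>
  have con: "\<bar>ip (S (t + r) h) z - ip (S t h) z\<bar> \<le> nm (S r h - h) * nm z"
    if "0 \<le> t" "0 \<le> r" "z \<in> X" for t r z
  proof -
    have "ip (S (t + r) h) z - ip (S t h) z = ip (S t (S r h - h)) z"
      using that h ip_diff[of t "S r h" h z] by (simp add: ip_add ip_simps)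
    also have "\<bar>\<dots>\<bar> \<le> nm (S t (S r h - h)) * nm z"
      using that h by (intro Cauchy_Schwarz) auto
    also have "\<dots> \<le> nm (S r h - h) * nm z"
      using that h by (intro mult_right_mono S_con) auto
    finally show ?thesis .
  qed
  have small: "\<exists>d>0. \<forall>r. 0 \<le> r \<and> r < d \<longrightarrow> nm (S r h - h) < \<epsilon>" if "\<epsilon> > 0" for \<epsilon>
  proof -
    have "((\<lambda>t. nm (S t h - h)) \<longlongrightarrow> 0) (at_right 0)" and 0: "nm (S 0 h - h) = 0"
      using S h by (auto simp: c0_contraction_semigroup_def c0_semigroup_def)
    then have "\<forall>\<^sub>F t in at_right 0. nm (S t h - h) < \<epsilon>"
      using that by (auto intro: order_tendstoD)
    then obtain d where "d > 0" "\<forall>r>0. r < d \<longrightarrow> nm (S r h - h) < \<epsilon>"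
      by (auto simp: eventually_at_right_field)
    then show ?thesis using 0 that by (metis order_le_less)
  qed
  have cont: "continuous_on {0..} (\<lambda>s. ip (S s h) z)" if z: "z \<in> X" for z
  proof (subst continuous_on_iff, safe)
    fix t \<epsilon> :: real assume t: "0 \<le> t" and \<epsilon>: "0 < \<epsilon>"
    obtain d where d: "d > 0" "\<And>r. 0 \<le> r \<Longrightarrow> r < d \<Longrightarrow> nm (S r h - h) < \<epsilon> / (nm z + 1)"
      using small[of "\<epsilon> / (nm z + 1)"] \<epsilon> z nm_nonneg[OF z] by (metis add_nonneg_pos divide_pos_pos zero_less_one)
    have *: "\<bar>ip (S (t + r) h) z - ip (S t h) z\<bar> < \<epsilon>" if "0 \<le> t" "0 \<le> r" "r < d" for t r
    proof -
      have "\<bar>ip (S (t + r) h) z - ip (S t h) z\<bar> \<le> nm (S r h - h) * nm z"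
        using con that z by blast
      also have "\<dots> \<le> \<epsilon> / (nm z + 1) * nm z"
        using d(2)[of r] that z by (intro mult_right_mono) auto
      also have "\<dots> < \<epsilon>"
        using \<epsilon> nm_nonneg[OF z] by (simp add: field_simps)
      finally show ?thesis .
    qed
    show "\<exists>d>0. \<forall>t'\<in>{0..}. dist t' t < d \<longrightarrow> dist (ip (S t' h) z) (ip (S t h) z) < \<epsilon>"
    proof (intro exI[of _ d] conjI ballI impI d(1))
      fix t' assume t': "t' \<in> {0..}" "dist t' t < d"
      show "dist (ip (S t' h) z) (ip (S t h) z) < \<epsilon>"
        using *[of t "t' - t"] *[of t' "t - t'"] t t'
        by (cases "t \<le> t'") (auto simp: dist_real_def abs_minus_commute)
    qed
  qed
  have integrable: "(\<lambda>s. ip (S s h) z) integrable_on {a..b}" if "0 \<le> a" "z \<in> X" for a b z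
    by (intro integrable_continuous_real continuous_on_subset[OF cont]) (use that in auto)
  obtain t where t: "t > 0" "\<And>r. 0 \<le> r \<Longrightarrow> r \<le> t \<Longrightarrow> nm (S r h - h) \<le> e / 2"
  proof -
    obtain d where "d > 0" "\<And>r. 0 \<le> r \<Longrightarrow> r < d \<Longrightarrow> nm (S r h - h) < e / 2"
      using small[of "e/2"] e by auto
    then show ?thesis by (intro that[of "d/2"]) (auto intro: less_imp_le)
  qed
  define f where "f z = (1 / t) * integral {0..t} (\<lambda>s. ip (S s h) z)" for z
  obtain u where u: "u \<in> X" and fu: "\<And>z. z \<in> X \<Longrightarrow> f z = ip z u"
  proof (rule Riesz[of f "nm h"])
    fix x y assume "x \<in> X" "y \<in> X"
    then have "integral {0..t} (\<lambda>s. ip (S s h) (x + y)) = integral {0..t} (\<lambda>s. ip (S s h) x + ip (S s h) y)"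
      using h by (intro integral_cong) (auto simp: ip_simps)
    also have "\<dots> = integral {0..t} (\<lambda>s. ip (S s h) x) + integral {0..t} (\<lambda>s. ip (S s h) y)"
      using \<open>x \<in> X\<close> \<open>y \<in> X\<close> by (intro integral_add integrable) auto
    finally show "f (x + y) = f x + f y" by (simp add: f_def algebra_simps add_divide_distrib)
  next
    fix a x assume "x \<in> X"
    then have "integral {0..t} (\<lambda>s. ip (S s h) (a *\<^sub>R x)) = integral {0..t} (\<lambda>s. a * ip (S s h) x)"
      using h by (intro integral_cong) (auto simp: ip_simps)
    then show "f (a *\<^sub>R x) = a * f x" by (simp add: f_def)
  next
    fix x assume x: "x \<in> X"
    have "norm (integral {0..t} (\<lambda>s. ip (S s h) x)) \<le> nm h * nm x * (t - 0)"
    proof (rule integral_bound)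
      fix s assume "s \<in> {0..t}"
      then have "\<bar>ip (S s h) x\<bar> \<le> nm (S s h) * nm x" "nm (S s h) \<le> nm h"
        using x h by (auto intro!: Cauchy_Schwarz S_con)
      then show "norm (ip (S s h) x) \<le> nm h * nm x"
        using mult_right_mono[of "nm (S s h)" "nm h" "nm x"] x by fastforce
    qed (use t x in \<open>auto intro!: continuous_on_subset[OF cont]\<close>)
    then show "\<bar>f x\<bar> \<le> nm h * nm x" using t by (simp add: f_def abs_mult field_simps)
  qed (blast intro: that)
  have ip_u: "ip u z = (1 / t) * integral {0..t} (\<lambda>s. ip (S s h) z)" if "z \<in> X" for z
    using fu[OF that] commute[OF that u] by (simp add: f_def)
  have ip_Su: "ip (S r u) z = (1 / t) * integral {r..t + r} (\<lambda>s. ip (S s h) z)" if r: "0 \<le> r" and z: "z \<in> X" for r z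
  proof -
    \<comment> \<open>\<open>g\<close> represents \<open>x \<mapsto> ip (S r x) z\<close>, so it is
      the adjoint of \<open>S r\<close> at \<open>z\<close>; through it \<open>S r\<close> can be
      moved under the integral that defines \<open>u\<close>.\<close>
    obtain g where g: "g \<in> X" "\<And>x. x \<in> X \<Longrightarrow> ip (S r x) z = ip x g"
    proof (rule Riesz[of "\<lambda>x. ip (S r x) z" "nm z"])
      fix x y assume "x \<in> X" "y \<in> X"
      then show "ip (S r (x + y)) z = ip (S r x) z + ip (S r y) z"
        using ip_lin[of r x y z 1 1] r z by simp
    next
      fix a x assume "x \<in> X"
      then show "ip (S r (a *\<^sub>R x)) z = a * ip (S r x) z"
        using ip_lin[of r x x z a 0] r z by simp
    next
      fix x assume x: "x \<in> X"
      then have "\<bar>ip (S r x) z\<bar> \<le> nm (S r x) * nm z" "nm (S r x) \<le> nm x"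
        using r z by (auto intro!: Cauchy_Schwarz S_con)
      then show "\<bar>ip (S r x) z\<bar> \<le> nm z * nm x"
        using mult_right_mono[of "nm (S r x)" "nm x" "nm z"] z by (fastforce simp: mult.commute)
    qed (blast intro: that)
    have "ip (S r u) z = (1 / t) * integral {0..t} (\<lambda>s. ip (S s h) g)"
      using g u by (simp add: ip_u)
    also have "integral {0..t} (\<lambda>s. ip (S s h) g) = integral {0..t} (\<lambda>s. ip (S (s + r) h) z)"
    proof (rule integral_cong)
      fix s assume "s \<in> {0..t}"
      then show "ip (S s h) g = ip (S (s + r) h) z"
        using g(2)[of "S s h"] h r z ip_add[of r s h z] by (simp add: add.commute)
    qed
    also have "\<dots> = integral {r..t + r} (\<lambda>s. ip (S s h) z)"
      using integral_shift_Icc_real[of 0 t "\<lambda>s. ip (S s h) z" r] by (simp add: add.commute o_def)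
    finally show ?thesis .
  qed
  have "nm (u - h) \<le> e / 2"
  proof (rule nm_le_of_dual)
    fix z assume z: "z \<in> X"
    have "ip (u - h) z = (1 / t) * integral {0..t} (\<lambda>s. ip (S s h) z - ip h z)"
      using t u h z integrable[of 0 z t] by (subst integral_diff) (auto simp: ip_simps ip_u algebra_simps diff_divide_distrib)
    also have "\<bar>\<dots>\<bar> \<le> (1 / t) * (e / 2 * nm z * (t - 0))"
    proof -
      have "norm (integral {0..t} (\<lambda>s. ip (S s h) z - ip h z)) \<le> e / 2 * nm z * (t - 0)"
      proof (rule integral_bound)
        fix s assume s: "s \<in> {0..t}"
        then have "\<bar>ip (S s h) z - ip h z\<bar> \<le> nm (S s h - h) * nm z"
          using Cauchy_Schwarz[of "S s h - h" z] h z by (simp add: ip_simps)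
        also have "\<dots> \<le> e / 2 * nm z" using t(2)[of s] s z by (intro mult_right_mono) auto
        finally show "norm (ip (S s h) z - ip h z) \<le> e / 2 * nm z" by simp
      qed (use t z in \<open>auto intro!: continuous_intros continuous_on_subset[OF cont]\<close>)
      then show ?thesis using t by (simp add: abs_mult field_simps)
    qed
    finally show "\<bar>ip (u - h) z\<bar> \<le> e / 2 * nm z" using t by simp
  qed (use u h e in auto)
  moreover
  \<comment> \<open>Formally the generator at the mean \<open>u\<close>: the derivative of a sliding
    integral is the difference of the integrand at the two ends.\<close>
  define v where "v = (1 / t) *\<^sub>R (S t h - h)"
  have v: "v \<in> X" using t h by (simp add: v_def)
  have "((\<lambda>r. nm ((1 / r) *\<^sub>R (S r u - u) - v)) \<longlongrightarrow> 0) (at_right 0)"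
  proof (rule tendstoI)
    fix \<epsilon> :: real assume \<epsilon>: "0 < \<epsilon>"
    obtain d where d: "d > 0" "\<And>r. 0 \<le> r \<Longrightarrow> r < d \<Longrightarrow> nm (S r h - h) < \<epsilon> * t / 4"
      using small[of "\<epsilon> * t / 4"] \<epsilon> t by auto
    have "nm ((1 / r) *\<^sub>R (S r u - u) - v) \<le> \<epsilon> / 2" if r: "0 < r" "r < d" for r
    proof (rule nm_le_of_dual)
      fix z assume z: "z \<in> X"
      let ?\<phi> = "\<lambda>s. ip (S s h) z"
      have split: "integral {a..a + r} (\<lambda>s. ?\<phi> s - ?\<phi> a) = integral {a..a + r} ?\<phi> - r * ?\<phi> a" if "0 \<le> a" for a
        using r that integrable[OF that z] by (subst integral_diff) auto
      have est: "\<bar>integral {a..a + r} (\<lambda>s. ?\<phi> s - ?\<phi> a)\<bar> \<le> \<epsilon> * t / 4 * nm z * r" if a: "0 \<le> a" for a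
      proof -
        have "norm (integral {a..a + r} (\<lambda>s. ?\<phi> s - ?\<phi> a)) \<le> \<epsilon> * t / 4 * nm z * (a + r - a)"
        proof (rule integral_bound)
          fix s assume s: "s \<in> {a..a + r}"
          then have "\<bar>?\<phi> (a + (s - a)) - ?\<phi> a\<bar> \<le> nm (S (s - a) h - h) * nm z"
            using con[of a "s - a" z] a z by auto
          also have "\<dots> \<le> \<epsilon> * t / 4 * nm z" using d(2)[of "s - a"] s r z by (intro mult_right_mono) auto
          finally show "norm (?\<phi> s - ?\<phi> a) \<le> \<epsilon> * t / 4 * nm z" by simp
        qed (use r z a in \<open>auto intro!: continuous_intros continuous_on_subset[OF cont]\<close>)
        then show ?thesis by simp
      qed
      \<comment> \<open>Both sides are the integral over \<open>{0..t + r}\<close>. Shifting the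
        window \<open>{0..t}\<close> by \<open>r\<close> therefore only exchanges two windows of
        length \<open>r\<close> at its ends.\<close>
      have "integral {0..r} ?\<phi> + integral {r..t + r} ?\<phi> = integral {0..t} ?\<phi> + integral {t..t + r} ?\<phi>"
        using t r integrable[of 0 z "t + r"] z
          Henstock_Kurzweil_Integration.integral_combine[where a = 0 and c = r and b = "t + r" and f = ?\<phi>]
          Henstock_Kurzweil_Integration.integral_combine[where a = 0 and c = t and b = "t + r" and f = ?\<phi>] by simp
      then have "integral {r..t + r} ?\<phi> - integral {0..t} ?\<phi> = integral {t..t + r} ?\<phi> - integral {0..0 + r} ?\<phi>"
        by simp
      also have "\<dots> = integral {t..t + r} (\<lambda>s. ?\<phi> s - ?\<phi> t) - integral {0..0 + r} (\<lambda>s. ?\<phi> s - ?\<phi> 0) + r * (?\<phi> t - ?\<phi> 0)"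
        using split[of t] split[of 0] t by (simp add: algebra_simps)
      finally have eq: "integral {r..t + r} ?\<phi> - integral {0..t} ?\<phi> - r * (?\<phi> t - ?\<phi> 0) =
        integral {t..t + r} (\<lambda>s. ?\<phi> s - ?\<phi> t) - integral {0..0 + r} (\<lambda>s. ?\<phi> s - ?\<phi> 0)" by simp
      define x where "x = ip ((1 / r) *\<^sub>R (S r u - u) - v) z"
      have "x = (1 / r) * (ip (S r u) z - ip u z) - (1 / t) * (?\<phi> t - ip h z)"
        using r t u h z unfolding x_def v_def by (simp add: ip_simps)
      also have "\<dots> = (1 / r) * ((1 / t) * integral {r..t + r} ?\<phi> - (1 / t) * integral {0..t} ?\<phi>)
          - (1 / t) * (?\<phi> t - ?\<phi> 0)"
        using r h z by (simp only: ip_u ip_Su ip_0 less_imp_le)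
      finally have "r * t * x = integral {r..t + r} ?\<phi> - integral {0..t} ?\<phi> - r * (?\<phi> t - ?\<phi> 0)"
        using r t by (simp add: right_diff_distrib)
      then have "\<bar>r * t * x\<bar> \<le> 2 * (\<epsilon> * t / 4 * nm z * r)"
        using eq est[of t] est[of 0] t(1) by linarith
      then have "r * t * \<bar>x\<bar> \<le> r * t * (\<epsilon> / 2 * nm z)"
        using t r by (simp add: abs_mult mult_ac)
      then show "\<bar>ip ((1 / r) *\<^sub>R (S r u - u) - v) z\<bar> \<le> \<epsilon> / 2 * nm z"
        using r t by (simp add: x_def)
    qed (use u v r \<epsilon> in auto)
    then have "\<forall>\<^sub>F r in at_right 0. nm ((1 / r) *\<^sub>R (S r u - u) - v) \<le> \<epsilon> / 2"
      using d(1) by (auto simp: eventually_at_right_field)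
    moreover have "\<forall>\<^sub>F r in at_right 0. r > (0::real)" by (simp add: eventually_at_right_less)
    ultimately show "\<forall>\<^sub>F r in at_right 0. dist (nm ((1 / r) *\<^sub>R (S r u - u) - v)) 0 < \<epsilon>"
      by eventually_elim (use u v \<epsilon> in \<open>auto simp: dist_real_def\<close>)
  qed
  then have "(u, v) \<in> semigroup_generator X nm S" using u v by (auto simp: semigroup_generator_def)
  ultimately show ?thesis using that[of u v] e by force
qed

end

text \<open>A Cauchy sequence in the closure has a limit in \<open>X\<close>; replacing its n-th
  term by an element of \<open>A\<close> at distance less than \<open>1 / Suc n\<close> shows that
  this limit is in the closure. With the continuous functionals as \<open>A\<close>, this makes
  \<open>H_infty\<close> complete.\<close>

lemma (in complete_semi_inner_product) seq_closure_complete: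
  assumes A: "subspace A" "A \<subseteq> X"
  shows "complete_semi_inner_product (seq_closure X nm A) ip"
proof -
  let ?C = "seq_closure X nm A"
  have CX: "?C \<subseteq> X" by (auto simp: seq_closure_def)
  have AX: "x \<in> X" if "x \<in> A" for x using A that by auto
  have "subspace ?C"
  proof (rule subspaceI)
    show "0 \<in> ?C"
      using subspace_0[OF A(1)] by (auto simp: seq_closure_def nm_def ip_simps intro!: exI[of _ "\<lambda>_. 0"])
         (metis diff_self mem(1) ip_simps(2) diff_self tendsto_const real_sqrt_zero)
  next
    fix x y assume x: "x \<in> ?C" and y: "y \<in> ?C"
    then obtain s t where s: "\<And>n. s n \<in> A" "(\<lambda>n. nm (s n - x)) \<longlonglongrightarrow> 0"
      and t: "\<And>n. t n \<in> A" "(\<lambda>n. nm (t n - y)) \<longlonglongrightarrow> 0"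
      by (auto simp: seq_closure_def)
    have "(\<lambda>n. nm (s n + t n - (x + y))) \<longlonglongrightarrow> 0"
    proof (rule Lim_null_comparison[OF _ tendsto_add_zero[OF s(2) t(2)]])
      have "norm (nm (s n + t n - (x + y))) \<le> nm (s n - x) + nm (t n - y)" for n
        using nm_triangle[of "s n - x" "t n - y"] x y CX AX[OF s(1)[of n]] AX[OF t(1)[of n]]
        by (auto simp: algebra_simps subset_iff)
      then show "\<forall>\<^sub>F n in sequentially. norm (nm (s n + t n - (x + y))) \<le> nm (s n - x) + nm (t n - y)"
        by simp
    qed
    then show "x + y \<in> ?C" using x y s t A(1)
      by (auto simp: seq_closure_def intro!: exI[of _ "\<lambda>n. s n + t n"] subspace_add)
  next
    fix a x assume x: "x \<in> ?C"
    then obtain s where s: "\<And>n. s n \<in> A" "(\<lambda>n. nm (s n - x)) \<longlonglongrightarrow> 0"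
      by (auto simp: seq_closure_def)
    have "nm (a *\<^sub>R s n - a *\<^sub>R x) = \<bar>a\<bar> * nm (s n - x)" for n
      using x CX AX[OF s(1)[of n]] nm_scale[of "s n - x" a] by (auto simp: scaleR_diff_right)
    then have "(\<lambda>n. nm (a *\<^sub>R s n - a *\<^sub>R x)) \<longlonglongrightarrow> 0"
      using tendsto_mult_right_zero[OF s(2)] by simp
    then show "a *\<^sub>R x \<in> ?C" using x s A(1)
      by (auto simp: seq_closure_def intro!: exI[of _ "\<lambda>n. a *\<^sub>R s n"] subspace_scale)
  qed
  then show ?thesis
  proof (unfold_locales, goal_cases)
    case (6 s)
    have sX: "s n \<in> X" for n using 6(2) CX by auto
    from complete[OF sX 6(3)] obtain x where x: "x \<in> X" and lim: "(\<lambda>n. nm (s n - x)) \<longlonglongrightarrow> 0"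
      unfolding nm_def by blast
    have "\<exists>a\<in>A. nm (a - s n) < 1 / real (Suc n)" for n
    proof -
      obtain a where a: "\<And>k. a k \<in> A" "(\<lambda>k. nm (a k - s n)) \<longlonglongrightarrow> 0"
        using 6(2)[of n] by (auto simp: seq_closure_def)
      have "\<forall>\<^sub>F k in sequentially. nm (a k - s n) < 1 / real (Suc n)"
        by (rule order_tendstoD(2)[OF a(2)]) simp
      then show ?thesis using a(1) by (meson eventually_False_sequentially eventually_mono)
    qed
    then obtain a where a: "\<And>n. a n \<in> A" "\<And>n. nm (a n - s n) < 1 / real (Suc n)" by metis
    have "(\<lambda>n. nm (a n - x)) \<longlonglongrightarrow> 0"
    proof (rule Lim_null_comparison)
      have "norm (nm (a n - x)) \<le> 1 / real (Suc n) + nm (s n - x)" for n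
        using nm_triangle_diff[OF AX[OF a(1)] sX x, of n n] a(2)[of n] AX[OF a(1)[of n]] x
        by (simp del: of_nat_Suc)
      then show "\<forall>\<^sub>F n in sequentially. norm (nm (a n - x)) \<le> 1 / real (Suc n) + nm (s n - x)"
        by (rule always_eventually[OF allI])
      show "(\<lambda>n. 1 / real (Suc n) + nm (s n - x)) \<longlonglongrightarrow> 0"
        by (intro tendsto_add_zero lim LIMSEQ_Suc[OF lim_1_over_n])
    qed
    then have "x \<in> ?C" using x a(1) by (auto simp: seq_closure_def)
    then show ?case using lim unfolding nm_def by blast
  qed (use CX in \<open>auto simp: ip_simps subset_iff intro: commute nonneg\<close>)
qed

lemma complete_semi_inner_product_inner:
  "complete_semi_inner_product UNIV ((\<bullet>) :: 'h::{real_inner,complete_space} \<Rightarrow> 'h \<Rightarrow> real)"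
proof (unfold_locales, goal_cases)
  case (6 s)
  then have "Cauchy s"
    unfolding Cauchy_def dist_norm norm_eq_sqrt_inner by blast
  then obtain x where "s \<longlonglongrightarrow> x" unfolding Cauchy_convergent_iff convergent_def by blast
  then have "(\<lambda>n. norm (s n - x)) \<longlonglongrightarrow> 0"
    using LIM_zero tendsto_norm_zero by blast
  then show ?case by (auto simp: norm_eq_sqrt_inner)
qed (auto simp: inner_commute inner_add_left inner_add_right)

text \<open>The Riesz theorem supplies a vector for the bounded functional
  \<open>xs \<circ> T\<close>, and testing with the difference of two candidates shows that it is
  unique; so the definite description in \<open>hadjoint\<close> denotes.\<close>

lemma inner_hadjoint:
  fixes T :: "'h::{real_inner,complete_space} \<Rightarrow> 'e::real_normed_vector"
  assumes "bounded_linear T"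
  shows "hadjoint T xs \<bullet> h = blinfun_apply xs (T h)"
proof -
  interpret complete_semi_inner_product UNIV "(\<bullet>) :: 'h \<Rightarrow> 'h \<Rightarrow> real"
    by (rule complete_semi_inner_product_inner)
  interpret f: bounded_linear "\<lambda>h. blinfun_apply xs (T h)"
    using blinfun.bounded_linear_right assms by (rule bounded_linear_compose)
  obtain K where K: "\<And>h. norm (blinfun_apply xs (T h)) \<le> norm h * K" using f.bounded by blast
  obtain g where g: "\<And>h. blinfun_apply xs (T h) = h \<bullet> g"
  proof (rule Riesz[of "\<lambda>h. blinfun_apply xs (T h)" K])
    show "\<bar>blinfun_apply xs (T h)\<bar> \<le> K * nm h" for h
      using K[of h] by (simp add: nm_def norm_eq_sqrt_inner mult.commute)
  qed (auto simp: f.add f.scaleR intro: that)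
  have "hadjoint T xs = g"
    unfolding hadjoint_def
  proof (rule the_equality)
    show "g' = g" if "\<forall>h. g' \<bullet> h = blinfun_apply xs (T h)" for g'
    proof -
      have "(g' - g) \<bullet> h = 0" for h using that g[of h] by (simp add: inner_diff_left inner_commute[of h g])
      from this[of "g' - g"] show ?thesis by simp
    qed
  qed (simp add: g inner_commute)
  then show ?thesis by (simp add: g inner_commute)
qed

lemma hadjoint_unique:
  fixes T :: "'h::{real_inner,complete_space} \<Rightarrow> 'e::real_normed_vector"
  assumes "bounded_linear T" "\<And>h. g \<bullet> h = blinfun_apply xs (T h)"
  shows "hadjoint T xs = g"
proof -
  have "(hadjoint T xs - g) \<bullet> h = 0" for h
    using inner_hadjoint[OF assms(1), of xs h] assms(2)[of h] by (simp add: inner_diff_left inner_commute[of h g])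
  from this[of "hadjoint T xs - g"] show ?thesis by simp
qed

section \<open>Square-integrable functions\<close>

lemma strongly_measurable_norm:
  fixes f :: "'a \<Rightarrow> 'b::real_normed_vector"
  assumes "strongly_measurable M f"
  shows "(\<lambda>x. norm (f x)) \<in> borel_measurable M"
proof -
  obtain s where s: "\<And>n. simple_function M (s n)" "\<And>x. x \<in> space M \<Longrightarrow> (\<lambda>n. s n x) \<longlonglongrightarrow> f x"
    using assms by (auto simp: strongly_measurable_def)
  show ?thesis
  proof (rule borel_measurable_LIMSEQ_real)
    show "(\<lambda>n. norm (s n x)) \<longlonglongrightarrow> norm (f x)" if "x \<in> space M" for x
      by (intro tendsto_norm s that)
    show "(\<lambda>x. norm (s n x)) \<in> borel_measurable M" for n
      using simple_function_compose1[OF s(1), of norm n] by (rule borel_measurable_simple_function)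
  qed
qed

text \<open>The target may be non-separable, where sums of Borel functions need not be Borel. The
  combination is therefore formed on the approximating simple functions.\<close>

lemma strongly_measurable_lincomb:
  fixes f g :: "'a \<Rightarrow> 'b::real_normed_vector"
  assumes "strongly_measurable M f" "strongly_measurable M g"
  shows "strongly_measurable M (\<lambda>x. a *\<^sub>R f x + b *\<^sub>R g x)"
proof -
  obtain s t where s: "\<And>n. simple_function M (s n)" "\<And>x. x \<in> space M \<Longrightarrow> (\<lambda>n. s n x) \<longlonglongrightarrow> f x"
    and t: "\<And>n. simple_function M (t n)" "\<And>x. x \<in> space M \<Longrightarrow> (\<lambda>n. t n x) \<longlonglongrightarrow> g x"
    using assms unfolding strongly_measurable_def by metis
  show ?thesis unfolding strongly_measurable_def
    by (intro exI[of _ "\<lambda>n x. a *\<^sub>R s n x + b *\<^sub>R t n x"] conjI allI ballI tendsto_intros s t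
        simple_function_compose2[where h = "\<lambda>x y. a *\<^sub>R x + b *\<^sub>R y"])
qed

lemma strongly_measurable_scaleR:
  fixes k :: "'b::real_normed_vector"
  assumes "f \<in> borel_measurable M"
  shows "strongly_measurable M (\<lambda>x. f x *\<^sub>R k)"
proof -
  obtain s where s: "\<And>n. simple_function M (s n)" "\<And>x. x \<in> space M \<Longrightarrow> (\<lambda>n. s n x) \<longlonglongrightarrow> f x"
    using borel_measurable_implies_sequence_metric[OF assms, of 0] by blast
  show ?thesis unfolding strongly_measurable_def
    by (intro exI[of _ "\<lambda>n x. s n x *\<^sub>R k"] conjI allI ballI tendsto_intros s
        simple_function_compose1[where g = "\<lambda>x. x *\<^sub>R k"])
qed

lemma strongly_measurable_sum:
  fixes f :: "'i \<Rightarrow> 'a \<Rightarrow> 'b::real_normed_vector"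
  assumes "\<And>j. j \<in> J \<Longrightarrow> strongly_measurable M (f j)"
  shows "strongly_measurable M (\<lambda>x. \<Sum>j\<in>J. f j x)"
  using assms
proof (induction J rule: infinite_finite_induct)
  case (insert j J)
  then show ?case using strongly_measurable_lincomb[of M "f j" "\<lambda>x. \<Sum>j\<in>J. f j x" 1 1] by simp
qed (use strongly_measurable_scaleR[of "\<lambda>_. 0" M 0] in simp_all)

lemma strongly_measurable_real_iff: "strongly_measurable M (f :: 'a \<Rightarrow> real) \<longleftrightarrow> f \<in> borel_measurable M"
proof
  assume "strongly_measurable M f"
  then obtain s where s: "\<And>n. simple_function M (s n)" "\<And>x. x \<in> space M \<Longrightarrow> (\<lambda>n. s n x) \<longlonglongrightarrow> f x"
    by (auto simp: strongly_measurable_def)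
  then show "f \<in> borel_measurable M"
    by (intro borel_measurable_LIMSEQ_real[of M s f] borel_measurable_simple_function)
next
  assume "f \<in> borel_measurable M"
  then show "strongly_measurable M f" using strongly_measurable_scaleR[of f M "1::real"] by simp
qed

lemma L2_real_iff: "f \<in> L2 M \<longleftrightarrow> f \<in> borel_measurable M \<and> integrable M (\<lambda>x. (f x :: real)\<^sup>2)"
  by (simp add: L2_def strongly_measurable_real_iff)

lemma integrable_mult_L2:
  fixes f g :: "'a \<Rightarrow> real"
  assumes "f \<in> L2 M" "g \<in> L2 M"
  shows "integrable M (\<lambda>x. f x * g x)"
proof (rule Bochner_Integration.integrable_bound)
  show "integrable M (\<lambda>x. (f x)\<^sup>2 + (g x)\<^sup>2)" using assms by (simp add: L2_real_iff)
  have "\<bar>f x * g x\<bar> \<le> (f x)\<^sup>2 + (g x)\<^sup>2" for x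
    using sum_squares_bound[of "\<bar>f x\<bar>" "\<bar>g x\<bar>"] mult_nonneg_nonneg[of "\<bar>f x\<bar>" "\<bar>g x\<bar>"]
    unfolding abs_mult power2_abs by linarith
  then show "AE x in M. norm (f x * g x) \<le> norm ((f x)\<^sup>2 + (g x)\<^sup>2)" by simp
qed (use assms in \<open>auto simp: L2_real_iff\<close>)

lemma semi_inner_product_L2: "semi_inner_product (L2 M) (L2inner M :: ('a \<Rightarrow> real) \<Rightarrow> _)"
proof
  show "subspace (L2 M :: ('a \<Rightarrow> real) set)"
  proof (rule subspaceI)
    fix f g :: "'a \<Rightarrow> real" assume fg: "f \<in> L2 M" "g \<in> L2 M"
    have "integrable M (\<lambda>x. (f x)\<^sup>2 + (g x)\<^sup>2 + 2 * (f x * g x))"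
      using fg integrable_mult_L2[OF fg] by (simp add: L2_real_iff)
    then show "f + g \<in> L2 M"
      using fg borel_measurable_add[of f M g] by (auto simp: L2_real_iff plus_fun_def power2_sum mult.assoc)
  qed (auto simp: L2_real_iff zero_fun_def scaleR_fun_def power_mult_distrib)
next
  fix f g h :: "'a \<Rightarrow> real" assume "f \<in> L2 M" "g \<in> L2 M" "h \<in> L2 M"
  then show "L2inner M (f + g) h = L2inner M f h + L2inner M g h"
    by (simp add: L2inner_def plus_fun_def distrib_right integrable_mult_L2)
next
  fix a and f g :: "'a \<Rightarrow> real"
  show "L2inner M (a *\<^sub>R f) g = a * L2inner M f g"
    by (simp add: L2inner_def scaleR_fun_def mult.assoc)
  show "L2inner M f g = L2inner M g f" by (simp add: L2inner_def mult.commute)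
qed (simp add: L2inner_def)

lemma L2norm_eq_sqrt_L2inner: "L2norm M f = sqrt (L2inner M f f)"
  by (simp add: L2norm_def L2inner_def dot_square_norm)

lemma nm_L2inner: "semi_inner_product.nm (L2inner M) = (L2norm M :: ('a \<Rightarrow> real) \<Rightarrow> real)"
  by (rule ext) (simp add: semi_inner_product.nm_def[OF semi_inner_product_L2] L2norm_eq_sqrt_L2inner)

context finite_measure begin

lemma L2_imp_integrable: "f \<in> L2 M \<Longrightarrow> integrable M (f :: 'a \<Rightarrow> real)"
  by (simp add: L2_real_iff square_integrable_imp_integrable)

lemma const_L2: "(\<lambda>_. c :: real) \<in> L2 M" by (simp add: L2_real_iff)

lemma integral_abs_le_L2norm:
  assumes "f \<in> L2 M"
  shows "(\<integral>x. \<bar>f x\<bar> \<partial>M) \<le> L2norm M f * sqrt (measure M (space M))"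
proof -
  have f: "(\<lambda>x. \<bar>f x\<bar>) \<in> L2 M" using assms by (auto simp: L2_real_iff)
  have "\<bar>L2inner M (\<lambda>x. \<bar>f x\<bar>) (\<lambda>_. 1)\<bar> \<le> L2norm M (\<lambda>x. \<bar>f x\<bar>) * L2norm M (\<lambda>_. 1 :: real)"
    using semi_inner_product.Cauchy_Schwarz[OF semi_inner_product_L2 f const_L2] by (simp only: nm_L2inner)
  then have "\<bar>\<integral>x. \<bar>f x\<bar> \<partial>M\<bar> \<le> L2norm M f * sqrt (measure M (space M))"
    by (simp add: L2inner_def L2norm_def)
  then show ?thesis by (rule order_trans[OF abs_ge_self])
qed

text \<open>On a finite measure space a Cauchy sequence in \<open>L2norm\<close> is Cauchy in mean,
  so a subsequence converges almost everywhere; Fatou's lemma then bounds the distance to the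
  pointwise limit by the tail of the sequence.\<close>

lemma complete_semi_inner_product_L2:
  "complete_semi_inner_product (L2 M) (L2inner M :: ('a \<Rightarrow> real) \<Rightarrow> _)"
proof -
  interpret semi_inner_product "L2 M" "L2inner M :: ('a \<Rightarrow> real) \<Rightarrow> _" by (rule semi_inner_product_L2)
  have compl: "\<exists>u\<in>L2 M. (\<lambda>n. L2norm M (s n - u)) \<longlonglongrightarrow> 0"
    if 1: "\<And>n. s n \<in> L2 M" "\<And>e. e > 0 \<Longrightarrow> \<exists>N. \<forall>i\<ge>N. \<forall>j\<ge>N. L2norm M (s i - s j) < e"
    for s :: "nat \<Rightarrow> 'a \<Rightarrow> real"
  proof -
    \<comment> \<open>The added 1 makes \<open>K\<close> positive, so that \<open>e / K\<close> is a
      positive tolerance even for the zero measure.\<close>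
    define K where "K = sqrt (measure M (space M)) + 1"
    have K: "sqrt (measure M (space M)) \<le> K" "K > 0"
      by (simp_all add: K_def add_nonneg_pos)
    have [measurable]: "s n \<in> borel_measurable M" for n using 1(1)[of n] by (simp add: L2_real_iff)
    have sub: "s i - s j \<in> L2 M" for i j using 1(1) by simp
    have "\<exists>N. \<forall>i\<ge>N. \<forall>j\<ge>N. (LINT x|M. norm (s i x - s j x)) < e" if e: "e > 0" for e
    proof -
      obtain N where N: "\<And>i j. i \<ge> N \<Longrightarrow> j \<ge> N \<Longrightarrow> L2norm M (s i - s j) < e / K"
        using 1(2)[OF divide_pos_pos[OF e K(2)]] by blast
      have "(LINT x|M. norm (s i x - s j x)) < e" if ij: "i \<ge> N" "j \<ge> N" for i j
      proof -
        have "(LINT x|M. norm (s i x - s j x)) \<le> L2norm M (s i - s j) * sqrt (measure M (space M))"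
          using integral_abs_le_L2norm[OF sub[of i j]] by simp
        also have "\<dots> \<le> L2norm M (s i - s j) * K"
          using K by (intro mult_left_mono) (auto simp: L2norm_def)
        also have "\<dots> < e" using N[OF ij] K by (simp add: field_simps)
        finally show ?thesis .
      qed
      then show ?thesis by blast
    qed
    from cauchy_L1_AE_cauchy_subseq[OF L2_imp_integrable[OF 1(1)] this]
    obtain r where r: "strict_mono r" "AE x in M. Cauchy (\<lambda>i. s (r i) x)" by blast
    define u where "u x = lim (\<lambda>i. s (r i) x)" for x
    have u[measurable]: "u \<in> borel_measurable M" unfolding u_def by measurable
    have lim: "AE x in M. (\<lambda>i. s (r i) x) \<longlonglongrightarrow> u x"
      using r(2) by eventually_elim (simp add: u_def Cauchy_convergent_iff convergent_LIMSEQ_iff)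
    have est: "s n - u \<in> L2 M \<and> L2norm M (s n - u) \<le> e"
      if e: "e > 0" and N: "\<And>i. i \<ge> N \<Longrightarrow> L2norm M (s i - s n) < e" for n e N
    proof -
      have "(\<integral>\<^sup>+x. ennreal ((s n x - u x)\<^sup>2) \<partial>M) = (\<integral>\<^sup>+x. liminf (\<lambda>k. ennreal ((s n x - s (r k) x)\<^sup>2)) \<partial>M)"
      proof (rule nn_integral_cong_AE)
        show "AE x in M. ennreal ((s n x - u x)\<^sup>2) = liminf (\<lambda>k. ennreal ((s n x - s (r k) x)\<^sup>2))"
          using lim
        proof eventually_elim
          case (elim x)
          then have "(\<lambda>k. ennreal ((s n x - s (r k) x)\<^sup>2)) \<longlonglongrightarrow> ennreal ((s n x - u x)\<^sup>2)"
            by (intro tendsto_intros tendsto_ennrealI)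
          then show ?case by (rule lim_imp_Liminf[OF trivial_limit_sequentially, symmetric])
        qed
      qed
      also have "\<dots> \<le> liminf (\<lambda>k. \<integral>\<^sup>+x. ennreal ((s n x - s (r k) x)\<^sup>2) \<partial>M)"
        by (rule nn_integral_liminf) measurable
      also have "\<dots> \<le> ennreal (e\<^sup>2)"
      proof (rule Liminf_le)
        show "\<forall>\<^sub>F k in sequentially. (\<integral>\<^sup>+x. ennreal ((s n x - s (r k) x)\<^sup>2) \<partial>M) \<le> ennreal (e\<^sup>2)"
        proof (rule eventually_sequentiallyI[of N])
          fix k assume "k \<ge> N"
          then have "r k \<ge> N" using seq_suble[OF r(1), of k] by simp
          then have "L2norm M (s n - s (r k)) < e" using N nm_minus[of "s n" "s (r k)"] 1(1)
            by (simp add: nm_L2inner)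
          then have "(L2norm M (s n - s (r k)))\<^sup>2 \<le> e\<^sup>2"
            by (intro power_mono) (auto simp: L2norm_def)
          then have "(\<integral>x. (s n x - s (r k) x)\<^sup>2 \<partial>M) \<le> e\<^sup>2" by (simp add: L2norm_def)
          moreover have "integrable M (\<lambda>x. (s n x - s (r k) x)\<^sup>2)"
            using sub[of n "r k"] by (simp add: L2_real_iff)
          ultimately show "(\<integral>\<^sup>+x. ennreal ((s n x - s (r k) x)\<^sup>2) \<partial>M) \<le> ennreal (e\<^sup>2)"
            by (subst nn_integral_eq_integral) (auto intro: ennreal_leI)
        qed
      qed simp
      finally have b: "(\<integral>\<^sup>+x. ennreal ((s n x - u x)\<^sup>2) \<partial>M) \<le> ennreal (e\<^sup>2)" .
      then have "integrable M (\<lambda>x. (s n x - u x)\<^sup>2)"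
        by (intro integrableI_bounded) (auto simp: less_top[symmetric] top_unique)
      moreover from this b have "(\<integral>x. (s n x - u x)\<^sup>2 \<partial>M) \<le> e\<^sup>2"
        by (subst (asm) nn_integral_eq_integral) auto
      ultimately have "s n - u \<in> L2 M" "(L2norm M (s n - u))\<^sup>2 \<le> e\<^sup>2"
        by (auto simp: L2_real_iff L2norm_def fun_diff_def)
      then show ?thesis using e by (auto intro: power2_le_imp_le)
    qed
    obtain N0 where "\<And>i. i \<ge> N0 \<Longrightarrow> L2norm M (s i - s N0) < 1" using 1(2)[of 1] by auto
    from est[of 1 N0 N0, OF _ this] have "s N0 - u \<in> L2 M" by simp
    from mem(3)[OF 1(1)[of N0] this] have "u \<in> L2 M" by simp
    moreover have "(\<lambda>n. L2norm M (s n - u)) \<longlonglongrightarrow> 0"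
    proof (rule LIMSEQ_I)
      fix e :: real assume "0 < e"
      then obtain N where N: "\<And>i j. i \<ge> N \<Longrightarrow> j \<ge> N \<Longrightarrow> L2norm M (s i - s j) < e / 2"
        using 1(2)[of "e/2"] by auto
      have "norm (L2norm M (s n - u) - 0) < e" if "n \<ge> N" for n
        using est[of "e/2" N n] N[of _ n] that \<open>0 < e\<close> by (simp add: L2norm_def)
      then show "\<exists>N. \<forall>n\<ge>N. norm (L2norm M (s n - u) - 0) < e" by blast
    qed
    ultimately show ?thesis by blast
  qed
  show ?thesis
    by (rule complete_semi_inner_product.intro[OF semi_inner_product_L2 complete_semi_inner_product_axioms.intro])
      (rule compl[unfolded L2norm_eq_sqrt_L2inner])
qed

end

section \<open>Joint distributions and characteristic functions\<close>

text \<open>Divided by its total mass, a non-negative weight is a probability density. Under the two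
  weighted measures \<open>X\<close> and \<open>Y\<close> have the same characteristic function, and
  Levy's theorem identifies their laws.\<close>

lemma weighted_char_unique:
  fixes X :: "'a \<Rightarrow> real" and Y :: "'a \<Rightarrow> real"
  assumes M: "prob_space M" and N: "prob_space N"
    and [measurable]: "X \<in> borel_measurable M" "Y \<in> borel_measurable N"
      "v \<in> borel_measurable M" "w \<in> borel_measurable N"
    and v: "\<And>x. 0 \<le> v x \<and> v x \<le> (C::real)" and w: "\<And>x. 0 \<le> w x \<and> w x \<le> (C::real)"
    and eq: "\<And>s. (CLINT x|M. complex_of_real (v x) * iexp (s * X x)) = (CLINT x|N. complex_of_real (w x) * iexp (s * Y x))"
    and [measurable]: "A \<in> sets borel"
  shows "(\<integral>x. v x * indicator A (X x) \<partial>M) = (\<integral>x. w x * indicator A (Y x) \<partial>N)"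
proof -
  interpret M: prob_space M by fact
  interpret N: prob_space N by fact
  have vi: "integrable M v" by (rule M.integrable_const_bound[where B = C]) (use v in auto)
  have wi: "integrable N w" by (rule N.integrable_const_bound[where B = C]) (use w in auto)
  define c where "c = (\<integral>x. v x \<partial>M)"
  \<comment> \<open>Frequency 0 shows that the two weights have the same mass.\<close>
  have "complex_of_real c = complex_of_real (\<integral>x. w x \<partial>N)"
    using eq[of 0] by (simp add: c_def)
  then have c': "c = (\<integral>x. w x \<partial>N)" by simp
  have "0 \<le> c" using v by (simp add: c_def)
  show ?thesis
  \<comment> \<open>Without mass there is nothing to normalise, but then both weights vanish almost
    everywhere.\<close>
  proof (cases "c = 0")
    case True
    then have "AE x in M. v x = 0" "AE x in N. w x = 0"
      using vi wi v w c' integral_nonneg_eq_0_iff_AE[OF vi] integral_nonneg_eq_0_iff_AE[OF wi] by (simp_all add: c_def)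
    then have "AE x in M. v x * indicator A (X x) = 0" "AE x in N. w x * indicator A (Y x) = 0" by auto
    then show ?thesis by (simp cong: integral_cong_AE add: integral_eq_zero_AE)
  next
    case False
    then have c: "c > 0" using \<open>0 \<le> c\<close> by simp
    define D where "D = (\<lambda>(K :: 'a measure) u X. distr (density K (\<lambda>x. ennreal (u x / c))) borel (X :: _ \<Rightarrow> real))"
    have D: "real_distribution (D K u Z) \<and> char (D K u Z) = (\<lambda>s. (CLINT x|K. complex_of_real (u x) * iexp (s * Z x)) / c)
       \<and> measure (D K u Z) A = (\<integral>x. u x * indicator A (Z x) \<partial>K) / c"
      if "prob_space K" and [measurable]: "u \<in> borel_measurable K" "Z \<in> borel_measurable K"
        and u: "\<And>x. 0 \<le> u x" "(\<integral>x. u x \<partial>K) = c" "integrable K u" for K :: "'a measure" and u Z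
    proof -
      interpret K: prob_space K by fact
      interpret P: prob_space "density K (\<lambda>x. ennreal (u x / c))"
      proof
        have "emeasure (density K (\<lambda>x. ennreal (u x / c))) (space K) = (\<integral>\<^sup>+x. ennreal (u x / c) \<partial>K)"
          by (subst emeasure_density) (auto intro!: nn_integral_cong)
        also have "\<dots> = ennreal (\<integral>x. u x / c \<partial>K)"
          using u c by (intro nn_integral_eq_integral) auto
        also have "\<dots> = 1" using u c by simp
        finally show "emeasure (density K (\<lambda>x. ennreal (u x / c))) (space (density K (\<lambda>x. ennreal (u x / c)))) = 1" by simp
      qed
      have r: "real_distribution (D K u Z)" unfolding D_def by (rule P.real_distribution_distr) simp
      have "char (D K u Z) s = (CLINT x|K. complex_of_real (u x) * iexp (s * Z x)) / c" for s
      proof -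
        have "char (D K u Z) s = (CLINT x|density K (\<lambda>x. ennreal (u x / c)). iexp (s * Z x))"
          unfolding char_def D_def by (subst integral_distr) auto
        also have "\<dots> = (CLINT x|K. (u x / c) *\<^sub>R iexp (s * Z x))"
          using u c by (subst integral_density) auto
        also have "\<dots> = (CLINT x|K. complex_of_real (u x) * iexp (s * Z x) / c)"
          by (simp add: scaleR_conv_of_real)
        finally show ?thesis by simp
      qed
      moreover have "measure (D K u Z) A = (\<integral>x. u x * indicator A (Z x) \<partial>K) / c"
      proof -
        interpret R: real_distribution "D K u Z" by (rule r)
        have "measure (D K u Z) A = (\<integral>x. indicator A x \<partial>D K u Z)" by simp
        also have "\<dots> = (\<integral>x. indicator A (Z x) \<partial>density K (\<lambda>x. ennreal (u x / c)))"
          unfolding D_def by (subst integral_distr) auto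
        also have "\<dots> = (\<integral>x. (u x / c) *\<^sub>R indicator A (Z x) \<partial>K)"
          using u c by (subst integral_density) auto
        finally show ?thesis by simp
      qed
      ultimately show ?thesis using r by auto
    qed
    have "D M v X = D N w Y"
      using D[of M v X] D[of N w Y] M N v w vi wi eq by (intro Levy_uniqueness) (auto simp: c_def c'[unfolded c_def])
    then have "measure (D M v X) A = measure (D N w Y) A" by simp
    then show ?thesis
      using D[of M v X] D[of N w Y] M N v w vi wi c by (auto simp: c_def c'[unfolded c_def])
  qed
qed

text \<open>
  The exponentials are replaced by indicator functions one coordinate at a time. The complex weight
  contributed by the other coordinates is reduced to the non-negative weights \<open>v\<close>,
  \<open>v * (1 + cos \<Theta>)\<close> and \<open>v * (1 + sin \<Theta>)\<close>.
\<close>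

lemma char_eq_imp_indicator_char_eq:
  fixes X :: "'i \<Rightarrow> 'a \<Rightarrow> real" and Y :: "'i \<Rightarrow> 'a \<Rightarrow> real"
  assumes M: "prob_space M" and N: "prob_space N" and J: "finite J"
    and X: "\<And>j. j \<in> J \<Longrightarrow> X j \<in> borel_measurable M"
    and Y: "\<And>j. j \<in> J \<Longrightarrow> Y j \<in> borel_measurable N"
    and char: "\<And>t. (CLINT x|M. iexp (\<Sum>j\<in>J. t j * X j x)) = (CLINT x|N. iexp (\<Sum>j\<in>J. t j * Y j x))"
    and K: "finite K" "K \<subseteq> J" and A: "\<And>j. A j \<in> sets borel"
  shows "(CLINT x|M. complex_of_real (\<Prod>j\<in>K. indicator (A j) (X j x)) * iexp (\<Sum>j\<in>J-K. t j * X j x))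
    = (CLINT x|N. complex_of_real (\<Prod>j\<in>K. indicator (A j) (Y j x)) * iexp (\<Sum>j\<in>J-K. t j * Y j x))"
  using K
proof (induction arbitrary: t rule: finite_subset_induct')
  case empty
  then show ?case using char by simp
next
  case (insert a K)
  define L where "L = J - insert a K"
  have JK: "J - K = insert a L" "a \<notin> L" "finite L" and L: "L \<subseteq> J" using insert J by (auto simp: L_def)
  define V where "V Z x = (\<Prod>j\<in>K. indicator (A j) (Z j x) :: real)" for Z :: "'i \<Rightarrow> 'a \<Rightarrow> real" and x
  define T where "T Z x = (\<Sum>j\<in>L. t j * Z j x)" for Z :: "'i \<Rightarrow> 'a \<Rightarrow> real" and x
  have V: "0 \<le> V Z x" "V Z x \<le> 1" for Z :: "'i \<Rightarrow> 'a \<Rightarrow> real" and x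
    by (auto simp: V_def intro: prod_nonneg prod_le_1)
  have [measurable]: "V X \<in> borel_measurable M" "T X \<in> borel_measurable M" "X a \<in> borel_measurable M"
    unfolding V_def T_def using X A insert L by (auto intro!: borel_measurable_prod borel_measurable_sum borel_measurable_times measurable_compose[OF _ borel_measurable_indicator])
  have [measurable]: "V Y \<in> borel_measurable N" "T Y \<in> borel_measurable N" "Y a \<in> borel_measurable N"
    unfolding V_def T_def using Y A insert L by (auto intro!: borel_measurable_prod borel_measurable_sum borel_measurable_times measurable_compose[OF _ borel_measurable_indicator])
  note A[measurable]
  \<comment> \<open>\<open>c\<close> takes the values 0, 1 and -1: the last two carry the
    exponentials that make up cosine and sine of \<open>T Z x\<close>.\<close>
  define F where "F Z s c x = complex_of_real (V Z x) * iexp (s * Z a x + c * T Z x)" for Z s c x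
  have E: "(CLINT x|M. F X s c x) = (CLINT x|N. F Y s c x)" for s c
  proof -
    have "(\<Sum>j\<in>J - K. (if j = a then s else c * t j) * Z j x) = s * Z a x + c * T Z x" for Z :: "'i \<Rightarrow> 'a \<Rightarrow> real" and x
    proof -
      have "(\<Sum>j\<in>L. (if j = a then s else c * t j) * Z j x) = (\<Sum>j\<in>L. c * (t j * Z j x))"
        using JK by (intro sum.cong) auto
      then show ?thesis using JK by (simp add: T_def sum_distrib_left)
    qed
    then show ?thesis using insert.IH[of "\<lambda>j. if j = a then s else c * t j"] by (simp add: V_def F_def)
  qed
  have int: "integrable Q (F Z s c)"
    if "prob_space Q" and [measurable]: "V Z \<in> borel_measurable Q" "T Z \<in> borel_measurable Q" "Z a \<in> borel_measurable Q"
    for Q :: "'a measure" and Z s c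
    unfolding F_def
    by (rule finite_measure.integrable_const_bound[OF prob_space.finite_measure[OF that(1)], where B = 1])
       (use V[of Z] in \<open>auto simp: norm_mult simp flip: of_real_mult of_real_add\<close>)
  have rl: "integrable Q (\<lambda>x. V Z x * f (T Z x) * indicator (A a) (Z a x))"
    if "prob_space Q" and [measurable]: "V Z \<in> borel_measurable Q" "T Z \<in> borel_measurable Q" "Z a \<in> borel_measurable Q"
      and [measurable]: "f \<in> borel_measurable borel" and f: "\<And>x. \<bar>f x\<bar> \<le> 1"
    for Q :: "'a measure" and Z and f :: "real \<Rightarrow> real"
    by (rule finite_measure.integrable_const_bound[OF prob_space.finite_measure[OF that(1)], where B = 1])
       (use V[of Z] f in \<open>auto simp: abs_mult indicator_def intro!: mult_le_one\<close>)
  have base: "(\<integral>x. V X x * indicator (A a) (X a x) \<partial>M) = (\<integral>x. V Y x * indicator (A a) (Y a x) \<partial>N)"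
    by (rule weighted_char_unique[OF M N, where C = 1]) (use V E[of _ 0] in \<open>auto simp: F_def\<close>)
  \<comment> \<open>The coefficients \<open>p\<close> and \<open>q\<close> let a single argument
    serve both sine and cosine.\<close>
  have trig: "(\<integral>x. V X x * f (T X x) * indicator (A a) (X a x) \<partial>M) = (\<integral>x. V Y x * f (T Y x) * indicator (A a) (Y a x) \<partial>N)"
    if [measurable]: "f \<in> borel_measurable borel" and f: "\<And>x. \<bar>f x\<bar> \<le> 1"
      and ff: "\<And>x. complex_of_real (f x) = p * iexp x + q * iexp (- x)" for f :: "real \<Rightarrow> real" and p q
  proof -
    have f1: "- 1 \<le> f x" "f x \<le> 1" for x using f[of x] by auto
    have expand: "complex_of_real (V Z x * (1 + f (T Z x))) * iexp (s * Z a x) =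
       F Z s 0 x + (p * F Z s 1 x + q * F Z s (-1) x)" for Z :: "'i \<Rightarrow> 'a \<Rightarrow> real" and x s
      by (simp add: F_def ff exp_add exp_diff exp_minus field_simps)
    have "(\<integral>x. V X x * (1 + f (T X x)) * indicator (A a) (X a x) \<partial>M) = (\<integral>x. V Y x * (1 + f (T Y x)) * indicator (A a) (Y a x) \<partial>N)"
    proof (rule weighted_char_unique[OF M N, where C = 2])
      fix s
      show "(CLINT x|M. complex_of_real (V X x * (1 + f (T X x))) * iexp (s * X a x))
        = (CLINT x|N. complex_of_real (V Y x * (1 + f (T Y x))) * iexp (s * Y a x))"
        unfolding expand using int[OF M, of X] int[OF N, of Y] by (simp add: E)
      show "0 \<le> V X x * (1 + f (T X x)) \<and> V X x * (1 + f (T X x)) \<le> 2" for x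
        using V[of X x] f1[of "T X x"] mult_mono[of "V X x" 1 "1 + f (T X x)" 2] by auto
      show "0 \<le> V Y x * (1 + f (T Y x)) \<and> V Y x * (1 + f (T Y x)) \<le> 2" for x
        using V[of Y x] f1[of "T Y x"] mult_mono[of "V Y x" 1 "1 + f (T Y x)" 2] by auto
    qed measurable
    then show ?thesis
      using base rl[OF M, of X f] rl[OF N, of Y f] rl[OF M, of X "\<lambda>_. 1"] rl[OF N, of Y "\<lambda>_. 1"] f
      by (simp add: distrib_left distrib_right)
  qed
  have sin: "complex_of_real (sin x) = (- \<i> / 2) * iexp x + (\<i> / 2) * iexp (- x)" for x
    by (simp add: complex_eq_iff Re_exp Im_exp)
  have cos: "complex_of_real (cos x) = (1 / 2) * iexp x + (1 / 2) * iexp (- x)" for x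
    by (simp add: complex_eq_iff Re_exp Im_exp)
  have split: "complex_of_real (\<Prod>j\<in>insert a K. indicator (A j) (Z j x)) * iexp (\<Sum>j\<in>J - insert a K. t j * Z j x)
     = complex_of_real (V Z x * cos (T Z x) * indicator (A a) (Z a x)) + \<i> * complex_of_real (V Z x * sin (T Z x) * indicator (A a) (Z a x))"
    for Z :: "'i \<Rightarrow> 'a \<Rightarrow> real" and x
    using insert unfolding L_def[symmetric] T_def[symmetric] by (simp add: V_def complex_eq_iff Re_exp Im_exp)
  show ?case
    unfolding split using rl[OF M, of X sin] rl[OF N, of Y sin] rl[OF M, of X cos] rl[OF N, of Y cos] trig[OF _ _ sin] trig[OF _ _ cos]
    by (simp del: of_real_mult)
qed

text \<open>Once every coordinate has been replaced by an indicator (\<open>K = J\<close>), the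
  preceding lemma compares the probabilities of boxes, and these determine a finite measure on the
  product.\<close>

lemma Cramer_Wold:
  fixes X :: "'i \<Rightarrow> 'a \<Rightarrow> real" and Y :: "'i \<Rightarrow> 'a \<Rightarrow> real"
  assumes M: "prob_space M" and N: "prob_space N" and J: "finite J"
    and X[measurable]: "\<And>j. j \<in> J \<Longrightarrow> X j \<in> borel_measurable M"
    and Y[measurable]: "\<And>j. j \<in> J \<Longrightarrow> Y j \<in> borel_measurable N"
    and char: "\<And>t. (CLINT x|M. iexp (\<Sum>j\<in>J. t j * X j x)) = (CLINT x|N. iexp (\<Sum>j\<in>J. t j * Y j x))"
  shows "distr M (\<Pi>\<^sub>M j\<in>J. borel) (\<lambda>x. \<lambda>j\<in>J. X j x) = distr N (\<Pi>\<^sub>M j\<in>J. borel) (\<lambda>x. \<lambda>j\<in>J. Y j x)"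
proof (rule measure_eqI_PiM_finite[OF J, where M = "\<lambda>_. borel" and A = "\<lambda>_::nat. space (\<Pi>\<^sub>M j\<in>J. borel :: real measure)"])
  interpret M: prob_space M by fact
  interpret N: prob_space N by fact
  have mX[measurable]: "(\<lambda>x. \<lambda>j\<in>J. X j x) \<in> M \<rightarrow>\<^sub>M (\<Pi>\<^sub>M j\<in>J. borel)" by measurable
  have mY[measurable]: "(\<lambda>x. \<lambda>j\<in>J. Y j x) \<in> N \<rightarrow>\<^sub>M (\<Pi>\<^sub>M j\<in>J. borel)" by measurable
  show "range (\<lambda>_::nat. space (\<Pi>\<^sub>M j\<in>J. borel)) \<subseteq> prod_algebra J (\<lambda>_. borel :: real measure)"
    using space_in_prod_algebra[of J "\<lambda>_. borel :: real measure"] by (auto simp: space_PiM)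
  show "emeasure (distr M (\<Pi>\<^sub>M j\<in>J. borel) (\<lambda>x. \<lambda>j\<in>J. X j x)) (space (\<Pi>\<^sub>M j\<in>J. borel)) \<noteq> \<infinity>"
    using finite_measure.emeasure_finite[OF prob_space.finite_measure[OF M.prob_space_distr[OF mX]]] by simp
  fix A :: "'i \<Rightarrow> real set" assume A: "\<And>j. j \<in> J \<Longrightarrow> A j \<in> sets borel"
  \<comment> \<open>The preceding lemma expects a Borel set at every index, while \<open>A\<close>
    is known to be Borel only on \<open>J\<close>.\<close>
  define A' where "A' j = (if j \<in> J then A j else {})" for j
  have A': "A' j \<in> sets borel" for j using A by (simp add: A'_def)
  have PA: "Pi\<^sub>E J A = Pi\<^sub>E J A'" by (rule PiE_cong) (simp add: A'_def)
  have [measurable]: "Pi\<^sub>E J A' \<in> sets (\<Pi>\<^sub>M j\<in>J. borel)" using A' J by (intro sets_PiM_I_finite) auto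
  have box: "measure (distr Q (\<Pi>\<^sub>M j\<in>J. borel) (\<lambda>x. \<lambda>j\<in>J. Z j x)) (Pi\<^sub>E J A') = (\<integral>x. (\<Prod>j\<in>J. indicator (A' j) (Z j x)) \<partial>Q)"
    if "(\<lambda>x. \<lambda>j\<in>J. Z j x) \<in> Q \<rightarrow>\<^sub>M (\<Pi>\<^sub>M j\<in>J. borel)" for Q :: "'a measure" and Z :: "'i \<Rightarrow> 'a \<Rightarrow> real"
  proof -
    note that[measurable]
    have "measure (distr Q (\<Pi>\<^sub>M j\<in>J. borel) (\<lambda>x. \<lambda>j\<in>J. Z j x)) (Pi\<^sub>E J A') = measure Q ((\<lambda>x. \<lambda>j\<in>J. Z j x) -` Pi\<^sub>E J A' \<inter> space Q)"
      by (rule measure_distr) measurable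
    also have "\<dots> = (\<integral>x. indicator ((\<lambda>x. \<lambda>j\<in>J. Z j x) -` Pi\<^sub>E J A' \<inter> space Q) x \<partial>Q)" by simp
    also have "\<dots> = (\<integral>x. (\<Prod>j\<in>J. indicator (A' j) (Z j x)) \<partial>Q)"
    proof (rule Bochner_Integration.integral_cong[OF refl])
      fix x assume "x \<in> space Q"
      then show "indicator ((\<lambda>x. \<lambda>j\<in>J. Z j x) -` Pi\<^sub>E J A' \<inter> space Q) x = (\<Prod>j\<in>J. indicator (A' j) (Z j x) :: real)"
        using J by (cases "\<forall>j\<in>J. Z j x \<in> A' j") (auto simp: indicator_def PiE_iff intro!: prod_zero)
    qed
    finally show ?thesis .
  qed
  have "(CLINT x|M. complex_of_real (\<Prod>j\<in>J. indicator (A' j) (X j x))) = (CLINT x|N. complex_of_real (\<Prod>j\<in>J. indicator (A' j) (Y j x)))"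
    using char_eq_imp_indicator_char_eq[OF M N J X Y char J subset_refl, of A' "\<lambda>_. 0"] A' by simp
  then have "(\<integral>x. (\<Prod>j\<in>J. indicator (A' j) (X j x)) \<partial>M) = (\<integral>x. (\<Prod>j\<in>J. indicator (A' j) (Y j x) :: real) \<partial>N)"
    by (simp only: integral_complex_of_real of_real_eq_iff)
  then have "measure (distr M (\<Pi>\<^sub>M j\<in>J. borel) (\<lambda>x. \<lambda>j\<in>J. X j x)) (Pi\<^sub>E J A) = measure (distr N (\<Pi>\<^sub>M j\<in>J. borel) (\<lambda>x. \<lambda>j\<in>J. Y j x)) (Pi\<^sub>E J A)"
    unfolding PA box[OF mX] box[OF mY] .
  then show "emeasure (distr M (\<Pi>\<^sub>M j\<in>J. borel) (\<lambda>x. \<lambda>j\<in>J. X j x)) (Pi\<^sub>E J A) = emeasure (distr N (\<Pi>\<^sub>M j\<in>J. borel) (\<lambda>x. \<lambda>j\<in>J. Y j x)) (Pi\<^sub>E J A)"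
    by (simp add: prob_space.finite_measure[OF M.prob_space_distr] prob_space.finite_measure[OF N.prob_space_distr] finite_measure.emeasure_eq_measure)
qed auto

lemma centred_gaussian_L2_char:
  assumes M: "prob_space M" and X: "centred_gaussian M X"
  shows "X \<in> L2 M" "(CLINT x|M. iexp (X x)) = exp (- (L2norm M X)\<^sup>2 / 2)"
proof -
  interpret prob_space M by fact
  have [measurable]: "X \<in> borel_measurable M" using X by (simp add: centred_gaussian_def)
  have "X \<in> L2 M \<and> (CLINT x|M. iexp (X x)) = exp (- (L2norm M X)\<^sup>2 / 2)"
  proof (cases "AE x in M. X x = 0")
    case True
    have "integrable M (\<lambda>x. (X x)\<^sup>2) \<longleftrightarrow> integrable M (\<lambda>x. 0 :: real)"
      by (rule integrable_cong_AE) (use True in auto)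
    moreover have "(\<integral>x. (X x)\<^sup>2 \<partial>M) = (\<integral>x. 0 \<partial>M)"
      by (rule integral_cong_AE) (use True in auto)
    moreover have "(CLINT x|M. iexp (X x)) = (CLINT x|M. 1)"
      by (rule integral_cong_AE) (use True in auto)
    ultimately show ?thesis by (simp add: L2_real_iff L2norm_def prob_space)
  next
    case False
    then obtain \<sigma> where \<sigma>: "\<sigma> > 0" and d: "distributed M lborel X (normal_density 0 \<sigma>)"
      using X by (auto simp: centred_gaussian_def)
    have i: "integrable M (\<lambda>x. (X x)\<^sup>2)"
      using integrable_normal_moment[OF \<sigma>, of 0 2]
      by (subst distributed_integrable[OF d, symmetric]) (auto simp: normal_density_nonneg)
    have v: "(\<integral>x. (X x)\<^sup>2 \<partial>M) = \<sigma>\<^sup>2"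
      using normal_distributed_variance[OF \<sigma> d] normal_distributed_expectation[OF \<sigma> d] by simp
    \<comment> \<open>The characteristic function of \<open>X\<close> at 1 is that of the standard
      normal variable \<open>X / \<sigma>\<close> at \<open>\<sigma>\<close>.\<close>
    have "distributed M lborel (\<lambda>x. (X x - 0) / \<sigma>) std_normal_density"
      using d normal_standard_normal_convert[OF \<sigma>] by blast
    then have "distr M lborel (\<lambda>x. X x / \<sigma>) = std_normal_distribution"
      by (simp add: distributed_def)
    then have "complex_of_real (exp (- (\<sigma>\<^sup>2) / 2)) = char (distr M lborel (\<lambda>x. X x / \<sigma>)) \<sigma>"
      by (simp add: char_std_normal_distribution)
    also have "\<dots> = (CLINT x|M. iexp (X x))"
      unfolding char_def using \<sigma> by (subst integral_distr) auto
    finally show ?thesis using i v by (simp add: L2_real_iff L2norm_def)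
  qed
  then show "X \<in> L2 M" "(CLINT x|M. iexp (X x)) = exp (- (L2norm M X)\<^sup>2 / 2)" by auto
qed

section \<open>A Gaussian variance inequality\<close>

lemma C1b_cong: "C1b n \<phi> d\<phi> \<Longrightarrow> (\<And>k. k < n \<Longrightarrow> x k = y k) \<Longrightarrow> \<phi> x = \<phi> y"
  by (simp add: C1b_def)

text \<open>\<open>C1b\<close> states only for \<open>\<phi>\<close> that coordinates from
  \<open>n\<close> on are irrelevant; the partial derivatives inherit this because a derivative is
  unique.\<close>

lemma C1b_partial_cong:
  assumes "C1b n \<phi> d\<phi>" "j < n" "\<And>k. k < n \<Longrightarrow> x k = y k"
  shows "d\<phi> j x = d\<phi> j y"
proof (rule DERIV_unique)
  show "((\<lambda>s. \<phi> (x(j := s))) has_real_derivative d\<phi> j x) (at (x j))"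
    using assms(1,2) by (simp add: C1b_def)
  have "\<phi> (x(j := s)) = \<phi> (y(j := s))" for s
    by (rule C1b_cong[OF assms(1)]) (simp add: assms(3))
  moreover have "((\<lambda>s. \<phi> (y(j := s))) has_real_derivative d\<phi> j y) (at (y j))"
    using assms(1,2) by (simp add: C1b_def)
  ultimately show "((\<lambda>s. \<phi> (x(j := s))) has_real_derivative d\<phi> j y) (at (x j))"
    using assms(3)[OF assms(2)] by simp
qed

text \<open>The passage from \<open>x\<close> to \<open>y\<close> changes one coordinate at a time,
  with the mean value theorem for each change; hence each partial derivative has its own
  intermediate point \<open>\<xi> j\<close>.\<close>

lemma C1b_increment:
  assumes C: "C1b n \<phi> d\<phi>"
  obtains \<xi> where "\<And>j k. \<bar>\<xi> j k - x k\<bar> \<le> \<bar>y k - x k\<bar>" "\<phi> y - \<phi> x = (\<Sum>j<n. d\<phi> j (\<xi> j) * (y j - x j))"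
proof -
  \<comment> \<open>\<open>c j\<close> has taken its first \<open>j\<close> coordinates from
    \<open>y\<close>. Below, \<open>x\<close> serves as a dummy intermediate point for
    \<open>j \<ge> n\<close>.\<close>
  define c where "c j k = (if k < j then y k else x k)" for j k :: nat
  have "\<exists>\<xi>. (\<forall>k. \<bar>\<xi> k - x k\<bar> \<le> \<bar>y k - x k\<bar>) \<and> (j < n \<longrightarrow> \<phi> (c (Suc j)) - \<phi> (c j) = d\<phi> j \<xi> * (y j - x j))" for j
  proof (cases "j < n")
    case True
    define f where "f s = \<phi> ((c j)(j := s))" for s
    have D: "(f has_real_derivative d\<phi> j ((c j)(j := s))) (at s)" for s
    proof -
      have "((\<lambda>r. \<phi> (((c j)(j := s))(j := r))) has_real_derivative d\<phi> j ((c j)(j := s))) (at (((c j)(j := s)) j))"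
        using C True unfolding C1b_def by blast
      then show ?thesis by (simp add: f_def[abs_def])
    qed
    have "\<exists>s. \<bar>s - x j\<bar> \<le> \<bar>y j - x j\<bar> \<and> f (y j) - f (x j) = d\<phi> j ((c j)(j := s)) * (y j - x j)"
    proof (cases "x j" "y j" rule: linorder_cases)
      case less
      from MVT2[OF less, of f "\<lambda>s. d\<phi> j ((c j)(j := s))"] D
      obtain z where "x j < z" "z < y j" "f (y j) - f (x j) = (y j - x j) * d\<phi> j ((c j)(j := z))" by blast
      then show ?thesis by (intro exI[of _ z]) (auto simp: mult.commute)
    next
      case equal
      then show ?thesis by (intro exI[of _ "x j"]) auto
    next
      case greater
      from MVT2[OF greater, of f "\<lambda>s. d\<phi> j ((c j)(j := s))"] D
      obtain z where "y j < z" "z < x j" "f (x j) - f (y j) = (x j - y j) * d\<phi> j ((c j)(j := z))" by blast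
      then show ?thesis by (intro exI[of _ z]) (auto simp: algebra_simps)
    qed
    then obtain s where s: "\<bar>s - x j\<bar> \<le> \<bar>y j - x j\<bar>" "f (y j) - f (x j) = d\<phi> j ((c j)(j := s)) * (y j - x j)" by blast
    have "(c j)(j := y j) = c (Suc j)" "(c j)(j := x j) = c j"
      by (auto simp: c_def fun_eq_iff less_Suc_eq)
    then show ?thesis using s by (intro exI[of _ "(c j)(j := s)"]) (auto simp: f_def c_def)
  qed (auto intro: exI[of _ x])
  then obtain \<xi> where \<xi>: "\<And>j k. \<bar>\<xi> j k - x k\<bar> \<le> \<bar>y k - x k\<bar>"
      "\<And>j. j < n \<Longrightarrow> \<phi> (c (Suc j)) - \<phi> (c j) = d\<phi> j (\<xi> j) * (y j - x j)" by metis
  have "\<phi> y = \<phi> (c n)" using C by (simp add: C1b_def c_def)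
  moreover have "x = c 0" by (simp add: c_def fun_eq_iff)
  ultimately have "\<phi> y - \<phi> x = \<phi> (c n) - \<phi> (c 0)" by simp
  also have "\<dots> = (\<Sum>j<n. \<phi> (c (Suc j)) - \<phi> (c j))"
    by (rule sum_lessThan_telescope[symmetric])
  also have "\<dots> = (\<Sum>j<n. d\<phi> j (\<xi> j) * (y j - x j))" using \<xi>(2) by simp
  finally show ?thesis using that \<xi>(1) by blast
qed

lemma C1b_partial_bounded:
  assumes "C1b n \<phi> d\<phi>"
  obtains C where "0 \<le> C" "\<And>j x. j < n \<Longrightarrow> \<bar>d\<phi> j x\<bar> \<le> C"
proof -
  have "\<exists>C. \<forall>x. \<bar>d\<phi> j x\<bar> \<le> C" if "j < n" for j
    using assms that by (auto simp: C1b_def bounded_real)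
  then obtain C where C: "\<And>j x. j < n \<Longrightarrow> \<bar>d\<phi> j x\<bar> \<le> C j" by metis
  show ?thesis
  proof (rule that[of "\<Sum>j<n. \<bar>C j\<bar>"])
    fix j x assume "j < n"
    then have "\<bar>C j\<bar> \<le> (\<Sum>j<n. \<bar>C j\<bar>)" by (intro member_le_sum) auto
    then show "\<bar>d\<phi> j x\<bar> \<le> (\<Sum>j<n. \<bar>C j\<bar>)" using C[OF \<open>j < n\<close>, of x] by linarith
  qed (simp add: sum_nonneg)
qed

lemma tendsto_coordinatewise:
  fixes f :: "'c \<Rightarrow> 'i \<Rightarrow> 'b::topological_space"
  shows "(\<And>i. ((\<lambda>c. f c i) \<longlongrightarrow> l i) F) \<Longrightarrow> (f \<longlongrightarrow> l) F"
  using limitin_componentwise[of "\<lambda>_. euclidean" UNIV f l F]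
  by (simp add: limitin_canonical_iff euclidean_product_topology)

text \<open>The intermediate points of \<open>C1b_increment\<close> are squeezed to \<open>x\<close>
  along with \<open>y m\<close>, so continuity of the partial derivatives takes the place of total
  differentiability. \<open>a m\<close> will be the reciprocal of the step length, up to the factor
  \<open>pi / 2\<close>.\<close>

lemma C1b_difference_quotient_tendsto:
  fixes a :: "nat \<Rightarrow> real"
  assumes C: "C1b n \<phi> d\<phi>" and y: "\<And>k. (\<lambda>m. y m k) \<longlonglongrightarrow> x k"
    and v: "\<And>j. j < n \<Longrightarrow> (\<lambda>m. a m * (y m j - x j)) \<longlonglongrightarrow> v j"
  shows "(\<lambda>m. a m * (\<phi> (y m) - \<phi> x)) \<longlonglongrightarrow> (\<Sum>j<n. d\<phi> j x * v j)"
proof -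
  have "\<exists>\<xi>. (\<forall>j k. \<bar>\<xi> j k - x k\<bar> \<le> \<bar>y m k - x k\<bar>) \<and> \<phi> (y m) - \<phi> x = (\<Sum>j<n. d\<phi> j (\<xi> j) * (y m j - x j))" for m
    using C1b_increment[OF C, of x "y m"] by metis
  then obtain \<xi> where \<xi>: "\<And>m j k. \<bar>\<xi> m j k - x k\<bar> \<le> \<bar>y m k - x k\<bar>"
      "\<And>m. \<phi> (y m) - \<phi> x = (\<Sum>j<n. d\<phi> j (\<xi> m j) * (y m j - x j))" by metis
  have lim: "(\<lambda>m. \<xi> m j) \<longlonglongrightarrow> x" for j
  proof (rule tendsto_coordinatewise)
    fix k
    have "(\<lambda>m. \<xi> m j k - x k) \<longlonglongrightarrow> 0"
      by (rule Lim_null_comparison[where g = "\<lambda>m. \<bar>y m k - x k\<bar>"])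
         (use \<xi>(1) tendsto_rabs_zero[OF LIM_zero[OF y[of k]]] in auto)
    then show "(\<lambda>m. \<xi> m j k) \<longlonglongrightarrow> x k" by (simp add: LIM_zero_iff)
  qed
  have d: "(\<lambda>m. d\<phi> j (\<xi> m j)) \<longlonglongrightarrow> d\<phi> j x" if "j < n" for j
    using C that continuous_on_tendsto_compose[OF _ lim, of UNIV "d\<phi> j"] by (auto simp: C1b_def)
  have "(\<lambda>m. \<Sum>j<n. d\<phi> j (\<xi> m j) * (a m * (y m j - x j))) \<longlonglongrightarrow> (\<Sum>j<n. d\<phi> j x * v j)"
    by (intro tendsto_sum tendsto_mult d v) auto
  then show ?thesis by (simp add: \<xi>(2) sum_distrib_left mult_ac)
qed

section \<open>Two independent copies and their rotation\<close>

context prob_space begin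

lemma integrable_pair_fst:
  assumes "integrable M (f :: 'a \<Rightarrow> real)" shows "integrable (M \<Otimes>\<^sub>M M) (\<lambda>p. f (fst p))"
    and "integral\<^sup>L (M \<Otimes>\<^sub>M M) (\<lambda>p. f (fst p)) = integral\<^sup>L M f"
proof -
  have "integrable (distr (M \<Otimes>\<^sub>M M) M fst) f" using assms by (simp add: distr_pair_fst)
  then show "integrable (M \<Otimes>\<^sub>M M) (\<lambda>p. f (fst p))" by (subst (asm) integrable_distr_eq) (use assms in auto)
  have "integral\<^sup>L (distr (M \<Otimes>\<^sub>M M) M fst) f = integral\<^sup>L (M \<Otimes>\<^sub>M M) (\<lambda>p. f (fst p))"
    by (subst integral_distr) (use assms in auto)
  then show "integral\<^sup>L (M \<Otimes>\<^sub>M M) (\<lambda>p. f (fst p)) = integral\<^sup>L M f" by (simp add: distr_pair_fst)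
qed

lemma integrable_pair_snd:
  assumes "integrable M (f :: 'a \<Rightarrow> real)" shows "integrable (M \<Otimes>\<^sub>M M) (\<lambda>p. f (snd p))"
    and "integral\<^sup>L (M \<Otimes>\<^sub>M M) (\<lambda>p. f (snd p)) = integral\<^sup>L M f"
proof -
  interpret pair_sigma_finite M M ..
  have e: "(\<lambda>(x, y). f x) = (\<lambda>p. f (fst p))" by auto
  show "integrable (M \<Otimes>\<^sub>M M) (\<lambda>p. f (snd p))"
    using integrable_product_swap_iff[of "\<lambda>p. f (snd p)"] integrable_pair_fst(1)[OF assms] by (simp add: e)
  have "(\<lambda>p. f (snd p)) \<in> borel_measurable (M \<Otimes>\<^sub>M M)" using assms by measurable
  then show "integral\<^sup>L (M \<Otimes>\<^sub>M M) (\<lambda>p. f (snd p)) = integral\<^sup>L M f"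
    using integral_product_swap[of "\<lambda>p. f (snd p)"] integrable_pair_fst(2)[OF assms] by (simp add: e)
qed

end

lemma sum_fun_apply: "(\<Sum>j\<in>J. f j) x = (\<Sum>j\<in>J. f j x)"
  by (induction J rule: infinite_finite_induct) auto

text \<open>That the \<open>h j\<close> are jointly Gaussian is encoded by the characteristic
  function of every single element of \<open>G\<close>: being a subspace, \<open>G\<close> contains
  all linear combinations of the \<open>h j\<close>. It will be \<open>H_infty\<close>.\<close>

locale gaussian_cylinder_function = prob_space M for M :: "'a measure" +
  fixes G :: "('a \<Rightarrow> real) set"
    and n :: nat and h :: "nat \<Rightarrow> 'a \<Rightarrow> real" and \<phi> :: "(nat \<Rightarrow> real) \<Rightarrow> real" and d\<phi>
  assumes G: "subspace G" "G \<subseteq> L2 M"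
    and G_char: "\<And>g. g \<in> G \<Longrightarrow> (CLINT x|M. iexp (g x)) = exp (- (L2norm M g)\<^sup>2 / 2)"
    and C: "C1b n \<phi> d\<phi>" and h: "\<And>j. j < n \<Longrightarrow> h j \<in> G"
begin

sublocale PP: pair_prob_space M M ..

lemma h_measurable: "j < n \<Longrightarrow> h j \<in> borel_measurable M"
  using h[of j] G by (auto simp: L2_real_iff)

text \<open>The value 0 from \<open>n\<close> on makes \<open>rot \<theta>\<close> measurable
  although nothing is known of \<open>h j\<close> for \<open>j \<ge> n\<close>;
  \<open>\<phi>\<close> does not see these coordinates.\<close>

definition rot :: "real \<Rightarrow> 'a \<times> 'a \<Rightarrow> nat \<Rightarrow> real"
  where "rot \<theta> p j = (if j < n then cos \<theta> * h j (fst p) + sin \<theta> * h j (snd p) else 0)"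

lemma rot_measurable: "rot \<theta> \<in> borel_measurable (M \<Otimes>\<^sub>M M)"
proof (rule measurable_coordinatewise_then_product)
  fix j show "(\<lambda>p. rot \<theta> p j) \<in> borel_measurable (M \<Otimes>\<^sub>M M)"
    unfolding rot_def using h_measurable[of j] by (cases "j < n") simp_all
qed

lemma \<phi>_measurable: "\<phi> \<in> borel_measurable borel" and d\<phi>_measurableurable: "j < n \<Longrightarrow> d\<phi> j \<in> borel_measurable borel"
  using C by (auto simp: C1b_def intro: borel_measurable_continuous_onI)

text \<open>The exponent is an element \<open>u\<close> of \<open>G\<close> at the first copy plus
  an element \<open>w\<close> of \<open>G\<close> at the second. By independence the squared norms
  of \<open>u\<close> and \<open>w\<close> add up, and the addition theorem for the cosine leaves
  only \<alpha> - \<beta> in the mixed term.\<close>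

lemma char_rot:
  fixes t :: "bool \<Rightarrow> nat \<Rightarrow> real"
  defines "P \<equiv> (\<lambda>b x. \<Sum>j<n. t b j * h j x)"
  shows "(CLINT p|M \<Otimes>\<^sub>M M. iexp ((\<Sum>j<n. t True j * rot \<alpha> p j) + (\<Sum>j<n. t False j * rot \<beta> p j)))
    = exp (- (L2inner M (P True) (P True) + L2inner M (P False) (P False) + 2 * cos (\<alpha> - \<beta>) * L2inner M (P True) (P False)) / 2)"
proof -
  have PG: "P b \<in> G" for b
  proof -
    have "(\<Sum>j<n. t b j *\<^sub>R h j) \<in> G" by (intro subspace_sum subspace_scale G h) auto
    also have "(\<Sum>j<n. t b j *\<^sub>R h j) = P b" by (simp add: P_def fun_eq_iff scaleR_fun_def sum_fun_apply)
    finally show ?thesis .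
  qed
  have PL: "P b \<in> L2 M" for b using PG G by auto
  interpret semi_inner_product "L2 M" "L2inner M :: ('a \<Rightarrow> real) \<Rightarrow> _" by (rule semi_inner_product_L2)
  define u where "u = cos \<alpha> *\<^sub>R P True + cos \<beta> *\<^sub>R P False"
  define w where "w = sin \<alpha> *\<^sub>R P True + sin \<beta> *\<^sub>R P False"
  have u: "u \<in> G" and w: "w \<in> G" unfolding u_def w_def using PG G by (auto intro!: subspace_add subspace_scale)
  have [measurable]: "u \<in> borel_measurable M" "w \<in> borel_measurable M"
    using u w G by (auto simp: L2_real_iff)
  have exponent: "(\<Sum>j<n. t True j * rot \<alpha> p j) + (\<Sum>j<n. t False j * rot \<beta> p j) = u (fst p) + w (snd p)" for p
  proof -
    have "(\<Sum>j<n. s j * rot \<gamma> p j) = cos \<gamma> * (\<Sum>j<n. s j * h j (fst p)) + sin \<gamma> * (\<Sum>j<n. s j * h j (snd p))" for s \<gamma>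
      unfolding rot_def sum_distrib_left sum.distrib[symmetric] by (intro sum.cong) (auto simp: algebra_simps)
    then show ?thesis by (simp add: u_def w_def P_def scaleR_fun_def)
  qed
  have "(CLINT p|M \<Otimes>\<^sub>M M. iexp (u (fst p) + w (snd p))) = (CLINT x|M. CLINT y|M. iexp (u x + w y))"
    by (subst PP.integral_fst'[symmetric])
       (auto intro!: PP.P.integrable_const_bound[where B = 1] simp del: of_real_add)
  also have "\<dots> = (CLINT x|M. iexp (u x) * (CLINT y|M. iexp (w y)))"
    by (simp add: exp_add distrib_left)
  also have "\<dots> = complex_of_real (exp (- (L2norm M u)\<^sup>2 / 2) * exp (- (L2norm M w)\<^sup>2 / 2))"
    using G_char[OF u] G_char[OF w] by simp
  also have "exp (- (L2norm M u)\<^sup>2 / 2) * exp (- (L2norm M w)\<^sup>2 / 2) = exp (- (L2inner M u u + L2inner M w w) / 2)"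
    using u w G nm_sq[of u] nm_sq[of w] by (simp add: nm_L2inner subset_iff exp_add[symmetric] add_divide_distrib)
  also have "L2inner M u u + L2inner M w w =
     L2inner M (P True) (P True) + L2inner M (P False) (P False) + 2 * cos (\<alpha> - \<beta>) * L2inner M (P True) (P False)"
  proof -
    have *: "L2inner M (a *\<^sub>R P True + b *\<^sub>R P False) (a *\<^sub>R P True + b *\<^sub>R P False) =
      a\<^sup>2 * L2inner M (P True) (P True) + b\<^sup>2 * L2inner M (P False) (P False) + 2 * (a * b) * L2inner M (P True) (P False)" for a b
      using PL[of True] PL[of False] commute[of "P False" "P True"] by (simp add: ip_simps power2_eq_square algebra_simps)
    have "x * (cos \<gamma>)\<^sup>2 + x * (sin \<gamma>)\<^sup>2 = x" for x \<gamma> :: real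
      by (metis distrib_left mult.right_neutral sin_cos_squared_add2)
    then show ?thesis unfolding u_def w_def * cos_diff by (simp add: algebra_simps)
  qed
  finally show ?thesis unfolding exponent by simp
qed

text \<open>
  By \<open>char_rot\<close> the joint characteristic function of \<open>rot \<alpha>\<close> and \<open>rot \<beta>\<close> depends only on \<open>\<alpha> - \<beta>\<close>.
\<close>

lemma rot_increment_invariant:
  "(\<integral>p. (\<phi> (rot (\<theta> + \<delta>) p) - \<phi> (rot \<theta> p))\<^sup>2 \<partial>(M \<Otimes>\<^sub>M M)) = (\<integral>p. (\<phi> (rot \<delta> p) - \<phi> (rot 0 p))\<^sup>2 \<partial>(M \<Otimes>\<^sub>M M))"
proof -
  \<comment> \<open>\<open>True\<close> marks the vector after the step and \<open>False\<close> the
    one before it, so that one law describes the pair.\<close>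
  define J where "J = (UNIV :: bool set) \<times> {..<n}"
  define X where "X \<theta> = (\<lambda>(b, j) p. rot (if b then \<theta> + \<delta> else \<theta>) p j)" for \<theta>
  have J: "finite J" by (simp add: J_def)
  have sumJ: "(\<Sum>i\<in>J. t i * X \<theta> i p) = (\<Sum>j<n. t (True, j) * rot (\<theta> + \<delta>) p j) + (\<Sum>j<n. t (False, j) * rot \<theta> p j)" for t \<theta> p
  proof -
    have "(\<Sum>i\<in>J. t i * X \<theta> i p) = (\<Sum>b\<in>UNIV. \<Sum>j<n. t (b, j) * X \<theta> (b, j) p)"
      unfolding J_def sum.cartesian_product by (simp add: split_beta)
    then show ?thesis by (simp add: X_def UNIV_bool)
  qed
  have X: "X \<theta> i \<in> borel_measurable (M \<Otimes>\<^sub>M M)" for \<theta> i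
    using measurable_compose[OF rot_measurable, of "\<lambda>f. f (snd i)" borel] by (auto simp: X_def split_beta)
  let ?PM = "\<Pi>\<^sub>M i\<in>J. (borel :: real measure)"
  have law: "distr (M \<Otimes>\<^sub>M M) ?PM (\<lambda>p. \<lambda>i\<in>J. X \<theta> i p) = distr (M \<Otimes>\<^sub>M M) ?PM (\<lambda>p. \<lambda>i\<in>J. X 0 i p)"
    by (rule Cramer_Wold[OF PP.P.prob_space_axioms PP.P.prob_space_axioms J X X])
       (use char_rot[of "\<lambda>b j. _ (b, j)"] in \<open>simp add: sumJ\<close>)
  define ex where "ex b v = (\<lambda>j. if j < n then v (b, j) else 0)" for b and v :: "bool \<times> nat \<Rightarrow> real"
  have ex: "ex b \<in> borel_measurable ?PM" for b
  proof (rule measurable_coordinatewise_then_product)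
    fix j show "(\<lambda>v. ex b v j) \<in> borel_measurable ?PM"
      unfolding ex_def by (cases "j < n") (auto simp: J_def)
  qed
  define \<Psi> where "\<Psi> v = (\<phi> (ex True v) - \<phi> (ex False v))\<^sup>2" for v
  have \<Psi>: "\<Psi> \<in> borel_measurable ?PM"
    unfolding \<Psi>_def using measurable_compose[OF ex \<phi>_measurable] by measurable
  have mX: "(\<lambda>p. \<lambda>i\<in>J. X \<theta> i p) \<in> M \<Otimes>\<^sub>M M \<rightarrow>\<^sub>M ?PM" for \<theta>
    using X by measurable
  have "\<Psi> (\<lambda>i\<in>J. X \<theta> i p) = (\<phi> (rot (\<theta> + \<delta>) p) - \<phi> (rot \<theta> p))\<^sup>2" for \<theta> p
  proof -
    have "ex True (\<lambda>i\<in>J. X \<theta> i p) = rot (\<theta> + \<delta>) p" "ex False (\<lambda>i\<in>J. X \<theta> i p) = rot \<theta> p"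
      by (auto simp: ex_def J_def X_def rot_def fun_eq_iff)
    then show ?thesis by (simp add: \<Psi>_def)
  qed
  then have "(\<integral>p. (\<phi> (rot (\<theta> + \<delta>) p) - \<phi> (rot \<theta> p))\<^sup>2 \<partial>(M \<Otimes>\<^sub>M M)) = integral\<^sup>L (distr (M \<Otimes>\<^sub>M M) ?PM (\<lambda>p. \<lambda>i\<in>J. X \<theta> i p)) \<Psi>" for \<theta>
    by (subst integral_distr[OF mX \<Psi>]) simp
  from this[of \<theta>] this[of 0] law show ?thesis by simp
qed

lemma \<phi>_rot_measurable: "(\<lambda>p. \<phi> (rot \<theta> p)) \<in> borel_measurable (M \<Otimes>\<^sub>M M)"
  by (rule measurable_compose[OF rot_measurable \<phi>_measurable])

lemma integrable_increment: "integrable (M \<Otimes>\<^sub>M M) (\<lambda>p. (\<phi> (rot \<alpha> p) - \<phi> (rot \<beta> p))\<^sup>2)"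
proof -
  obtain B where B: "\<And>x. \<bar>\<phi> x\<bar> \<le> B" using C by (auto simp: C1b_def bounded_real)
  have "\<bar>\<phi> x - \<phi> y\<bar> \<le> 2 * B" for x y using B[of x] B[of y] by linarith
  then have "(\<phi> x - \<phi> y)\<^sup>2 \<le> (2 * B)\<^sup>2" for x y
    by (metis abs_ge_zero power2_abs power_mono)
  then show ?thesis using \<phi>_rot_measurable by (intro PP.P.integrable_const_bound[where B = "(2 * B)\<^sup>2"]) auto
qed

text \<open>The quarter turn telescopes into \<open>K\<close> increments. Cauchy-Schwarz for the sum
  costs one factor \<open>K\<close>, and the \<open>K\<close> identically distributed terms give
  another; placed under the square, they turn the increment into a difference quotient.\<close>

lemma rot_increment_le:
  assumes "0 < K"
  shows "(\<integral>p. (\<phi> (rot (pi / 2) p) - \<phi> (rot 0 p))\<^sup>2 \<partial>(M \<Otimes>\<^sub>M M))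
    \<le> (\<integral>p. (real K * (\<phi> (rot (pi / 2 / K) p) - \<phi> (rot 0 p)))\<^sup>2 \<partial>(M \<Otimes>\<^sub>M M))"
proof -
  let ?\<delta> = "pi / 2 / real K"
  define D where "D k p = \<phi> (rot (real k * ?\<delta> + ?\<delta>) p) - \<phi> (rot (real k * ?\<delta>) p)" for k p
  have "\<phi> (rot (pi / 2) p) - \<phi> (rot 0 p) = (\<Sum>k<K. D k p)" for p
  proof -
    have "(\<Sum>k<K. D k p) = (\<Sum>k<K. \<phi> (rot (real (Suc k) * ?\<delta>) p) - \<phi> (rot (real k * ?\<delta>) p))"
      unfolding D_def of_nat_Suc distrib_right mult_1_left by (simp add: add.commute)
    also have "\<dots> = \<phi> (rot (real K * ?\<delta>) p) - \<phi> (rot (real 0 * ?\<delta>) p)"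
      by (rule sum_lessThan_telescope)
    finally show ?thesis using assms by simp
  qed
  then have "(\<integral>p. (\<phi> (rot (pi / 2) p) - \<phi> (rot 0 p))\<^sup>2 \<partial>(M \<Otimes>\<^sub>M M)) = (\<integral>p. (\<Sum>k<K. D k p)\<^sup>2 \<partial>(M \<Otimes>\<^sub>M M))"
    by simp
  also have "\<dots> \<le> (\<integral>p. (\<Sum>k<K. (D k p)\<^sup>2) * real K \<partial>(M \<Otimes>\<^sub>M M))"
  proof (rule integral_mono')
    show "integrable (M \<Otimes>\<^sub>M M) (\<lambda>p. (\<Sum>k<K. (D k p)\<^sup>2) * real K)"
      unfolding D_def by (intro integrable_mult_left Bochner_Integration.integrable_sum integrable_increment)
    show "(\<Sum>k<K. D k p)\<^sup>2 \<le> (\<Sum>k<K. (D k p)\<^sup>2) * real K" for p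
      using sum_squared_le_sum_of_squares[of "\<lambda>k. D k p" "{..<K}"] by simp
  qed (simp add: sum_nonneg)
  also have "\<dots> = (\<Sum>k<K. \<integral>p. (D k p)\<^sup>2 \<partial>(M \<Otimes>\<^sub>M M)) * real K"
    unfolding D_def by (subst integral_mult_left_zero, subst Bochner_Integration.integral_sum)
      (auto intro: integrable_increment)
  also have "\<dots> = (real K)\<^sup>2 * (\<integral>p. (\<phi> (rot ?\<delta> p) - \<phi> (rot 0 p))\<^sup>2 \<partial>(M \<Otimes>\<^sub>M M))"
    unfolding D_def rot_increment_invariant by (simp add: power2_eq_square)
  finally show ?thesis by (simp add: power_mult_distrib)
qed

text \<open>Let the number of steps tend to infinity in \<open>rot_increment_le\<close>. The
  velocity of the rotation at angle 0 is the second copy, so the scaled increment tends to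
  \<open>pi / 2\<close> times the derivative of \<open>\<phi>\<close> at the first copy in the
  direction of the second. The square of \<open>pi / 2\<close> is the constant.\<close>

lemma gaussian_poincare:
  defines "g \<equiv> (\<lambda>x y. (\<Sum>j<n. d\<phi> j (\<lambda>k. h k x) * h j y)\<^sup>2)"
  shows "integrable (M \<Otimes>\<^sub>M M) (\<lambda>p. g (fst p) (snd p))"
    and "(\<integral>p. (\<phi> (\<lambda>j. h j (snd p)) - \<phi> (\<lambda>j. h j (fst p)))\<^sup>2 \<partial>(M \<Otimes>\<^sub>M M))
      \<le> pi\<^sup>2 / 4 * (\<integral>p. g (fst p) (snd p) \<partial>(M \<Otimes>\<^sub>M M))"
proof -
  obtain L where L: "0 \<le> L" "\<And>j x. j < n \<Longrightarrow> \<bar>d\<phi> j x\<bar> \<le> L" using C1b_partial_bounded[OF C] by blast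
  \<comment> \<open>The number of steps is \<open>Suc K\<close>, so that the step length never
    divides by zero.\<close>
  define s where "s K p = real (Suc K) * (\<phi> (rot (pi / 2 / Suc K) p) - \<phi> (rot 0 p))" for K p
  define f where "f p = (\<Sum>j<n. d\<phi> j (rot 0 p) * (pi / 2 * h j (snd p)))" for p :: "'a \<times> 'a"
  \<comment> \<open>Majorant for all \<open>K\<close> at once: \<open>pi / 2\<close> is the number
    of steps times their length, \<open>n\<close> comes from Cauchy-Schwarz for the sum, and 2 from
    the square of a sum of two terms.\<close>
  define w where "w p = (L * pi / 2)\<^sup>2 * ((\<Sum>j<n. 2 * ((h j (fst p))\<^sup>2 + (h j (snd p))\<^sup>2)) * n)" for p
  have h2: "integrable M (\<lambda>x. (h j x)\<^sup>2)" if "j < n" for j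
    using h[OF that] G by (auto simp: L2_real_iff)
  have w: "integrable (M \<Otimes>\<^sub>M M) w"
    unfolding w_def using h2
    by (intro integrable_mult_left integrable_mult_right Bochner_Integration.integrable_sum Bochner_Integration.integrable_add
       integrable_pair_fst(1)[where f = "\<lambda>x. (h _ x)\<^sup>2"] integrable_pair_snd(1)[where f = "\<lambda>x. (h _ x)\<^sup>2"])
       auto
  have fm: "f \<in> borel_measurable (M \<Otimes>\<^sub>M M)"
    unfolding f_def using measurable_compose[OF rot_measurable d\<phi>_measurableurable] h_measurable
    by (auto intro!: borel_measurable_sum borel_measurable_times measurable_compose[OF measurable_snd])
  have sm: "s K \<in> borel_measurable (M \<Otimes>\<^sub>M M)" for K
    unfolding s_def using \<phi>_rot_measurable by (auto intro!: borel_measurable_times)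
  have sbound: "(s K p)\<^sup>2 \<le> w p" for K p
  proof -
    let ?\<delta> = "pi / 2 / Suc K"
    obtain \<xi> where \<xi>: "\<phi> (rot ?\<delta> p) - \<phi> (rot 0 p) = (\<Sum>j<n. d\<phi> j (\<xi> j) * (rot ?\<delta> p j - rot 0 p j))"
      using C1b_increment[OF C, of "rot 0 p" "rot ?\<delta> p"] by metis
    \<comment> \<open>The factor \<open>Suc K\<close> only has to be compensated to first order, so
      the cosine is estimated no better than the sine.\<close>
    have tr: "\<bar>cos d - 1\<bar> \<le> d" "\<bar>sin d\<bar> \<le> d" if "0 \<le> d" for d :: real
    proof -
      show "\<bar>sin d\<bar> \<le> d" using abs_sin_x_le_abs_x[of d] that by simp
      have "1 - cos d = 2 * (sin (d / 2))\<^sup>2" using cos_double_sin[of "d / 2"] by simp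
      also have "\<dots> \<le> 2 * \<bar>sin (d / 2)\<bar>"
      proof -
        have "\<bar>sin (d / 2)\<bar> * \<bar>sin (d / 2)\<bar> \<le> \<bar>sin (d / 2)\<bar> * 1" by (intro mult_left_mono) auto
        then show ?thesis by (simp add: power2_eq_square abs_mult[symmetric])
      qed
      also have "\<dots> \<le> d" using abs_sin_x_le_abs_x[of "d / 2"] that by simp
      finally show "\<bar>cos d - 1\<bar> \<le> d" by simp
    qed
    have trig: "\<bar>cos ?\<delta> - 1\<bar> \<le> ?\<delta>" "\<bar>sin ?\<delta>\<bar> \<le> ?\<delta>"
      by (rule tr; simp)+
    have "\<bar>s K p\<bar> = real (Suc K) * \<bar>\<Sum>j<n. d\<phi> j (\<xi> j) * (rot ?\<delta> p j - rot 0 p j)\<bar>"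
      unfolding s_def \<xi> by (simp add: abs_mult)
    also have "\<dots> \<le> real (Suc K) * (\<Sum>j<n. L * (?\<delta> * (\<bar>h j (fst p)\<bar> + \<bar>h j (snd p)\<bar>)))"
    proof (intro mult_left_mono order_trans[OF sum_abs] sum_mono)
      fix j assume "j \<in> {..<n}"
      then have j: "j < n" by simp
      have "\<bar>rot ?\<delta> p j - rot 0 p j\<bar> = \<bar>(cos ?\<delta> - 1) * h j (fst p) + sin ?\<delta> * h j (snd p)\<bar>"
        using j by (simp add: rot_def algebra_simps)
      also have "\<dots> \<le> \<bar>cos ?\<delta> - 1\<bar> * \<bar>h j (fst p)\<bar> + \<bar>sin ?\<delta>\<bar> * \<bar>h j (snd p)\<bar>"
        unfolding abs_mult[symmetric] by (rule abs_triangle_ineq)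
      also have "\<dots> \<le> ?\<delta> * \<bar>h j (fst p)\<bar> + ?\<delta> * \<bar>h j (snd p)\<bar>"
        by (intro add_mono mult_right_mono trig) auto
      finally have "\<bar>rot ?\<delta> p j - rot 0 p j\<bar> \<le> ?\<delta> * (\<bar>h j (fst p)\<bar> + \<bar>h j (snd p)\<bar>)" by (simp only: distrib_left)
      then show "\<bar>d\<phi> j (\<xi> j) * (rot ?\<delta> p j - rot 0 p j)\<bar> \<le> L * (?\<delta> * (\<bar>h j (fst p)\<bar> + \<bar>h j (snd p)\<bar>))"
        unfolding abs_mult using L j by (intro mult_mono) auto
    qed auto
    also have "\<dots> = L * pi / 2 * (\<Sum>j<n. \<bar>h j (fst p)\<bar> + \<bar>h j (snd p)\<bar>)"
    proof -
      have e1: "real (Suc K) * (\<Sum>j<n. L * (?\<delta> * a j)) = L * (real (Suc K) * ?\<delta>) * (\<Sum>j<n. a j)" for a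
        unfolding sum_distrib_left by (simp only: mult_ac)
      have e2: "real (Suc K) * ?\<delta> = pi / 2"
        by (rule nonzero_mult_div_cancel_left[of "real (Suc K)" "pi / 2", unfolded times_divide_eq_right[symmetric]]) simp
      show ?thesis unfolding e1 e2 by simp
    qed
    finally have "\<bar>s K p\<bar>\<^sup>2 \<le> (L * pi / 2 * (\<Sum>j<n. \<bar>h j (fst p)\<bar> + \<bar>h j (snd p)\<bar>))\<^sup>2"
      by (intro power_mono) auto
    also have "\<dots> = (L * pi / 2)\<^sup>2 * (\<Sum>j<n. \<bar>h j (fst p)\<bar> + \<bar>h j (snd p)\<bar>)\<^sup>2" by (rule power_mult_distrib)
    also have "\<dots> \<le> w p"
      unfolding w_def
    proof (intro mult_left_mono order_trans[OF sum_squared_le_sum_of_squares] mult_mono sum_mono)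
      fix j show "(\<bar>h j (fst p)\<bar> + \<bar>h j (snd p)\<bar>)\<^sup>2 \<le> 2 * ((h j (fst p))\<^sup>2 + (h j (snd p))\<^sup>2)"
        using sum_squares_bound[of "\<bar>h j (fst p)\<bar>" "\<bar>h j (snd p)\<bar>"] by (simp add: power2_sum)
    qed (auto intro: sum_nonneg)
    finally show ?thesis by simp
  qed
  have slim: "(\<lambda>K. s K p) \<longlonglongrightarrow> f p" for p
    unfolding s_def f_def
  proof (rule C1b_difference_quotient_tendsto[OF C])
    have \<delta>0: "(\<lambda>K. pi / 2 / real (Suc K)) \<longlonglongrightarrow> 0"
      by (rule LIMSEQ_Suc) real_asymp
    show "(\<lambda>K. rot (pi / 2 / real (Suc K)) p k) \<longlonglongrightarrow> rot 0 p k" for k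
    proof -
      have "(\<lambda>K. cos (pi / 2 / real (Suc K)) * h k (fst p) + sin (pi / 2 / real (Suc K)) * h k (snd p))
         \<longlonglongrightarrow> cos 0 * h k (fst p) + sin 0 * h k (snd p)"
        by (intro tendsto_intros \<delta>0)
      then show ?thesis by (cases "k < n") (simp_all add: rot_def)
    qed
    fix j assume j: "j < n"
    \<comment> \<open>The cosine is stationary at 0, which removes the first copy from the limit
      direction; the sine contributes the second copy with speed \<open>pi / 2\<close>.\<close>
    have c: "(\<lambda>K. real (Suc K) * (cos (pi / 2 / real (Suc K)) - 1)) \<longlonglongrightarrow> 0"
      by (rule LIMSEQ_Suc[where f = "\<lambda>K. real K * (cos (pi / 2 / real K) - 1)"]) real_asymp
    have s: "(\<lambda>K. real (Suc K) * sin (pi / 2 / real (Suc K))) \<longlonglongrightarrow> pi / 2"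
      by (rule LIMSEQ_Suc[where f = "\<lambda>K. real K * sin (pi / 2 / real K)"]) real_asymp
    have "(\<lambda>K. real (Suc K) * (cos (pi / 2 / real (Suc K)) - 1) * h j (fst p) + real (Suc K) * sin (pi / 2 / real (Suc K)) * h j (snd p))
       \<longlonglongrightarrow> 0 * h j (fst p) + pi / 2 * h j (snd p)"
      by (intro tendsto_intros c s)
    then show "(\<lambda>K. real (Suc K) * (rot (pi / 2 / real (Suc K)) p j - rot 0 p j)) \<longlonglongrightarrow> pi / 2 * h j (snd p)"
      using j by (simp add: rot_def algebra_simps)
  qed
  have fg: "(f p)\<^sup>2 = pi\<^sup>2 / 4 * g (fst p) (snd p)" for p
  proof -
    have "d\<phi> j (rot 0 p) = d\<phi> j (\<lambda>k. h k (fst p))" if "j < n" for j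
      by (rule C1b_partial_cong[OF C that]) (simp add: rot_def)
    then have "f p = pi / 2 * (\<Sum>j<n. d\<phi> j (\<lambda>k. h k (fst p)) * h j (snd p))"
      unfolding f_def sum_distrib_left by (intro sum.cong) auto
    then show ?thesis by (simp only: g_def power_mult_distrib power_divide) simp
  qed
  have AE1: "AE p in M \<Otimes>\<^sub>M M. (\<lambda>K. (s K p)\<^sup>2) \<longlonglongrightarrow> (f p)\<^sup>2" by (intro AE_I2 tendsto_power slim)
  have AE2: "AE p in M \<Otimes>\<^sub>M M. norm ((s K p)\<^sup>2) \<le> w p" for K using sbound by simp
  have "integrable (M \<Otimes>\<^sub>M M) (\<lambda>p. (f p)\<^sup>2)"
    by (rule integrable_dominated_convergence[OF _ _ w AE1 AE2]) (use fm sm in auto)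
  from integrable_mult_right[OF this, of "4 / pi\<^sup>2"]
  show "integrable (M \<Otimes>\<^sub>M M) (\<lambda>p. g (fst p) (snd p))" by (simp add: fg)
  have lim: "(\<lambda>K. \<integral>p. (s K p)\<^sup>2 \<partial>(M \<Otimes>\<^sub>M M)) \<longlonglongrightarrow> (\<integral>p. (f p)\<^sup>2 \<partial>(M \<Otimes>\<^sub>M M))"
    by (rule integral_dominated_convergence[OF _ _ w AE1 AE2]) (use fm sm in auto)
  have "\<phi> (\<lambda>j. h j (snd p)) - \<phi> (\<lambda>j. h j (fst p)) = \<phi> (rot (pi / 2) p) - \<phi> (rot 0 p)" for p
  proof -
    have "\<phi> (\<lambda>j. h j (snd p)) = \<phi> (rot (pi / 2) p)" "\<phi> (\<lambda>j. h j (fst p)) = \<phi> (rot 0 p)"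
      by (rule C1b_cong[OF C]; simp add: rot_def)+
    then show ?thesis by simp
  qed
  then have "(\<integral>p. (\<phi> (\<lambda>j. h j (snd p)) - \<phi> (\<lambda>j. h j (fst p)))\<^sup>2 \<partial>(M \<Otimes>\<^sub>M M))
     = (\<integral>p. (\<phi> (rot (pi / 2) p) - \<phi> (rot 0 p))\<^sup>2 \<partial>(M \<Otimes>\<^sub>M M))" by simp
  also have "\<dots> \<le> (\<integral>p. (f p)\<^sup>2 \<partial>(M \<Otimes>\<^sub>M M))"
    by (rule LIMSEQ_le_const[OF lim]) (use rot_increment_le[OF zero_less_Suc] in \<open>unfold s_def, blast\<close>)
  finally show "(\<integral>p. (\<phi> (\<lambda>j. h j (snd p)) - \<phi> (\<lambda>j. h j (fst p)))\<^sup>2 \<partial>(M \<Otimes>\<^sub>M M))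
      \<le> pi\<^sup>2 / 4 * (\<integral>p. g (fst p) (snd p) \<partial>(M \<Otimes>\<^sub>M M))" by (simp add: fg)
qed

end

section \<open>Semigroups on Banach spaces\<close>

text \<open>The closed sets on which all \<open>T n\<close> are bounded by \<open>k\<close> cover
  the space, so by Baire's theorem one of them contains a ball.\<close>

lemma uniform_boundedness:
  fixes T :: "nat \<Rightarrow> 'e::banach \<Rightarrow> 'f::real_normed_vector"
  assumes T: "\<And>n. bounded_linear (T n)" and bd: "\<And>x. \<exists>C. \<forall>n. norm (T n x) \<le> C"
  obtains C where "0 \<le> C" "\<And>n x. norm (T n x) \<le> C * norm x"
proof -
  define A where "A k = {x. \<forall>n. norm (T n x) \<le> real k}" for k
  have clA: "closed (A k)" for k
    unfolding A_def Collect_all_eq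
    by (intro closed_INT ballI closed_Collect_le continuous_intros linear_continuous_on T)
  have "(\<Union>k. A k) = UNIV"
  proof -
    have "\<exists>k. x \<in> A k" for x
    proof -
      obtain C where "\<forall>n. norm (T n x) \<le> C" using bd by blast
      then show ?thesis using real_arch_simple[of C] unfolding A_def by (blast intro: order_trans)
    qed
    then show ?thesis by auto
  qed
  moreover have "interior (\<Union>k. A k) = {}" if "\<forall>k. interior (A k) = {}"
    using Baire_category_alt[of "euclidean :: 'e topology" "range A"]
      completely_metrizable_space_euclidean[where 'a = 'e] clA that by fastforce
  ultimately obtain k where "interior (A k) \<noteq> {}" by auto
  then obtain x0 r where r: "0 < r" "cball x0 r \<subseteq> A k"
    by (meson all_not_in_conv mem_interior_cball)
  \<comment> \<open>A vector of norm \<open>r\<close> is the difference of two points of the ball,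
    each of them mapped into norm at most \<open>k\<close>; rescaling gives this constant.\<close>
  show ?thesis
  proof (rule that[of "2 * real k / r"])
    fix n x
    interpret T: bounded_linear "T n" by (rule T)
    show "norm (T n x) \<le> 2 * real k / r * norm x"
    proof (cases "x = 0")
      case False
      define y where "y = (r / norm x) *\<^sub>R x"
      have y: "norm y = r" using False r by (simp add: y_def)
      have "x0 + y \<in> A k" "x0 \<in> A k" using r y by (auto simp: dist_norm)
      then have "norm (T n (x0 + y)) \<le> k" "norm (T n x0) \<le> k" by (auto simp: A_def)
      moreover have "norm (T n y) = norm (T n (x0 + y) - T n x0)" by (simp add: T.add)
      ultimately have "norm (T n y) \<le> 2 * real k"
        using norm_triangle_ineq4[of "T n (x0 + y)" "T n x0"] by linarith
      then show ?thesis using r False by (simp add: y_def T.scaleR field_simps)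
    qed (simp add: T.zero)
  qed (use r in simp)
qed

locale banach_c0_semigroup =
  fixes S :: "real \<Rightarrow> 'e::banach \<Rightarrow> 'e"
  assumes S: "c0_semigroup UNIV norm S"
begin

lemma bounded_linear_S: "0 \<le> t \<Longrightarrow> bounded_linear (S t)"
proof -
  assume "0 \<le> t"
  then have b: "bounded_op UNIV norm (S t)" using S by (simp add: c0_semigroup_def)
  then obtain C where C: "\<And>x. norm (S t x) \<le> C * norm x" by (auto simp: bounded_op_def)
  have lin: "S t (a *\<^sub>R x + b *\<^sub>R y) = a *\<^sub>R S t x + b *\<^sub>R S t y" for a b x y
    using b by (simp add: bounded_op_def)
  show ?thesis
    using lin[of 1 _ 1] lin[of _ _ 0] C by (intro bounded_linear_intro[where K = C]) (auto simp: mult.commute)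
qed

lemma S_0: "S 0 x = x" and S_add: "0 \<le> s \<Longrightarrow> 0 \<le> t \<Longrightarrow> S (s + t) x = S s (S t x)"
  using S by (auto simp: c0_semigroup_def)

lemma S_tendsto: "((\<lambda>t. norm (S t x - x)) \<longlongrightarrow> 0) (at_right 0)"
  using S by (auto simp: c0_semigroup_def)

lemma norm_S_diff_less: assumes "\<epsilon> > 0" shows "\<exists>d>0. \<forall>r. 0 \<le> r \<and> r < d \<longrightarrow> norm (S r x - x) < \<epsilon>"
proof -
  have "\<forall>\<^sub>F t in at_right 0. norm (S t x - x) < \<epsilon>"
    by (rule order_tendstoD(2)[OF S_tendsto assms])
  then obtain d where "d > 0" "\<forall>r>0. r < d \<longrightarrow> norm (S r x - x) < \<epsilon>"
    by (auto simp: eventually_at_right_field)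
  then show ?thesis using S_0 assms by (metis cancel_comm_monoid_add_class.diff_cancel norm_zero order_le_less)
qed

text \<open>Otherwise there are times \<open>t n\<close> tending to 0 at which the operator norms
  exceed \<open>n\<close>. Strong continuity at 0 bounds each orbit along these times, which
  contradicts uniform boundedness.\<close>

lemma bounded_near_0: "\<exists>d>0. \<exists>K. \<forall>t x. 0 \<le> t \<and> t \<le> d \<longrightarrow> norm (S t x) \<le> K * norm x"
proof (rule ccontr)
  assume contr: "\<not> ?thesis"
  have "\<exists>t x. 0 \<le> t \<and> t \<le> 1 / real (Suc n) \<and> norm (S t x) > real n * norm x" for n
  proof (rule ccontr)
    assume "\<not> ?thesis"
    then have "\<forall>t x. 0 \<le> t \<and> t \<le> 1 / real (Suc n) \<longrightarrow> norm (S t x) \<le> real n * norm x" by (meson not_le)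
    moreover have "0 < 1 / real (Suc n)" by simp
    ultimately show False using contr by blast
  qed
  then obtain t x where t: "\<And>n. 0 \<le> t n" "\<And>n. t n \<le> 1 / real (Suc n)" "\<And>n. norm (S (t n) (x n)) > real n * norm (x n)"
    by metis
  have "\<exists>C. \<forall>n. norm (S (t n) y) \<le> C" for y
  proof -
    obtain d where d: "d > 0" "\<And>r. 0 \<le> r \<Longrightarrow> r < d \<Longrightarrow> norm (S r y - y) < 1" using norm_S_diff_less[of 1 y] by auto
    obtain N where N: "1 / real (Suc N) < d" using nat_approx_posE[OF d(1)] .
    \<comment> \<open>The maximum covers the finitely many indices up to \<open>N\<close>; beyond
      them, \<open>S (t n) y\<close> is within 1 of \<open>y\<close>.\<close>
    have "norm (S (t n) y) \<le> Max ((\<lambda>n. norm (S (t n) y)) ` {..N}) + (norm y + 1)" for n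
    proof (cases "n \<le> N")
      case True
      then have "norm (S (t n) y) \<le> Max ((\<lambda>n. norm (S (t n) y)) ` {..N})" by (intro Max_ge) auto
      then show ?thesis using norm_ge_zero[of y] by linarith
    next
      case False
      then have "1 / real (Suc n) \<le> 1 / real (Suc N)" by (simp add: field_simps)
      then have "t n < d" using t(2)[of n] N by linarith
      then have "norm (S (t n) y - y) < 1" using d t(1) by blast
      then have "norm (S (t n) y) \<le> norm y + 1" using norm_triangle_ineq2[of "S (t n) y" y] by linarith
      moreover have "0 \<le> Max ((\<lambda>n. norm (S (t n) y)) ` {..N})" by (auto simp: Max_ge_iff)
      ultimately show ?thesis by linarith
    qed
    then show ?thesis by blast
  qed
  from uniform_boundedness[OF bounded_linear_S[OF t(1)] this]
  obtain C where C: "0 \<le> C" "\<And>n x. norm (S (t n) x) \<le> C * norm x" by blast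
  obtain n where n: "C \<le> real n" using real_arch_simple by blast
  have "C * norm (x n) \<le> real n * norm (x n)" using n by (intro mult_right_mono) auto
  then show False using C(2)[of n "x n"] t(3)[of n] by linarith
qed

lemma locally_bounded:
  obtains K where "0 \<le> K" "\<And>t x. 0 \<le> t \<Longrightarrow> t \<le> T \<Longrightarrow> norm (S t x) \<le> K * norm x"
proof -
  obtain d K0 where d: "d > 0" and K0: "\<And>t x. 0 \<le> t \<Longrightarrow> t \<le> d \<Longrightarrow> norm (S t x) \<le> K0 * norm x"
    using bounded_near_0 by blast
  \<comment> \<open>With \<open>K \<ge> 1\<close> the powers of \<open>K\<close> increase, so the
    bound for \<open>m\<close> steps of length \<open>d\<close> also covers shorter times.\<close>
  define K where "K = max 1 K0"
  have K: "1 \<le> K" "norm (S t x) \<le> K * norm x" if "0 \<le> t" "t \<le> d" for t x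
    using K0[OF that, of x] mult_right_mono[of K0 K "norm x"] by (auto simp: K_def)
  have K1: "1 \<le> K" by (simp add: K_def)
  have iter: "norm (S t x) \<le> K ^ m * norm x" if "0 \<le> t" "t \<le> real m * d" for t m x
    using that
  proof (induction m arbitrary: t)
    case 0
    then show ?case by (simp add: S_0)
  next
    case (Suc m)
    show ?case
    proof (cases "t \<le> d")
      case True
      have "K * 1 \<le> K * K ^ m" using K1 by (intro mult_left_mono one_le_power) auto
      then have "K * norm x \<le> K ^ Suc m * norm x" by (intro mult_right_mono) auto
      then show ?thesis using K(2)[OF Suc.prems(1) True, of x] by linarith
    next
      case False
      have "S t x = S d (S (t - d) x)" using S_add[of d "t - d" x] d False by simp
      then have "norm (S t x) \<le> K * norm (S (t - d) x)" using K(2)[of d] d by simp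
      also have "\<dots> \<le> K * (K ^ m * norm x)"
        using Suc False K1 by (intro mult_left_mono Suc.IH) (auto simp: algebra_simps)
      finally show ?thesis by simp
    qed
  qed
  obtain m where "T / d \<le> real m" using real_arch_simple by blast
  then have m: "T \<le> real m * d" using d by (simp add: field_simps)
  show ?thesis by (rule that[of "K ^ m"]) (use K1 iter m in auto)
qed

lemma continuous_on_S: "continuous_on {0..T} (\<lambda>s. S s x)"
proof -
  obtain K where K: "0 \<le> K" "\<And>t x. 0 \<le> t \<Longrightarrow> t \<le> T \<Longrightarrow> norm (S t x) \<le> K * norm x"
    using locally_bounded by blast
  show ?thesis
  proof (subst continuous_on_iff, safe)
    fix t \<epsilon> :: real assume t: "t \<in> {0..T}" and \<epsilon>: "0 < \<epsilon>"
    obtain d where d: "d > 0" "\<And>r. 0 \<le> r \<Longrightarrow> r < d \<Longrightarrow> norm (S r x - x) < \<epsilon> / (K + 1)"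
      using norm_S_diff_less[of "\<epsilon> / (K + 1)" x] \<epsilon> K by auto
    \<comment> \<open>The bound is uniform in the base point, so exchanging the roles of the two
      times also gives continuity from the left.\<close>
    have *: "norm (S (t + r) x - S t x) < \<epsilon>" if "0 \<le> t" "t \<le> T" "0 \<le> r" "r < d" for t r
    proof -
      have "S (t + r) x - S t x = S t (S r x - x)"
        using that by (simp add: S_add bounded_linear.linear[OF bounded_linear_S] linear_diff)
      then have "norm (S (t + r) x - S t x) \<le> K * norm (S r x - x)" using K(2) that by simp
      also have "\<dots> \<le> K * (\<epsilon> / (K + 1))" using d(2)[of r] that K by (intro mult_left_mono) auto
      also have "\<dots> < \<epsilon>" using \<epsilon> K by (simp add: field_simps)
      finally show ?thesis .
    qed
    show "\<exists>d>0. \<forall>t'\<in>{0..T}. dist t' t < d \<longrightarrow> dist (S t' x) (S t x) < \<epsilon>"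
    proof (intro exI[of _ d] conjI ballI impI d(1))
      fix t' assume t': "t' \<in> {0..T}" "dist t' t < d"
      show "dist (S t' x) (S t x) < \<epsilon>"
        using *[of t "t' - t"] *[of t' "t - t'"] t t'
        by (cases "t \<le> t'") (auto simp: dist_real_def dist_norm norm_minus_commute)
    qed
  qed
qed

lemma continuous_on_dual:
  fixes xs :: "'e \<Rightarrow>\<^sub>L real"
  shows "0 \<le> a \<Longrightarrow> continuous_on {a..T} (\<lambda>s. blinfun_apply xs (S s x))"
  using continuous_on_compose2[OF blinfun.continuous_on[OF continuous_on_const continuous_on_id, of UNIV xs] continuous_on_S[of T x]]
  by (auto intro: continuous_on_subset)

lemma integrable_dual:
  fixes xs :: "'e \<Rightarrow>\<^sub>L real"
  shows "0 \<le> a \<Longrightarrow> (\<lambda>s. blinfun_apply xs (S s x)) integrable_on {a..T}"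
  by (intro integrable_continuous_real continuous_on_dual)

definition dual_S :: "real \<Rightarrow> ('e \<Rightarrow>\<^sub>L real) \<Rightarrow> 'e \<Rightarrow>\<^sub>L real"
  where "dual_S t xs = Blinfun (\<lambda>x. blinfun_apply xs (S t x))"

text \<open>The orbit \<open>s \<mapsto> dual_S s xs\<close> need not be continuous in norm; only
  the scalar functions that it induces are integrated.\<close>

definition integral_dual_S :: "real \<Rightarrow> ('e \<Rightarrow>\<^sub>L real) \<Rightarrow> 'e \<Rightarrow>\<^sub>L real"
  where "integral_dual_S T xs = Blinfun (\<lambda>x. integral {0..T} (\<lambda>s. blinfun_apply xs (S s x)))"

lemma dual_S: "0 \<le> t \<Longrightarrow> blinfun_apply (dual_S t xs) x = blinfun_apply xs (S t x)"
  unfolding dual_S_def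
  by (subst bounded_linear_Blinfun_apply)
     (auto intro: bounded_linear_compose[OF blinfun.bounded_linear_right bounded_linear_S])

lemma integral_dual_S:
  "blinfun_apply (integral_dual_S T xs) x = integral {0..T} (\<lambda>s. blinfun_apply xs (S s x))"
  unfolding integral_dual_S_def
proof (subst bounded_linear_Blinfun_apply)
  obtain K where K: "0 \<le> K" "\<And>t x. 0 \<le> t \<Longrightarrow> t \<le> T \<Longrightarrow> norm (S t x) \<le> K * norm x"
    using locally_bounded by blast
  note lin = bounded_linear.linear[OF bounded_linear_S]
  show "bounded_linear (\<lambda>x. integral {0..T} (\<lambda>s. blinfun_apply xs (S s x)))"
  proof (rule bounded_linear_intro)
    fix x y
    have "integral {0..T} (\<lambda>s. blinfun_apply xs (S s (x + y)))
        = integral {0..T} (\<lambda>s. blinfun_apply xs (S s x) + blinfun_apply xs (S s y))"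
      by (intro integral_cong) (simp add: lin linear_add blinfun.add_right)
    then show "integral {0..T} (\<lambda>s. blinfun_apply xs (S s (x + y)))
        = integral {0..T} (\<lambda>s. blinfun_apply xs (S s x)) + integral {0..T} (\<lambda>s. blinfun_apply xs (S s y))"
      by (simp add: integral_add integrable_dual)
  next
    fix r x
    have "integral {0..T} (\<lambda>s. blinfun_apply xs (S s (r *\<^sub>R x))) = integral {0..T} (\<lambda>s. r *\<^sub>R blinfun_apply xs (S s x))"
      by (intro integral_cong) (simp add: lin linear_scale blinfun.scaleR_right)
    then show "integral {0..T} (\<lambda>s. blinfun_apply xs (S s (r *\<^sub>R x))) = r *\<^sub>R integral {0..T} (\<lambda>s. blinfun_apply xs (S s x))"
      by simp
  next
    fix x
    \<comment> \<open>\<open>T\<close> is arbitrary here: for negative \<open>T\<close> the interval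
      is empty and the integral is 0, whence the absolute value in the bound.\<close>
    show "norm (integral {0..T} (\<lambda>s. blinfun_apply xs (S s x))) \<le> norm x * (norm xs * K * \<bar>T\<bar>)"
    proof (cases "0 \<le> T")
      case True
      have "norm (integral {0..T} (\<lambda>s. blinfun_apply xs (S s x))) \<le> norm xs * (K * norm x) * (T - 0)"
      proof (rule integral_bound[OF True continuous_on_dual])
        fix s assume "s \<in> {0..T}"
        then have "norm xs * norm (S s x) \<le> norm xs * (K * norm x)" using K(2) by (intro mult_left_mono) auto
        then show "norm (blinfun_apply xs (S s x)) \<le> norm xs * (K * norm x)"
          using norm_blinfun[of xs "S s x"] by linarith
      qed simp
      then show ?thesis using True by (simp add: mult_ac)
    next
      case False
      then have "{0..T} = {}" by simp
      moreover have "0 \<le> norm x * (norm xs * K * \<bar>T\<bar>)" using K by simp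
      ultimately show ?thesis by (simp only: integral_empty norm_zero)
    qed
  qed
qed simp

text \<open>Applying the functional to \<open>S t x\<close> shifts the window \<open>{0..T}\<close>
  by \<open>t\<close>. What remains are means over \<open>{T..T + t}\<close> and
  \<open>{0..t}\<close>, which tend to the end values. The formula holds for every \<open>x\<close>
  in E, so it can also be used at \<open>i_inf u\<close>.\<close>

lemma integral_dual_S_difference_quotient:
  assumes T: "0 < T"
  shows "((\<lambda>t. blinfun_apply (integral_dual_S T xs) ((1 / t) *\<^sub>R (S t x - x)))
    \<longlongrightarrow> blinfun_apply (dual_S T xs - xs) x) (at_right 0)"
proof -
  define f where "f s = blinfun_apply xs (S s x)" for s
  have int: "f integrable_on {a..b}" if "0 \<le> a" for a b
    unfolding f_def by (rule integrable_dual[OF that])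
  have mean: "((\<lambda>t. (1 / t) * integral {a..a + t} f) \<longlongrightarrow> f a) (at_right 0)" if a: "0 \<le> a" for a
  proof -
    have "((\<lambda>y. integral {a..y} f) has_real_derivative f a) (at a within {a..a + 1})"
      unfolding f_def by (rule integral_has_real_derivative[OF continuous_on_dual[OF a]]) auto
    then have "((\<lambda>y. (integral {a..y} f - integral {a..a} f) / (y - a)) \<longlongrightarrow> f a) (at_right a)"
      unfolding has_field_derivative_iff by (simp add: at_within_Icc_at_right)
    then show ?thesis
      unfolding filterlim_at_right_to_0[of _ _ a] by (simp add: add.commute)
  qed
  have "((\<lambda>t. (1 / t) * integral {T..T + t} f - (1 / t) * integral {0..0 + t} f) \<longlongrightarrow> f T - f 0) (at_right 0)"
    using T by (intro tendsto_diff mean) auto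
  moreover have "\<forall>\<^sub>F t in at_right 0. (1 / t) * integral {T..T + t} f - (1 / t) * integral {0..0 + t} f
     = blinfun_apply (integral_dual_S T xs) ((1 / t) *\<^sub>R (S t x - x))"
    using eventually_at_right_less[of "0::real"]
  proof eventually_elim
    case (elim t)
    have "integral {0..T} (\<lambda>s. blinfun_apply xs (S s (S t x))) = integral {0..T} (f \<circ> (+) t)"
      using elim by (intro integral_cong) (auto simp: f_def S_add add.commute)
    also have "\<dots> = integral {t..T + t} f" by (subst integral_shift_Icc_real) simp
    finally have "blinfun_apply (integral_dual_S T xs) (S t x - x) = integral {t..T + t} f - integral {0..T} f"
      by (simp add: blinfun.diff_right integral_dual_S f_def[abs_def])
    also have "\<dots> = integral {T..T + t} f - integral {0..t} f"
    proof -
      have "integral {0..t} f + integral {t..T + t} f = integral {0..T + t} f"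
        by (rule Henstock_Kurzweil_Integration.integral_combine) (use elim T int in auto)
      moreover have "integral {0..T} f + integral {T..T + t} f = integral {0..T + t} f"
        by (rule Henstock_Kurzweil_Integration.integral_combine) (use elim T int in auto)
      ultimately show ?thesis by linarith
    qed
    finally show ?case by (simp add: blinfun.scaleR_right right_diff_distrib diff_divide_distrib)
  qed
  ultimately have "((\<lambda>t. blinfun_apply (integral_dual_S T xs) ((1 / t) *\<^sub>R (S t x - x))) \<longlongrightarrow> f T - f 0) (at_right 0)"
    by (rule Lim_transform_eventually)
  then show ?thesis using T by (simp add: f_def S_0 blinfun.diff_left dual_S)
qed

lemma integral_dual_S_in_dual_graph:
  assumes "0 < T"
  shows "(integral_dual_S T xs, dual_S T xs - xs) \<in> dual_graph (semigroup_generator UNIV norm S)"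
  unfolding dual_graph_def
proof safe
  fix x y assume "(x, y) \<in> semigroup_generator UNIV norm S"
  then have "((\<lambda>t. (1 / t) *\<^sub>R (S t x - x)) \<longlongrightarrow> y) (at_right 0)"
    by (simp add: semigroup_generator_def tendsto_norm_zero_iff LIM_zero_iff)
  then have "((\<lambda>t. blinfun_apply (integral_dual_S T xs) ((1 / t) *\<^sub>R (S t x - x)))
     \<longlongrightarrow> blinfun_apply (integral_dual_S T xs) y) (at_right 0)"
    by (rule blinfun.tendsto[OF tendsto_const])
  from tendsto_unique[OF trivial_limit_at_right_real this integral_dual_S_difference_quotient[OF assms]]
  show "blinfun_apply (integral_dual_S T xs) y = blinfun_apply (dual_S T xs - xs) x" .
qed

end

section \<open>Two integral inequalities\<close>

lemma integral_square_le:
  fixes f :: "real \<Rightarrow> real"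
  assumes "0 < T" "continuous_on {0..T} f"
  shows "(integral {0..T} f)\<^sup>2 \<le> T * integral {0..T} (\<lambda>s. (f s)\<^sup>2)"
proof -
  \<comment> \<open>The claim is the non-negativity of the integral of
    \<open>(f s - m)\<^sup>2\<close>, where \<open>m\<close> is the mean of
    \<open>f\<close>.\<close>
  define m where "m = integral {0..T} f / T"
  have i: "f integrable_on {0..T}" "(\<lambda>s. (f s)\<^sup>2) integrable_on {0..T}"
    by (intro integrable_continuous_real continuous_intros assms)+
  have "0 \<le> integral {0..T} (\<lambda>s. (f s - m)\<^sup>2)"
    by (intro integral_nonneg integrable_continuous_real continuous_intros assms) auto
  also have "(\<lambda>s. (f s - m)\<^sup>2) = (\<lambda>s. (f s)\<^sup>2 - 2 * m * f s + m\<^sup>2)" by (auto simp: power2_diff)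
  also have "integral {0..T} \<dots> = integral {0..T} (\<lambda>s. (f s)\<^sup>2) - integral {0..T} (\<lambda>s. 2 * m * f s) + integral {0..T} (\<lambda>s. m\<^sup>2)"
    by (subst Henstock_Kurzweil_Integration.integral_add Henstock_Kurzweil_Integration.integral_diff
        | intro integrable_continuous_real continuous_intros assms refl)+
  also have "\<dots> = integral {0..T} (\<lambda>s. (f s)\<^sup>2) - 2 * m * integral {0..T} f + m\<^sup>2 * T"
    using assms by simp
  also have "\<dots> = integral {0..T} (\<lambda>s. (f s)\<^sup>2) - (integral {0..T} f)\<^sup>2 / T"
    using assms by (simp add: m_def power2_eq_square field_simps)
  finally show ?thesis using assms by (simp add: field_simps)
qed

text \<open>A continuous minorant on \<open>{0..T}\<close> stands in for \<open>g\<close>, which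
  will be the integrand of the covariance formula; the rest of the half-line contributes
  non-negatively.\<close>

lemma nn_integral_half_line_ge:
  fixes f :: "real \<Rightarrow> real"
  assumes "continuous_on {0..T} f" "\<And>s. 0 \<le> s \<Longrightarrow> s \<le> T \<Longrightarrow> 0 \<le> f s"
    and "\<And>s. 0 \<le> s \<Longrightarrow> s \<le> T \<Longrightarrow> ennreal (f s) \<le> g s"
  shows "ennreal (integral {0..T} f) \<le> (\<integral>\<^sup>+s. g s \<partial>half_line)"
proof -
  have si: "set_integrable lborel {0..T} f" by (rule borel_integrable_atLeastAtMost') fact
  have "ennreal (integral {0..T} f) = ennreal (\<integral>s. indicator {0..T} s * f s \<partial>lborel)"
    using set_borel_integral_eq_integral(2)[OF si] by (simp add: set_lebesgue_integral_def)
  also have "\<dots> = (\<integral>\<^sup>+s. ennreal (indicator {0..T} s * f s) \<partial>lborel)"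
    using si assms(2) by (intro nn_integral_eq_integral[symmetric]) (auto simp: set_integrable_def indicator_def)
  also have "\<dots> \<le> (\<integral>\<^sup>+s. g s * indicator {0..} s \<partial>lborel)"
    using assms(3) by (intro nn_integral_mono) (auto simp: indicator_def)
  also have "\<dots> = (\<integral>\<^sup>+s. g s \<partial>half_line)"
    unfolding half_line_def by (rule nn_integral_restrict_space[symmetric]) simp
  finally show ?thesis .
qed

section \<open>The estimate for continuous linear functionals\<close>

lemma (in semi_inner_product) nm_sum: "(\<And>j. j \<in> J \<Longrightarrow> f j \<in> X) \<Longrightarrow> nm (\<Sum>j\<in>J. f j) \<le> (\<Sum>j\<in>J. nm (f j))"
proof (induction J rule: infinite_finite_induct)
  case (insert j J)
  have "(\<Sum>j\<in>J. f j) \<in> X" using insert.prems by (intro subspace_sum subspace) auto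
  then show ?case using insert nm_triangle[of "f j" "\<Sum>j\<in>J. f j"] by force
qed (use scale_left[of 0 0 0] in \<open>auto simp: nm_def\<close>)

section \<open>The Gaussian Hilbert space of the measure\<close>

locale gaussian_radon =
  fixes \<mu> :: "'e::banach measure"
  assumes mu: "centred_gaussian_radon_measure \<mu>"
begin

sublocale prob_space \<mu> using mu by (simp add: centred_gaussian_radon_measure_def)

lemma sets_mu: "sets \<mu> = sets borel" using mu by (simp add: centred_gaussian_radon_measure_def)

lemma space_mu: "space \<mu> = UNIV" using sets_eq_imp_space_eq[OF sets_mu] by simp

lemma
  fixes xs :: "'e \<Rightarrow>\<^sub>L real"
  shows functional_L2: "blinfun_apply xs \<in> L2 \<mu>"
    and functional_char: "(CLINT x|\<mu>. iexp (blinfun_apply xs x)) = exp (- (L2norm \<mu> (blinfun_apply xs))\<^sup>2 / 2)"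
  using centred_gaussian_L2_char[OF prob_space_axioms, of "blinfun_apply xs"] mu
  by (auto simp: centred_gaussian_radon_measure_def)

sublocale L: complete_semi_inner_product "L2 \<mu>" "L2inner \<mu> :: ('e \<Rightarrow> real) \<Rightarrow> _"
  rewrites "L.nm = L2norm \<mu>"
  by (rule complete_semi_inner_product_L2) (rule nm_L2inner)

lemma subspace_functionals: "subspace (range blinfun_apply :: ('e \<Rightarrow> real) set)"
proof (rule subspaceI)
  show "0 \<in> (range blinfun_apply :: ('e \<Rightarrow> real) set)" by (auto intro!: image_eqI[of _ _ 0] simp: fun_eq_iff)
next
  fix f g :: "'e \<Rightarrow> real" assume "f \<in> range blinfun_apply" "g \<in> range blinfun_apply"
  then obtain xs ys where "f = blinfun_apply xs" "g = blinfun_apply ys" by auto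
  then show "f + g \<in> range blinfun_apply"
    by (auto intro!: image_eqI[of _ _ "xs + ys"] simp: fun_eq_iff blinfun.add_left)
next
  fix c and f :: "'e \<Rightarrow> real" assume "f \<in> range blinfun_apply"
  then obtain xs where "f = blinfun_apply xs" by auto
  then show "c *\<^sub>R f \<in> range blinfun_apply"
    by (auto intro!: image_eqI[of _ _ "c *\<^sub>R xs"] simp: fun_eq_iff scaleR_fun_def blinfun.scaleR_left)
qed

sublocale H: complete_semi_inner_product "H_infty \<mu>" "L2inner \<mu> :: ('e \<Rightarrow> real) \<Rightarrow> _"
  rewrites "H.nm = L2norm \<mu>"
  unfolding H_infty_def
  using L.seq_closure_complete[OF subspace_functionals] functional_L2 nm_L2inner by auto

lemma H_infty_L2: "H_infty \<mu> \<subseteq> L2 \<mu>"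
  by (auto simp: H_infty_def seq_closure_def)

lemma functional_H_infty: "blinfun_apply xs \<in> H_infty \<mu>" for xs :: "'e \<Rightarrow>\<^sub>L real"
proof -
  have "L2norm \<mu> (blinfun_apply xs - blinfun_apply xs) = 0" by (simp add: L2norm_def)
  then show ?thesis unfolding H_infty_def seq_closure_def
    using functional_L2[of xs] by (auto intro!: exI[of _ "\<lambda>_. blinfun_apply xs"])
qed

lemma L2norm_ge_integral_abs: "f \<in> L2 \<mu> \<Longrightarrow> (\<integral>x. \<bar>f x\<bar> \<partial>\<mu>) \<le> L2norm \<mu> f"
  using integral_abs_le_L2norm[of f] by (simp add: prob_space)

text \<open>The function \<open>iexp\<close> is Lipschitz with constant 1, so convergence in
  \<open>L2norm\<close>, and hence in mean, carries over to the characteristic functions; the norms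
  converge as well. Thus limits of Gaussian functionals remain Gaussian.\<close>

lemma H_infty_char:
  assumes h: "h \<in> H_infty \<mu>"
  shows "(CLINT x|\<mu>. iexp (h x)) = exp (- (L2norm \<mu> h)\<^sup>2 / 2)"
proof -
  obtain s where s: "\<And>n. s n \<in> range blinfun_apply" and lim: "(\<lambda>n. L2norm \<mu> (s n - h)) \<longlonglongrightarrow> 0"
    using h by (auto simp: H_infty_def seq_closure_def)
  have sL: "s n \<in> L2 \<mu>" and sc: "(CLINT x|\<mu>. iexp (s n x)) = exp (- (L2norm \<mu> (s n))\<^sup>2 / 2)" for n
    using s[of n] functional_L2 functional_char by auto
  have hL: "h \<in> L2 \<mu>" using h H_infty_L2 by auto
  have [measurable]: "h \<in> borel_measurable \<mu>" "s n \<in> borel_measurable \<mu>" for n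
    using sL[of n] hL by (auto simp: L2_real_iff)
  have int: "integrable \<mu> (\<lambda>x. iexp (f x))" if [measurable]: "f \<in> borel_measurable \<mu>" for f :: "'e \<Rightarrow> real"
    by (rule integrable_const_bound[where B = 1]) auto
  have "(\<lambda>n. (CLINT x|\<mu>. iexp (s n x)) - (CLINT x|\<mu>. iexp (h x))) \<longlonglongrightarrow> 0"
  proof (rule Lim_null_comparison[OF _ lim], rule always_eventually, rule allI)
    fix n
    have "(CLINT x|\<mu>. iexp (s n x)) - (CLINT x|\<mu>. iexp (h x)) = (CLINT x|\<mu>. iexp (s n x) - iexp (h x))"
      by (rule Bochner_Integration.integral_diff[symmetric]) (auto intro: int)
    also have "norm \<dots> \<le> (\<integral>x. norm (iexp (s n x) - iexp (h x)) \<partial>\<mu>)" by (rule integral_norm_bound)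
    also have "\<dots> \<le> (\<integral>x. \<bar>(s n - h) x\<bar> \<partial>\<mu>)"
    proof (rule integral_mono)
      show "integrable \<mu> (\<lambda>x. norm (iexp (s n x) - iexp (h x)))"
        by (intro integrable_norm Bochner_Integration.integrable_diff int) auto
      show "integrable \<mu> (\<lambda>x. \<bar>(s n - h) x\<bar>)"
        using L2_imp_integrable[OF L.mem(3)[OF sL hL]] by (rule integrable_abs)
      fix x
      have "iexp (s n x) - iexp (h x) = iexp (h x) * (iexp (s n x - h x) - 1)"
        by (simp add: exp_diff right_diff_distrib)
      then have "norm (iexp (s n x) - iexp (h x)) = norm (iexp (s n x - h x) - 1)" by (simp add: norm_mult)
      also have "\<dots> \<le> \<bar>s n x - h x\<bar>" using iexp_approx1[of "s n x - h x" 0] by simp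
      finally show "norm (iexp (s n x) - iexp (h x)) \<le> \<bar>(s n - h) x\<bar>" by simp
    qed
    also have "\<dots> \<le> L2norm \<mu> (s n - h)" by (rule L2norm_ge_integral_abs[OF L.mem(3)[OF sL hL]])
    finally show "norm ((CLINT x|\<mu>. iexp (s n x)) - (CLINT x|\<mu>. iexp (h x))) \<le> L2norm \<mu> (s n - h)" .
  qed
  then have 1: "(\<lambda>n. CLINT x|\<mu>. iexp (s n x)) \<longlonglongrightarrow> (CLINT x|\<mu>. iexp (h x))" by (simp add: LIM_zero_iff)
  have "(\<lambda>n. L2norm \<mu> (s n)) \<longlonglongrightarrow> L2norm \<mu> h" by (rule L.tendsto_nm[OF sL hL lim])
  then have 2: "(\<lambda>n. complex_of_real (exp (- (L2norm \<mu> (s n))\<^sup>2 / 2))) \<longlonglongrightarrow> complex_of_real (exp (- (L2norm \<mu> h)\<^sup>2 / 2))"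
    by (intro tendsto_intros) auto
  show ?thesis using LIMSEQ_unique[OF 1[unfolded sc] 2] .
qed

text \<open>A continuous functional commutes with integrals of simple functions and enlarges the
  approximation error at most by its norm. On \<open>H_infty\<close> the result says that the
  adjoint of \<open>i_inf\<close> sends \<open>xs\<close> to \<open>xs\<close>, viewed as a
  function.\<close>

lemma functional_i_inf:
  assumes i: "has_bochner_integral_in UNIV norm \<mu> (\<lambda>x. h x *\<^sub>R x) v" and h: "h \<in> L2 \<mu>"
  shows "blinfun_apply xs v = L2inner \<mu> h (blinfun_apply xs)"
proof -
  have lin: "linear (blinfun_apply xs)" by (rule blinfun.bounded_linear_right[THEN bounded_linear.linear])
  obtain s where s: "\<And>n. Bochner_Integration.simple_bochner_integrable \<mu> (s n)"
     and sm: "\<And>n. (\<lambda>x. norm (h x *\<^sub>R x - s n x)) \<in> borel_measurable \<mu>"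
     and s0: "(\<lambda>n. \<integral>\<^sup>+x. ennreal (norm (h x *\<^sub>R x - s n x)) \<partial>\<mu>) \<longlonglongrightarrow> 0"
     and sv: "(\<lambda>n. norm (Bochner_Integration.simple_bochner_integral \<mu> (s n) - v)) \<longlonglongrightarrow> 0"
    using i unfolding has_bochner_integral_in_def by auto
  have "has_bochner_integral \<mu> (\<lambda>x. blinfun_apply xs (h x *\<^sub>R x)) (blinfun_apply xs v)"
  proof (rule has_bochner_integral.intros)
    have "(\<lambda>x. h x * blinfun_apply xs x) \<in> borel_measurable \<mu>"
      using h functional_L2[of xs] by (auto simp: L2_real_iff intro!: borel_measurable_times)
    then show "(\<lambda>x. blinfun_apply xs (h x *\<^sub>R x)) \<in> borel_measurable \<mu>" by (simp add: blinfun.scaleR_right)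
    show "Bochner_Integration.simple_bochner_integrable \<mu> (\<lambda>x. blinfun_apply xs (s n x))" for n
      using simple_bochner_integrable_compose2[where p = "\<lambda>x y. blinfun_apply xs x", OF _ s[of n] s[of n]] by simp
    show "(\<lambda>n. \<integral>\<^sup>+x. norm (blinfun_apply xs (h x *\<^sub>R x) - blinfun_apply xs (s n x)) \<partial>\<mu>) \<longlonglongrightarrow> 0"
    proof (rule tendsto_sandwich[OF _ _ tendsto_const])
      show "(\<lambda>n. ennreal (norm xs) * (\<integral>\<^sup>+x. ennreal (norm (h x *\<^sub>R x - s n x)) \<partial>\<mu>)) \<longlonglongrightarrow> 0"
        using ennreal_tendsto_cmult[OF _ s0, of "ennreal (norm xs)"] by simp
      have "(\<integral>\<^sup>+x. norm (blinfun_apply xs (h x *\<^sub>R x) - blinfun_apply xs (s n x)) \<partial>\<mu>)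
        \<le> (\<integral>\<^sup>+x. ennreal (norm xs) * ennreal (norm (h x *\<^sub>R x - s n x)) \<partial>\<mu>)" for n
        using norm_blinfun[of xs] by (intro nn_integral_mono) (simp add: blinfun.diff_right[symmetric] ennreal_mult[symmetric])
      then show "\<forall>\<^sub>F n in sequentially. (\<integral>\<^sup>+x. norm (blinfun_apply xs (h x *\<^sub>R x) - blinfun_apply xs (s n x)) \<partial>\<mu>)
        \<le> ennreal (norm xs) * (\<integral>\<^sup>+x. ennreal (norm (h x *\<^sub>R x - s n x)) \<partial>\<mu>)"
        using sm by (auto simp: nn_integral_cmult)
    qed simp
    have "(\<lambda>n. Bochner_Integration.simple_bochner_integral \<mu> (s n)) \<longlonglongrightarrow> v"
      using sv by (simp add: tendsto_norm_zero_iff LIM_zero_iff)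
    then have "(\<lambda>n. blinfun_apply xs (Bochner_Integration.simple_bochner_integral \<mu> (s n))) \<longlonglongrightarrow> blinfun_apply xs v"
      by (rule blinfun.tendsto[OF tendsto_const])
    then show "(\<lambda>n. Bochner_Integration.simple_bochner_integral \<mu> (\<lambda>x. blinfun_apply xs (s n x))) \<longlonglongrightarrow> blinfun_apply xs v"
      by (simp add: simple_bochner_integral_linear[OF lin s])
  qed
  then have "(\<integral>x. blinfun_apply xs (h x *\<^sub>R x) \<partial>\<mu>) = blinfun_apply xs v" by (rule has_bochner_integral_integral_eq)
  then show ?thesis by (simp add: L2inner_def blinfun.scaleR_right)
qed

end

lemma functional_poincare:
  fixes i :: "'h::{real_inner,complete_space} \<Rightarrow> 'e::banach"
  assumes i: "bounded_linear i"
    and S: "c0_semigroup UNIV norm S"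
    and mu: "centred_gaussian_radon_measure \<mu>"
    and mu_cov: "\<And>xs :: 'e \<Rightarrow>\<^sub>L real.
      (\<integral>\<^sup>+x. ennreal ((blinfun_apply xs x)\<^sup>2) \<partial>\<mu>)
        = (\<integral>\<^sup>+t. ennreal ((norm (hadjoint (S t \<circ> i) xs))\<^sup>2) \<partial>half_line)"
    and i_inf: "\<And>h. h \<in> H_infty \<mu> \<Longrightarrow>
      has_bochner_integral_in UNIV norm \<mu> (\<lambda>x. h x *\<^sub>R x) (i_inf h)"
    and S_inf: "c0_contraction_semigroup (H_infty \<mu>) (L2norm \<mu>) S_inf"
      "\<And>t h. t \<ge> 0 \<Longrightarrow> h \<in> H_infty \<mu> \<Longrightarrow> i_inf (S_inf t h) = S t (i_inf h)"
    and B: "bounded_linear B"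
      "\<And>xs. xs \<in> Domain (dual_graph (semigroup_generator UNIV norm S)) \<Longrightarrow>
        \<exists>k. (blinfun_apply xs, k)
              \<in> adjoint_graph (H_infty \<mu>) (L2inner \<mu>) (H_infty \<mu>) (L2inner \<mu>)
                  (semigroup_generator (H_infty \<mu>) (L2norm \<mu>) S_inf) \<and>
            i (B (hadjoint i xs)) = - i_inf k"
    and stable: "uniformly_exp_stable (H_infty \<mu>) (L2norm \<mu>) S_inf"
  obtains C where "0 \<le> C" "\<And>xs. L2norm \<mu> (blinfun_apply xs) \<le> C * norm (hadjoint i xs)"
proof -
  interpret S: banach_c0_semigroup S by unfold_locales (rule S)
  interpret gaussian_radon \<mu> by unfold_locales (rule mu)
  have pair: "blinfun_apply xs (i_inf h) = L2inner \<mu> h (blinfun_apply xs)" if "h \<in> H_infty \<mu>" for h xs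
    using functional_i_inf[OF i_inf[OF that]] that H_infty_L2 by auto
  have S_inf_mem: "S_inf t h \<in> H_infty \<mu>" if "0 \<le> t" "h \<in> H_infty \<mu>" for t h
    using S_inf(1) that by (auto simp: c0_contraction_semigroup_def c0_semigroup_def bounded_op_def)
  obtain K where K: "0 \<le> K" "\<And>h. norm (B h) \<le> norm h * K"
    using bounded_linear.nonneg_bounded[OF B(1)] by blast
  \<comment> \<open>Any factor below 1 would serve; with 1/2, half of \<open>N\<^sup>2\<close> is
    absorbed below.\<close>
  obtain T where T: "0 < T" "\<And>h. h \<in> H_infty \<mu> \<Longrightarrow> L2norm \<mu> (S_inf T h) \<le> 1 / 2 * L2norm \<mu> h"
  proof -
    obtain M \<omega> where M: "\<omega> > 0" "\<And>t h. 0 \<le> t \<Longrightarrow> h \<in> H_infty \<mu> \<Longrightarrow> L2norm \<mu> (S_inf t h) \<le> M * exp (- \<omega> * t) * L2norm \<mu> h"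
      using stable by (auto simp: uniformly_exp_stable_def)
    have "((\<lambda>t. M * exp (- \<omega> * t)) \<longlongrightarrow> 0) at_top" using M(1) by real_asymp
    then have "\<forall>\<^sub>F t in at_top. M * exp (- \<omega> * t) < 1 / 2" by (rule order_tendstoD(2)) simp
    moreover have "\<forall>\<^sub>F t in at_top. (0::real) < t" by (rule eventually_gt_at_top)
    ultimately have "\<forall>\<^sub>F t in at_top. M * exp (- \<omega> * t) < 1 / 2 \<and> 0 < t" by (rule eventually_conj)
    from eventually_happens'[OF trivial_limit_at_top_linorder this]
    obtain T where T: "M * exp (- \<omega> * T) < 1 / 2" "0 < T" by blast
    show ?thesis
    proof (rule that[OF T(2)])
      fix h assume h: "h \<in> H_infty \<mu>"
      have "M * exp (- \<omega> * T) * L2norm \<mu> h \<le> 1 / 2 * L2norm \<mu> h"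
        using T h by (intro mult_right_mono) auto
      then show "L2norm \<mu> (S_inf T h) \<le> 1 / 2 * L2norm \<mu> h" using M(2)[of T h] T h by linarith
    qed
  qed
  \<comment> \<open>The constant arises from
    \<open>N\<^sup>2 / 2 \<le> norm (hadjoint i xs) * norm (B b)\<close>, the bound \<open>K\<close>
    of \<open>B\<close>, and \<open>norm b \<le> sqrt T * N\<close>, after one factor
    \<open>N\<close> is cancelled.\<close>
  have main: "L2norm \<mu> (blinfun_apply xs) \<le> 2 * K * sqrt T * norm (hadjoint i xs)" for xs
  proof -
    define N where "N = L2norm \<mu> (blinfun_apply xs)"
    have N: "0 \<le> N" by (simp add: N_def L2norm_def)
    define ys where "ys = S.integral_dual_S T xs"
    define zs where "zs = S.dual_S T xs - xs"
    define b where "b = hadjoint i ys"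
    note fH = functional_H_infty
    have "ys \<in> Domain (dual_graph (semigroup_generator UNIV norm S))"
      using S.integral_dual_S_in_dual_graph[OF T(1), of xs] by (auto simp: ys_def)
    from B(2)[OF this] obtain k where k: "k \<in> H_infty \<mu>" and iB: "i (B b) = - i_inf k"
      and adj: "\<And>u v. (u, v) \<in> semigroup_generator (H_infty \<mu>) (L2norm \<mu>) S_inf \<Longrightarrow> L2inner \<mu> v (blinfun_apply ys) = L2inner \<mu> u k"
      by (auto simp: adjoint_graph_def b_def)
    \<comment> \<open>The difference quotients of \<open>S_inf\<close> at \<open>u\<close>, paired
      with \<open>ys\<close>, have two limits: one from the definition of the generator, and one on
      the side of E, because \<open>i_inf\<close> intertwines \<open>S_inf\<close> with
      \<open>S\<close>.\<close>
    have gen: "L2inner \<mu> u k = L2inner \<mu> u (blinfun_apply zs)"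
      if uv: "(u, v) \<in> semigroup_generator (H_infty \<mu>) (L2norm \<mu>) S_inf" for u v
    proof -
      have u: "u \<in> H_infty \<mu>" and v: "v \<in> H_infty \<mu>"
        and lim: "((\<lambda>t. L2norm \<mu> ((1 / t) *\<^sub>R (S_inf t u - u) - v)) \<longlongrightarrow> 0) (at_right 0)"
        using uv by (auto simp: semigroup_generator_def)
      have ev: "\<forall>\<^sub>F t in at_right 0. (1 / t) *\<^sub>R (S_inf t u - u) \<in> H_infty \<mu>"
        using eventually_at_right_less[of "0::real"] by eventually_elim (use u S_inf_mem in auto)
      have 1: "((\<lambda>t. L2inner \<mu> ((1 / t) *\<^sub>R (S_inf t u - u)) (blinfun_apply ys)) \<longlongrightarrow> L2inner \<mu> v (blinfun_apply ys)) (at_right 0)"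
        by (rule H.tendsto_ip[OF ev v fH lim])
      have eq: "\<forall>\<^sub>F t in at_right 0. blinfun_apply ys ((1 / t) *\<^sub>R (S t (i_inf u) - i_inf u))
          = L2inner \<mu> ((1 / t) *\<^sub>R (S_inf t u - u)) (blinfun_apply ys)"
        using eventually_at_right_less[of "0::real"]
      proof eventually_elim
        case (elim t)
        then show ?case
          using u S_inf_mem[of t u] fH[of ys] pair[of u ys] pair[of "S_inf t u" ys] S_inf(2)[of t u]
          by (simp add: H.ip_simps blinfun.scaleR_right blinfun.diff_right)
      qed
      have 2: "((\<lambda>t. L2inner \<mu> ((1 / t) *\<^sub>R (S_inf t u - u)) (blinfun_apply ys)) \<longlongrightarrow> blinfun_apply zs (i_inf u)) (at_right 0)"
        using S.integral_dual_S_difference_quotient[OF T(1), of xs "i_inf u"] eq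
        unfolding ys_def zs_def by (rule Lim_transform_eventually)
      have "L2inner \<mu> v (blinfun_apply ys) = blinfun_apply zs (i_inf u)"
        by (rule tendsto_unique[OF trivial_limit_at_right_real 1 2])
      then show ?thesis using adj[OF uv] pair[OF u] by simp
    qed
    \<comment> \<open>Density of the domain extends the identity to all of \<open>H_infty\<close>.
      \<open>k\<close> itself is thereby fixed only up to seminorm zero, which is enough for
      pairings.\<close>
    have kz: "L2inner \<mu> h k = L2inner \<mu> h (blinfun_apply zs)" if h: "h \<in> H_infty \<mu>" for h
    proof -
      define w where "w = k - blinfun_apply zs"
      have w: "w \<in> H_infty \<mu>" using k fH by (simp add: w_def)
      have w_small: "\<bar>L2inner \<mu> h w\<bar> \<le> e * L2norm \<mu> w" if "e > 0" for e
      proof -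
        obtain u v where uv: "(u, v) \<in> semigroup_generator (H_infty \<mu>) (L2norm \<mu>) S_inf" "L2norm \<mu> (u - h) < e"
          using H.c0_contraction_semigroup_generator_dense[OF S_inf(1) h \<open>e > 0\<close>] by blast
        have u: "u \<in> H_infty \<mu>" using uv by (auto simp: semigroup_generator_def)
        have "L2inner \<mu> u w = 0" using gen[OF uv(1)] u k fH[of zs] by (simp add: w_def H.ip_simps)
        then have "\<bar>L2inner \<mu> h w\<bar> = \<bar>L2inner \<mu> (u - h) w\<bar>" using u h w by (simp add: H.ip_simps)
        also have "\<dots> \<le> L2norm \<mu> (u - h) * L2norm \<mu> w" using u h w by (intro H.Cauchy_Schwarz) auto
        also have "\<dots> \<le> e * L2norm \<mu> w" using uv w by (intro mult_right_mono) auto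
        finally show ?thesis .
      qed
      have "\<bar>L2inner \<mu> h w\<bar> \<le> 0 + e" if "e > 0" for e
      proof -
        have "\<bar>L2inner \<mu> h w\<bar> \<le> e / (L2norm \<mu> w + 1) * L2norm \<mu> w"
          by (rule w_small) (use that H.nm_nonneg[OF w] in \<open>auto intro!: divide_pos_pos\<close>)
        also have "\<dots> \<le> e" using that H.nm_nonneg[OF w] by (simp add: field_simps)
        finally show ?thesis by simp
      qed
      then have "\<bar>L2inner \<mu> h w\<bar> \<le> 0" by (rule field_le_epsilon)
      then show ?thesis using h k fH[of zs] by (simp add: w_def H.ip_simps)
    qed
    have "hadjoint i xs \<bullet> B b = blinfun_apply xs (i (B b))" by (rule inner_hadjoint[OF i])
    also have "\<dots> = - L2inner \<mu> k (blinfun_apply xs)" by (simp add: iB pair[OF k] blinfun.minus_right)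
    also have "\<dots> = - L2inner \<mu> (blinfun_apply xs) (blinfun_apply zs)"
      using H.commute[OF k fH[of xs]] kz[OF fH[of xs]] by simp
    also have "\<dots> = - L2inner \<mu> (S_inf T (blinfun_apply xs)) (blinfun_apply xs) + N\<^sup>2"
    proof -
      have "L2inner \<mu> (blinfun_apply xs) (blinfun_apply zs) = blinfun_apply zs (i_inf (blinfun_apply xs))"
        using pair[OF fH] by simp
      also have "\<dots> = blinfun_apply xs (i_inf (S_inf T (blinfun_apply xs))) - blinfun_apply xs (i_inf (blinfun_apply xs))"
        using T(1) S_inf(2)[of T "blinfun_apply xs"] fH by (simp add: zs_def blinfun.diff_left S.dual_S)
      also have "\<dots> = L2inner \<mu> (S_inf T (blinfun_apply xs)) (blinfun_apply xs) - N\<^sup>2"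
        using pair[OF fH] pair[OF S_inf_mem[OF _ fH]] T(1) H.nm_sq[OF fH] by (simp add: N_def)
      finally show ?thesis by simp
    qed
    finally have N2: "N\<^sup>2 = hadjoint i xs \<bullet> B b + L2inner \<mu> (S_inf T (blinfun_apply xs)) (blinfun_apply xs)" by simp
    have "\<bar>L2inner \<mu> (S_inf T (blinfun_apply xs)) (blinfun_apply xs)\<bar> \<le> L2norm \<mu> (S_inf T (blinfun_apply xs)) * N"
      unfolding N_def using T(1) fH S_inf_mem by (intro H.Cauchy_Schwarz) auto
    also have "\<dots> \<le> 1 / 2 * N * N"
      using T(2)[OF fH] N unfolding N_def by (intro mult_right_mono) auto
    finally have half: "N\<^sup>2 / 2 \<le> hadjoint i xs \<bullet> B b" using N2 by (simp add: power2_eq_square)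
    \<comment> \<open>The square of \<open>norm b\<close> is the integral of \<open>f\<close>, whose
      values are the inner products of \<open>hadjoint (S s \<circ> i) xs\<close> with
      \<open>b\<close>. Bounding its square by \<open>T\<close> times the integral of
      \<open>f\<^sup>2\<close> brings in the covariance formula.\<close>
    have b: "norm b \<le> sqrt T * N"
    proof (cases "b = 0")
      case False
      define f where "f s = blinfun_apply xs (S s (i b))" for s
      have f: "continuous_on {0..T} f" unfolding f_def by (rule S.continuous_on_dual) simp
      have "(norm b)\<^sup>2 = blinfun_apply ys (i b)"
        using inner_hadjoint[OF i, of ys b] by (simp add: b_def power2_norm_eq_inner)
      also have "\<dots> = integral {0..T} f" by (simp add: ys_def S.integral_dual_S f_def[abs_def])
      finally have b2: "(norm b)\<^sup>2 = integral {0..T} f" .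
      \<comment> \<open>Divided by \<open>norm b\<close>, \<open>f\<close> is dominated by the norms
        in the covariance formula, whose integral over the whole half-line is
        \<open>N\<^sup>2\<close>.\<close>
      have "ennreal (integral {0..T} (\<lambda>s. (f s / norm b)\<^sup>2)) \<le> (\<integral>\<^sup>+t. ennreal ((norm (hadjoint (S t \<circ> i) xs))\<^sup>2) \<partial>half_line)"
      proof (rule nn_integral_half_line_ge)
        fix s assume s: "0 \<le> s" "s \<le> T"
        have "f s = hadjoint (S s \<circ> i) xs \<bullet> b"
          using inner_hadjoint[OF bounded_linear_compose[OF S.bounded_linear_S[OF s(1)] i], of xs b] by (simp add: f_def o_def)
        then have "\<bar>f s / norm b\<bar> \<le> norm (hadjoint (S s \<circ> i) xs)"
          using Cauchy_Schwarz_ineq2[of "hadjoint (S s \<circ> i) xs" b] False by (simp add: field_simps)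
        then have "(f s / norm b)\<^sup>2 \<le> (norm (hadjoint (S s \<circ> i) xs))\<^sup>2"
          by (metis abs_ge_zero power2_abs power_mono)
        then show "ennreal ((f s / norm b)\<^sup>2) \<le> ennreal ((norm (hadjoint (S s \<circ> i) xs))\<^sup>2)" by (rule ennreal_leI)
      qed (use f False in \<open>auto intro!: continuous_intros\<close>)
      also have "\<dots> = ennreal (N\<^sup>2)"
      proof -
        have "(\<integral>\<^sup>+x. ennreal ((blinfun_apply xs x)\<^sup>2) \<partial>\<mu>) = ennreal (\<integral>x. (blinfun_apply xs x)\<^sup>2 \<partial>\<mu>)"
          using functional_L2[of xs] by (intro nn_integral_eq_integral) (auto simp: L2_real_iff)
        then show ?thesis by (simp add: mu_cov[symmetric] N_def L2norm_def)
      qed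
      finally have "integral {0..T} (\<lambda>s. (f s / norm b)\<^sup>2) \<le> N\<^sup>2" by simp
      then have fN: "integral {0..T} (\<lambda>s. (f s)\<^sup>2) \<le> N\<^sup>2 * (norm b)\<^sup>2"
        using False by (simp add: power_divide field_simps)
      have "(norm b)\<^sup>2 * (norm b)\<^sup>2 \<le> T * integral {0..T} (\<lambda>s. (f s)\<^sup>2)"
        using integral_square_le[OF T(1) f] b2 by (simp add: power2_eq_square)
      also have "\<dots> \<le> T * (N\<^sup>2 * (norm b)\<^sup>2)" using fN T(1) by simp
      finally have "(norm b)\<^sup>2 * (norm b)\<^sup>2 \<le> (T * N\<^sup>2) * (norm b)\<^sup>2" by (simp only: mult.assoc)
      then have "(norm b)\<^sup>2 \<le> T * N\<^sup>2" by (rule mult_right_le_imp_le) (use False in simp)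
      then have "(norm b)\<^sup>2 \<le> (sqrt T * N)\<^sup>2" using T(1) by (simp add: power_mult_distrib)
      then show ?thesis by (rule power2_le_imp_le) (use T(1) N in simp)
    qed (use T(1) N in simp)
    have "N\<^sup>2 / 2 \<le> norm (hadjoint i xs) * norm (B b)"
      using half Cauchy_Schwarz_ineq2[of "hadjoint i xs" "B b"] by linarith
    also have "\<dots> \<le> norm (hadjoint i xs) * (sqrt T * N * K)"
      using K(2)[of b] mult_right_mono[OF b K(1)] by (intro mult_left_mono) auto
    finally have "N * N \<le> 2 * K * sqrt T * norm (hadjoint i xs) * N" by (simp add: power2_eq_square mult_ac)
    then have "N \<le> 2 * K * sqrt T * norm (hadjoint i xs)"
      using N K(1) T(1) by (cases "N = 0") auto
    then show ?thesis by (simp add: N_def)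
  qed
  show ?thesis by (rule that[of "2 * K * sqrt T"]) (use K(1) T(1) main in auto)
qed

section \<open>The estimate for the gradient\<close>

lemma hadjoint_sum:
  fixes i :: "'h::{real_inner,complete_space} \<Rightarrow> 'e::real_normed_vector"
  assumes i: "bounded_linear i"
  shows "hadjoint i (\<Sum>j\<in>J. c j *\<^sub>R xs j) = (\<Sum>j\<in>J. c j *\<^sub>R hadjoint i (xs j))"
  by (rule hadjoint_unique[OF i])
     (simp add: inner_sum_left inner_hadjoint[OF i] blinfun.sum_left blinfun.scaleR_left)

text \<open>The semi-inner product on \<open>L2\<close> is set up for real functions only, so the
  triangle inequality for H-valued functions is reduced to the pointwise norms.\<close>

lemma L2norm_le_L2norm_add:
  fixes F G :: "'a \<Rightarrow> 'h::real_inner"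
  assumes F: "F \<in> L2 M" and G: "G \<in> L2 M"
  shows "L2norm M F \<le> L2norm M G + L2norm M (F - G)"
proof -
  interpret semi_inner_product "L2 M" "L2inner M :: ('a \<Rightarrow> real) \<Rightarrow> _" by (rule semi_inner_product_L2)
  define f where "f x = norm (F x)" for x
  define g where "g x = norm (G x)" for x
  define d where "d x = norm ((F - G) x)" for x
  have sm: "strongly_measurable M F" "strongly_measurable M G"
    and sq: "integrable M (\<lambda>x. (norm (F x))\<^sup>2)" "integrable M (\<lambda>x. (norm (G x))\<^sup>2)"
    using F G by (auto simp: L2_def)
  have fL: "f \<in> L2 M" and gL: "g \<in> L2 M"
    using sq strongly_measurable_norm[OF sm(1)] strongly_measurable_norm[OF sm(2)]
    by (auto simp: L2_real_iff f_def[abs_def] g_def[abs_def])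
  have dm: "d \<in> borel_measurable M"
    using strongly_measurable_norm[OF strongly_measurable_lincomb[OF sm, of 1 "-1"]] by (simp add: d_def[abs_def])
  have "(d x)\<^sup>2 \<le> (f x + g x)\<^sup>2" for x
    unfolding d_def f_def g_def by (intro power_mono) (auto simp: norm_triangle_ineq4)
  moreover have "integrable M (\<lambda>x. (f x + g x)\<^sup>2)" using mem(2)[OF fL gL] by (simp add: L2_real_iff plus_fun_def)
  ultimately have "integrable M (\<lambda>x. (d x)\<^sup>2)"
    using dm by (auto intro: Bochner_Integration.integrable_bound)
  then have dL: "d \<in> L2 M" using dm by (simp add: L2_real_iff)
  have "f x \<le> g x + d x" for x
    unfolding f_def g_def d_def using norm_triangle_sub[of "F x" "G x"] by simp
  then have "(f x)\<^sup>2 \<le> ((g + d) x)\<^sup>2" for x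
    by (intro power_mono) (auto simp: f_def)
  then have "L2norm M f \<le> L2norm M (g + d)"
    unfolding L2norm_def using fL mem(2)[OF gL dL] by (intro real_sqrt_le_mono integral_mono) (auto simp: L2_real_iff)
  also have "\<dots> \<le> L2norm M g + L2norm M d"
    using nm_triangle[OF gL dL] by (simp add: nm_L2inner)
  finally show ?thesis by (simp add: L2norm_def f_def g_def d_def)
qed

lemma L2norm_sq: "(L2norm M f)\<^sup>2 = (\<integral>x. (norm (f x))\<^sup>2 \<partial>M)"
  by (simp add: L2norm_def)

context prob_space begin

lemma L2norm_centred:
  fixes f :: "'a \<Rightarrow> real"
  assumes f: "f \<in> L2 M"
  shows "(L2norm M (\<lambda>x. f x - expectation f))\<^sup>2 = expectation (\<lambda>x. (f x)\<^sup>2) - (expectation f)\<^sup>2"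
proof -
  have i: "integrable M f" "integrable M (\<lambda>x. (f x)\<^sup>2)" using f L2_imp_integrable[OF f] by (auto simp: L2_real_iff)
  show ?thesis unfolding L2norm_sq real_norm_def power2_abs by (rule variance_eq[OF i])
qed

lemma L2norm_centred_le:
  fixes f :: "'a \<Rightarrow> real"
  assumes f: "f \<in> L2 M"
  shows "L2norm M (\<lambda>x. f x - expectation f) \<le> L2norm M f"
proof (rule power2_le_imp_le)
  show "(L2norm M (\<lambda>x. f x - expectation f))\<^sup>2 \<le> (L2norm M f)\<^sup>2"
    unfolding L2norm_centred[OF f] unfolding L2norm_sq by simp
qed (simp add: L2norm_def)

text \<open>The mixed term factorises by independence. The factor 2 counts the variances of both
  copies.\<close>

lemma expectation_pair_diff_square:
  fixes f :: "'a \<Rightarrow> real"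
  assumes f: "f \<in> L2 M"
  shows "(\<integral>p. (f (snd p) - f (fst p))\<^sup>2 \<partial>(M \<Otimes>\<^sub>M M)) = 2 * (L2norm M (\<lambda>x. f x - expectation f))\<^sup>2"
proof -
  interpret PP: pair_prob_space M M ..
  have i: "integrable M f" "integrable M (\<lambda>x. (f x)\<^sup>2)" using f L2_imp_integrable[OF f] by (auto simp: L2_real_iff)
  have [measurable]: "f \<in> borel_measurable M" using f by (simp add: L2_real_iff)
  note sq = integrable_pair_fst[OF i(2)] integrable_pair_snd[OF i(2)]
  have prod: "integrable (M \<Otimes>\<^sub>M M) (\<lambda>p. f (fst p) * f (snd p))"
  proof (rule Bochner_Integration.integrable_bound[OF Bochner_Integration.integrable_add[OF sq(1,3)]])
    have "\<bar>a * b\<bar> \<le> a\<^sup>2 + b\<^sup>2" for a b :: real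
      using sum_squares_bound[of "\<bar>a\<bar>" "\<bar>b\<bar>"] mult_nonneg_nonneg[of "\<bar>a\<bar>" "\<bar>b\<bar>"]
      unfolding abs_mult power2_abs by linarith
    then show "AE p in M \<Otimes>\<^sub>M M. norm (f (fst p) * f (snd p)) \<le> norm ((f (fst p))\<^sup>2 + (f (snd p))\<^sup>2)" by simp
  qed measurable
  have "(\<integral>p. f (fst p) * f (snd p) \<partial>(M \<Otimes>\<^sub>M M)) = (\<integral>x. (\<integral>y. f x * f y \<partial>M) \<partial>M)"
    by (subst PP.integral_fst'[OF prod, symmetric]) simp
  also have "\<dots> = (expectation f)\<^sup>2" by (simp add: power2_eq_square)
  finally have p: "(\<integral>p. f (fst p) * f (snd p) \<partial>(M \<Otimes>\<^sub>M M)) = (expectation f)\<^sup>2" .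
  have "(\<lambda>p. (f (snd p) - f (fst p))\<^sup>2) = (\<lambda>p. (f (fst p))\<^sup>2 + (f (snd p))\<^sup>2 - 2 * (f (fst p) * f (snd p)))"
    by (simp add: fun_eq_iff power2_diff)
  then have "(\<integral>p. (f (snd p) - f (fst p))\<^sup>2 \<partial>(M \<Otimes>\<^sub>M M))
     = expectation (\<lambda>x. (f x)\<^sup>2) + expectation (\<lambda>x. (f x)\<^sup>2) - 2 * (expectation f)\<^sup>2"
    using sq prod by (simp add: p)
  then show ?thesis by (simp add: L2norm_centred[OF f])
qed

end

context gaussian_radon begin

text \<open>Each \<open>h j\<close> is approximated by functionals along the graph of U; combined
  with the coefficients \<open>c j\<close>, the approximants are functionals again, and the bound
  survives the limit. The \<open>c j\<close> will be the partial derivatives of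
  \<open>\<phi>\<close> at a fixed point.\<close>

lemma U_op_poincare:
  fixes i :: "'h::{real_inner,complete_space} \<Rightarrow> 'e"
  assumes i: "bounded_linear i"
    and C: "\<And>xs. L2norm \<mu> (blinfun_apply xs) \<le> C * norm (hadjoint i xs)"
    and U: "\<And>j. j < n \<Longrightarrow> (h j, Uh j) \<in> U_op \<mu> i"
  shows "L2norm \<mu> (\<lambda>x. \<Sum>j<n. c j * h j x) \<le> C * norm (\<Sum>j<n. c j *\<^sub>R Uh j)"
proof -
  have "\<exists>xs. (\<lambda>m. L2norm \<mu> (blinfun_apply (xs m) - h j)) \<longlonglongrightarrow> 0 \<and> (\<lambda>m. hadjoint i (xs m)) \<longlonglongrightarrow> Uh j"
    if j: "j < n" for j
  proof -
    obtain s where s: "\<And>m. s m \<in> {(blinfun_apply xs, hadjoint i xs) | xs. True}"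
      and lim: "(\<lambda>m. (\<lambda>(x, y). L2norm \<mu> x + norm y) (s m - (h j, Uh j))) \<longlonglongrightarrow> 0"
      using U[OF j] by (auto simp: U_op_def op_closure_def seq_closure_def)
    obtain xs where xs: "\<And>m. s m = (blinfun_apply (xs m), hadjoint i (xs m))" using s by (simp, metis)
    have lim': "(\<lambda>m. L2norm \<mu> (blinfun_apply (xs m) - h j) + norm (hadjoint i (xs m) - Uh j)) \<longlonglongrightarrow> 0"
      using lim by (simp add: xs)
    have "(\<lambda>m. L2norm \<mu> (blinfun_apply (xs m) - h j)) \<longlonglongrightarrow> 0"
      by (rule Lim_null_comparison[OF _ lim']) (simp add: L2norm_def)
    moreover have "(\<lambda>m. norm (hadjoint i (xs m) - Uh j)) \<longlonglongrightarrow> 0"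
      by (rule Lim_null_comparison[OF _ lim']) (simp add: L2norm_def)
    ultimately show ?thesis by (auto simp: tendsto_norm_zero_iff LIM_zero_iff)
  qed
  then obtain xs where xs: "\<And>j. j < n \<Longrightarrow> (\<lambda>m. L2norm \<mu> (blinfun_apply (xs j m) - h j)) \<longlonglongrightarrow> 0"
      "\<And>j. j < n \<Longrightarrow> (\<lambda>m. hadjoint i (xs j m)) \<longlonglongrightarrow> Uh j" by metis
  have h: "h j \<in> H_infty \<mu>" if "j < n" for j
    using U[OF that] by (auto simp: U_op_def op_closure_def seq_closure_def)
  define g where "g = (\<Sum>j<n. c j *\<^sub>R h j)"
  define X where "X m = (\<Sum>j<n. c j *\<^sub>R xs j m)" for m
  have g: "g \<in> H_infty \<mu>" unfolding g_def using h by (intro subspace_sum H.subspace) auto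
  have X: "blinfun_apply (X m) - g = (\<Sum>j<n. c j *\<^sub>R (blinfun_apply (xs j m) - h j))" for m
    by (simp add: X_def g_def fun_eq_iff blinfun.sum_left blinfun.scaleR_left sum_fun_apply scaleR_fun_def
        sum_subtractf right_diff_distrib)
  have "(\<lambda>m. L2norm \<mu> (blinfun_apply (X m) - g)) \<longlonglongrightarrow> 0"
  proof (rule Lim_null_comparison)
    have "L2norm \<mu> (blinfun_apply (X m) - g) \<le> (\<Sum>j<n. \<bar>c j\<bar> * L2norm \<mu> (blinfun_apply (xs j m) - h j))" for m
    proof -
      have "L2norm \<mu> (\<Sum>j<n. c j *\<^sub>R (blinfun_apply (xs j m) - h j))
          \<le> (\<Sum>j<n. L2norm \<mu> (c j *\<^sub>R (blinfun_apply (xs j m) - h j)))"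
        by (rule H.nm_sum) (use h functional_H_infty in auto)
      also have "\<dots> = (\<Sum>j<n. \<bar>c j\<bar> * L2norm \<mu> (blinfun_apply (xs j m) - h j))"
        using h functional_H_infty by (intro sum.cong refl H.nm_scale) auto
      finally show ?thesis by (simp only: X)
    qed
    then show "\<forall>\<^sub>F m in sequentially. norm (L2norm \<mu> (blinfun_apply (X m) - g)) \<le> (\<Sum>j<n. \<bar>c j\<bar> * L2norm \<mu> (blinfun_apply (xs j m) - h j))"
      by (simp add: L2norm_def)
    have "(\<lambda>m. \<Sum>j<n. \<bar>c j\<bar> * L2norm \<mu> (blinfun_apply (xs j m) - h j)) \<longlonglongrightarrow> (\<Sum>j<n. \<bar>c j\<bar> * 0)"
      using xs(1) by (intro tendsto_sum tendsto_mult tendsto_const) auto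
    then show "(\<lambda>m. \<Sum>j<n. \<bar>c j\<bar> * L2norm \<mu> (blinfun_apply (xs j m) - h j)) \<longlonglongrightarrow> 0" by simp
  qed
  then have 1: "(\<lambda>m. L2norm \<mu> (blinfun_apply (X m))) \<longlonglongrightarrow> L2norm \<mu> g"
    by (rule H.tendsto_nm[OF functional_H_infty g])
  have 2: "(\<lambda>m. C * norm (hadjoint i (X m))) \<longlonglongrightarrow> C * norm (\<Sum>j<n. c j *\<^sub>R Uh j)"
    unfolding X_def hadjoint_sum[OF i] using xs(2) by (intro tendsto_intros) auto
  have "L2norm \<mu> g \<le> C * norm (\<Sum>j<n. c j *\<^sub>R Uh j)"
    by (rule LIMSEQ_le[OF 1 2]) (use C in auto)
  moreover have "g = (\<lambda>x. \<Sum>j<n. c j * h j x)" by (simp add: g_def fun_eq_iff sum_fun_apply scaleR_fun_def)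
  ultimately show ?thesis by simp
qed

lemma cylindrical_gradient_poincare:
  fixes i :: "'h::{real_inner,complete_space} \<Rightarrow> 'e"
  assumes i: "bounded_linear i" and C0: "0 \<le> C"
    and bound: "\<And>xs. L2norm \<mu> (blinfun_apply xs) \<le> C * norm (hadjoint i xs)"
    and f: "(f, F) \<in> cylindrical_gradient (U_op \<mu> i)"
  shows "f \<in> L2 \<mu>" "F \<in> L2 \<mu>" "L2norm \<mu> (\<lambda>x. f x - expectation f) \<le> pi * C * L2norm \<mu> F"
proof -
  obtain n \<phi> d\<phi> h Uh where fF: "f = (\<lambda>x. \<phi> (\<lambda>j. h j x))" "F = (\<lambda>x. \<Sum>j<n. d\<phi> j (\<lambda>k. h k x) *\<^sub>R Uh j)"
    and \<phi>: "C1b n \<phi> d\<phi>" and U: "\<And>j. j < n \<Longrightarrow> (h j, Uh j) \<in> U_op \<mu> i"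
    using f by (auto simp: cylindrical_gradient_def)
  have h: "h j \<in> H_infty \<mu>" if "j < n" for j
    using U[OF that] by (auto simp: U_op_def op_closure_def seq_closure_def)
  interpret gaussian_cylinder_function \<mu> "H_infty \<mu>" n h \<phi> d\<phi>
    by unfold_locales (use H.subspace H_infty_L2 H_infty_char \<phi> h in auto)
  \<comment> \<open>As in \<open>rot\<close>, coordinates from \<open>n\<close> on are set to 0,
    because \<open>h j\<close> is unrestricted there and need not be measurable.\<close>
  define hn where "hn x = (\<lambda>j. if j < n then h j x else 0)" for x
  have hn: "hn \<in> borel_measurable \<mu>"
  proof (rule measurable_coordinatewise_then_product)
    fix j show "(\<lambda>x. hn x j) \<in> borel_measurable \<mu>"
      using h_measurable[of j] by (cases "j < n") (simp_all add: hn_def)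
  qed
  have f_eq: "f x = \<phi> (hn x)" for x unfolding fF by (rule C1b_cong[OF \<phi>]) (simp add: hn_def)
  have d_eq: "d\<phi> j (\<lambda>k. h k x) = d\<phi> j (hn x)" if "j < n" for j x
    by (rule C1b_partial_cong[OF \<phi> that]) (simp add: hn_def)
  have dm: "(\<lambda>x. d\<phi> j (\<lambda>k. h k x)) \<in> borel_measurable \<mu>" if "j < n" for j
    using measurable_compose[OF hn d\<phi>_measurableurable[OF that]] by (simp add: d_eq[OF that])
  have fm: "f \<in> borel_measurable \<mu>"
    using measurable_compose[OF hn \<phi>_measurable] by (simp add: f_eq[abs_def])
  obtain b where b: "\<And>x. \<bar>\<phi> x\<bar> \<le> b" using \<phi> by (auto simp: C1b_def bounded_real)
  have "(\<phi> x)\<^sup>2 \<le> b\<^sup>2" for x using b[of x] by (metis abs_ge_zero power2_abs power_mono)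
  then show fL: "f \<in> L2 \<mu>"
    unfolding L2_real_iff using fm by (auto simp: fF intro!: integrable_const_bound[where B = "b\<^sup>2"])
  obtain L where L: "0 \<le> L" "\<And>j x. j < n \<Longrightarrow> \<bar>d\<phi> j x\<bar> \<le> L" using C1b_partial_bounded[OF \<phi>] by blast
  have Fm: "strongly_measurable \<mu> F"
    unfolding fF by (intro strongly_measurable_sum strongly_measurable_scaleR dm) auto
  have Fb: "norm (F x) \<le> (\<Sum>j<n. L * norm (Uh j))" for x
    unfolding fF using L by (intro order_trans[OF norm_sum] sum_mono) (auto intro: mult_right_mono)
  have F2: "integrable \<mu> (\<lambda>x. (norm (F x))\<^sup>2)"
    using strongly_measurable_norm[OF Fm] power_mono[OF Fb norm_ge_zero]
    by (intro integrable_const_bound[where B = "(\<Sum>j<n. L * norm (Uh j))\<^sup>2"]) auto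
  then show FL: "F \<in> L2 \<mu>" using Fm by (simp add: L2_def)
  let ?g = "\<lambda>p. (\<Sum>j<n. d\<phi> j (\<lambda>k. h k (fst p)) * h j (snd p))\<^sup>2"
  have gi: "integrable (\<mu> \<Otimes>\<^sub>M \<mu>) ?g" by (rule gaussian_poincare)
  \<comment> \<open>By Fubini the first copy can be frozen: the inner integral is the squared norm
    of a linear combination of the \<open>h j\<close> whose image under U is
    \<open>F x\<close>.\<close>
  have "(\<integral>p. ?g p \<partial>(\<mu> \<Otimes>\<^sub>M \<mu>)) = (\<integral>x. (\<integral>y. (\<Sum>j<n. d\<phi> j (\<lambda>k. h k x) * h j y)\<^sup>2 \<partial>\<mu>) \<partial>\<mu>)"
    by (subst PP.integral_fst'[OF gi, symmetric]) simp
  also have "\<dots> \<le> (\<integral>x. C\<^sup>2 * (norm (F x))\<^sup>2 \<partial>\<mu>)"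
  proof (rule integral_mono)
    show "integrable \<mu> (\<lambda>x. \<integral>y. (\<Sum>j<n. d\<phi> j (\<lambda>k. h k x) * h j y)\<^sup>2 \<partial>\<mu>)"
      using PP.integrable_fst'[OF gi] by simp
    show "integrable \<mu> (\<lambda>x. C\<^sup>2 * (norm (F x))\<^sup>2)" using F2 by simp
    fix x
    have "(L2norm \<mu> (\<lambda>y. \<Sum>j<n. d\<phi> j (\<lambda>k. h k x) * h j y))\<^sup>2 \<le> (C * norm (F x))\<^sup>2"
      using U_op_poincare[OF i bound U, where c = "\<lambda>j. d\<phi> j (\<lambda>k. h k x)"]
      by (intro power_mono) (auto simp: fF L2norm_def)
    then show "(\<integral>y. (\<Sum>j<n. d\<phi> j (\<lambda>k. h k x) * h j y)\<^sup>2 \<partial>\<mu>) \<le> C\<^sup>2 * (norm (F x))\<^sup>2"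
      by (simp add: L2norm_def power_mult_distrib)
  qed
  also have "\<dots> = C\<^sup>2 * (L2norm \<mu> F)\<^sup>2" by (simp add: L2norm_def)
  finally have g: "(\<integral>p. ?g p \<partial>(\<mu> \<Otimes>\<^sub>M \<mu>)) \<le> C\<^sup>2 * (L2norm \<mu> F)\<^sup>2" .
  have "2 * (L2norm \<mu> (\<lambda>x. f x - expectation f))\<^sup>2 \<le> pi\<^sup>2 / 4 * (\<integral>p. ?g p \<partial>(\<mu> \<Otimes>\<^sub>M \<mu>))"
    using gaussian_poincare(2) expectation_pair_diff_square[OF fL] by (simp add: fF)
  also have "\<dots> \<le> pi\<^sup>2 / 4 * (C\<^sup>2 * (L2norm \<mu> F)\<^sup>2)" by (intro mult_left_mono g) auto
  \<comment> \<open>A deliberately crude step, from 1/4 to 2: it absorbs the factor 2 on the left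
    and leaves a constant without roots.\<close>
  also have "\<dots> \<le> 2 * (pi * C * L2norm \<mu> F)\<^sup>2" by (simp add: power_mult_distrib)
  finally have "(L2norm \<mu> (\<lambda>x. f x - expectation f))\<^sup>2 \<le> (pi * C * L2norm \<mu> F)\<^sup>2" by simp
  then show "L2norm \<mu> (\<lambda>x. f x - expectation f) \<le> pi * C * L2norm \<mu> F"
    by (rule power2_le_imp_le) (use C0 in \<open>simp add: L2norm_def\<close>)
qed

text \<open>Both sides are continuous along the graph: subtracting the mean is a contraction for
  \<open>L2norm\<close>, and the gradients obey the triangle inequality.\<close>

lemma D_H_poincare:
  fixes i :: "'h::{real_inner,complete_space} \<Rightarrow> 'e"
  assumes i: "bounded_linear i" and C0: "0 \<le> C"
    and C: "\<And>xs. L2norm \<mu> (blinfun_apply xs) \<le> C * norm (hadjoint i xs)"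
    and fG: "(f, G) \<in> D_H \<mu> i"
  shows "L2norm \<mu> (\<lambda>x. f x - expectation f) \<le> pi * C * L2norm \<mu> G"
proof -
  obtain s where s: "\<And>m. s m \<in> cylindrical_gradient (U_op \<mu> i)" and f: "f \<in> L2 \<mu>" and G: "G \<in> L2 \<mu>"
    and lim: "(\<lambda>m. (\<lambda>(x, y). L2norm \<mu> x + L2norm \<mu> y) (s m - (f, G))) \<longlonglongrightarrow> 0"
    using fG by (auto simp: D_H_def op_closure_def seq_closure_def)
  define a where "a m = fst (s m)" for m
  define A where "A m = snd (s m)" for m
  have aA: "(a m, A m) \<in> cylindrical_gradient (U_op \<mu> i)" for m using s by (simp add: a_def A_def)
  have lim: "(\<lambda>m. L2norm \<mu> (a m - f) + L2norm \<mu> (A m - G)) \<longlonglongrightarrow> 0"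
    using lim by (simp add: a_def A_def case_prod_beta)
  have lim1: "(\<lambda>m. L2norm \<mu> (a m - f)) \<longlonglongrightarrow> 0" and lim2: "(\<lambda>m. L2norm \<mu> (A m - G)) \<longlonglongrightarrow> 0"
    by (rule Lim_null_comparison[OF _ lim]; simp add: L2norm_def)+
  note cyl = cylindrical_gradient_poincare[OF i C0 C aA]
  define c where "c u = (\<lambda>x. u x - expectation u)" for u :: "'e \<Rightarrow> real"
  have cL: "c u \<in> L2 \<mu>" if "u \<in> L2 \<mu>" for u
    using L.mem(3)[OF that const_L2[of "expectation u"]] by (simp add: c_def fun_diff_def)
  have "L2norm \<mu> (c f) \<le> pi * C * (L2norm \<mu> G + L2norm \<mu> (A m - G)) + L2norm \<mu> (a m - f)" for m
  proof -
    have d: "f - a m \<in> L2 \<mu>" using L.mem(3)[OF f cyl(1)] .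
    have "c f = c (a m) + c (f - a m)"
      using L2_imp_integrable[OF f] L2_imp_integrable[OF cyl(1)]
      by (simp add: c_def fun_eq_iff fun_diff_def[of f "a m"])
    then have "L2norm \<mu> (c f) \<le> L2norm \<mu> (c (a m)) + L2norm \<mu> (c (f - a m))"
      using L.nm_triangle[OF cL[OF cyl(1)] cL[OF d]] by simp
    moreover have "L2norm \<mu> (c (f - a m)) \<le> L2norm \<mu> (f - a m)" unfolding c_def by (rule L2norm_centred_le[OF d])
    moreover have "L2norm \<mu> (f - a m) = L2norm \<mu> (a m - f)" by (rule L.nm_minus[OF f cyl(1)])
    moreover have "L2norm \<mu> (c (a m)) \<le> pi * C * L2norm \<mu> (A m)" unfolding c_def by (rule cyl(3))
    moreover have "pi * C * L2norm \<mu> (A m) \<le> pi * C * (L2norm \<mu> G + L2norm \<mu> (A m - G))"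
      using C0 by (intro mult_left_mono L2norm_le_L2norm_add cyl(2) G) auto
    ultimately show ?thesis by linarith
  qed
  moreover have "(\<lambda>m. pi * C * (L2norm \<mu> G + L2norm \<mu> (A m - G)) + L2norm \<mu> (a m - f)) \<longlonglongrightarrow> pi * C * (L2norm \<mu> G + 0) + 0"
    by (intro tendsto_intros lim1 lim2)
  ultimately have "L2norm \<mu> (c f) \<le> pi * C * (L2norm \<mu> G + 0) + 0"
    by (intro LIMSEQ_le_const) auto
  then show ?thesis by (simp add: c_def)
qed

end

section \<open>From the whole space to the open set\<close>

lemma (in prob_space) L2norm_le_centred:
  fixes f :: "'a \<Rightarrow> real"
  assumes f: "f \<in> L2 M" and A: "A \<in> sets M" "0 < prob A" "\<And>x. x \<in> A \<Longrightarrow> f x = 0"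
  shows "L2norm M f \<le> sqrt (1 + 1 / prob A) * L2norm M (\<lambda>x. f x - expectation f)"
proof -
  define m where "m = expectation f"
  define V where "V = L2norm M (\<lambda>x. f x - m)"
  interpret L: semi_inner_product "L2 M" "L2inner M :: ('a \<Rightarrow> real) \<Rightarrow> _" by (rule semi_inner_product_L2)
  have "(\<lambda>x. f x - m) \<in> L2 M" using L.mem(3)[OF f const_L2[of m]] by (simp add: fun_diff_def)
  then have i: "integrable M (\<lambda>x. (f x - m)\<^sup>2)" by (simp add: L2_real_iff)
  \<comment> \<open>On \<open>A\<close> the centred function is the constant \<open>- m\<close>, so
    its variance already contains the mass \<open>m\<^sup>2 * prob A\<close>.\<close>
  have "m\<^sup>2 * prob A = (\<integral>x. indicator A x * m\<^sup>2 \<partial>M)" using A(1) by simp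
  also have "\<dots> \<le> (\<integral>x. (f x - m)\<^sup>2 \<partial>M)"
  proof (rule integral_mono[OF _ i])
    show "integrable M (\<lambda>x. indicator A x * m\<^sup>2)"
      using A(1) by (intro integrable_mult_left) (simp add: less_top[symmetric])
  qed (use A(3) in \<open>auto simp: indicator_def\<close>)
  also have "\<dots> = V\<^sup>2" by (simp add: V_def L2norm_def)
  finally have "m\<^sup>2 \<le> V\<^sup>2 / prob A" using A(2) by (simp add: field_simps)
  moreover have "(L2norm M f)\<^sup>2 = V\<^sup>2 + m\<^sup>2"
    using L2norm_centred[OF f] by (simp add: V_def m_def) (simp add: L2norm_def)
  ultimately have "(L2norm M f)\<^sup>2 \<le> (1 + 1 / prob A) * V\<^sup>2" by (simp add: algebra_simps)
  also have "\<dots> = (sqrt (1 + 1 / prob A) * V)\<^sup>2" by (simp add: power_mult_distrib)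
  finally show ?thesis unfolding V_def m_def
    by (rule power2_le_imp_le) (simp add: L2norm_def)
qed

lemma L2norm_restrict_space:
  assumes "A \<in> sets M"
  shows "L2norm (restrict_space M A) f = L2norm M (ext_zero A f)"
proof -
  have "indicator A x *\<^sub>R (norm (f x))\<^sup>2 = (norm (ext_zero A f x))\<^sup>2" for x
    by (simp add: ext_zero_def indicator_def)
  then show ?thesis using assms by (simp add: L2norm_def integral_restrict_space)
qed

theorem theorem5p7:
  fixes i :: "'h::{real_inner,complete_space} \<Rightarrow> 'e::banach"
    and \<Omega> :: "'w measure"
    and W :: "(real \<Rightarrow> 'h) \<Rightarrow> 'w \<Rightarrow> real"
    and S :: "real \<Rightarrow> 'e \<Rightarrow> 'e"
    and \<mu> :: "'e measure"
    and Z :: "real \<Rightarrow> 'w \<Rightarrow> 'e"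
    and P :: "real \<Rightarrow> ('e \<Rightarrow> real) \<Rightarrow> 'e \<Rightarrow> real"
    and i_inf :: "('e \<Rightarrow> real) \<Rightarrow> 'e"
    and S_inf :: "real \<Rightarrow> ('e \<Rightarrow> real) \<Rightarrow> 'e \<Rightarrow> real"
    and B :: "'h \<Rightarrow> 'h"
    and \<O> :: "'e set"
  assumes i: "bounded_linear i" "inj i"
    and W: "cylindrical_brownian_motion \<Omega> W"
    and S: "c0_semigroup UNIV norm S"
    and mu: "centred_gaussian_radon_measure \<mu>"
    and mu_cov: "\<And>xs :: 'e \<Rightarrow>\<^sub>L real.
      (\<integral>\<^sup>+x. ennreal ((blinfun_apply xs x)\<^sup>2) \<partial>\<mu>)
        = (\<integral>\<^sup>+t. ennreal ((norm (hadjoint (S t \<circ> i) xs))\<^sup>2) \<partial>half_line)"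
    and Z: "\<And>t. t \<ge> 0 \<Longrightarrow> has_stochastic_integral \<Omega> W t (\<lambda>s. S (t - s) \<circ> i) (Z t)"
    and P: "ornstein_uhlenbeck_semigroup \<Omega> S Z \<mu> P"
    and P_analytic: "analytic_semigroup (L2 \<mu>) (L2norm \<mu>) P"
    and i_inf: "\<And>h. h \<in> H_infty \<mu> \<Longrightarrow>
      has_bochner_integral_in UNIV norm \<mu> (\<lambda>x. h x *\<^sub>R x) (i_inf h)"
    and S_inf: "c0_contraction_semigroup (H_infty \<mu>) (L2norm \<mu>) S_inf"
      "\<And>t h. t \<ge> 0 \<Longrightarrow> h \<in> H_infty \<mu> \<Longrightarrow> i_inf (S_inf t h) = S t (i_inf h)"
    and B: "bounded_linear B"
      "\<And>xs. xs \<in> Domain (dual_graph (semigroup_generator UNIV norm S)) \<Longrightarrow>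
        \<exists>k. (blinfun_apply xs, k)
              \<in> adjoint_graph (H_infty \<mu>) (L2inner \<mu>) (H_infty \<mu>) (L2inner \<mu>)
                  (semigroup_generator (H_infty \<mu>) (L2norm \<mu>) S_inf) \<and>
            i (B (hadjoint i xs)) = - i_inf k"
    and O_set: "open \<O>" "\<O> \<noteq> {}" "emeasure \<mu> \<O> > 0"
    and O_compl: "emeasure \<mu> (- \<O>) > 0"
    and stable: "uniformly_exp_stable (H_infty \<mu>) (L2norm \<mu>) S_inf"
    and calculus: "bounded_Hinfty_calculus (range_closure \<mu> i \<O>)
      (L2norm (restrict_space \<mu> \<O>)) (neg_op (L_O \<mu> i \<O> B))"
  shows "\<exists>C. \<forall>u\<in>W12_ring \<mu> i \<O>. \<forall>F. (u, F) \<in> D_O \<mu> i \<O> \<longrightarrow>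
    L2norm (restrict_space \<mu> \<O>) u \<le> C * L2norm (restrict_space \<mu> \<O>) F"
proof -
  interpret gaussian_radon \<mu> by unfold_locales (rule mu)
  have "\<exists>C\<ge>0. \<forall>xs. L2norm \<mu> (blinfun_apply xs) \<le> C * norm (hadjoint i xs)"
    by (rule functional_poincare[OF i(1) S mu mu_cov i_inf S_inf B stable]) blast+
  then obtain C where C: "0 \<le> C" "\<And>xs. L2norm \<mu> (blinfun_apply xs) \<le> C * norm (hadjoint i xs)"
    by blast
  have O: "\<O> \<in> sets \<mu>" "- \<O> \<in> sets \<mu>" using O_set(1) by (simp_all add: sets_mu)
  have pO: "0 < prob (- \<O>)" using O_compl by (simp add: emeasure_eq_measure)
  have "L2norm (restrict_space \<mu> \<O>) u \<le> sqrt (1 + 1 / prob (- \<O>)) * (pi * C) * L2norm (restrict_space \<mu> \<O>) F"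
    if uF: "(u, F) \<in> D_O \<mu> i \<O>" for u F
  proof -
    obtain G where G: "(ext_zero \<O> u, G) \<in> D_H \<mu> i" and G0: "AE x in \<mu>. x \<notin> \<O> \<longrightarrow> G x = 0"
      and FG: "AE x in restrict_space \<mu> \<O>. F x = G x" and FL: "F \<in> L2 (restrict_space \<mu> \<O>)"
      using uF by (auto simp: D_O_def)
    have u: "ext_zero \<O> u \<in> L2 \<mu>" and GL: "G \<in> L2 \<mu>"
      using G by (auto simp: D_H_def op_closure_def seq_closure_def)
    have Gm: "(\<lambda>x. norm (G x)) \<in> borel_measurable \<mu>" and Fm: "(\<lambda>x. norm (F x)) \<in> borel_measurable (restrict_space \<mu> \<O>)"
      using GL FL by (auto simp: L2_def intro: strongly_measurable_norm)
    \<comment> \<open>Only the values of \<open>F\<close> on \<O> matter; there it agrees with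
      \<open>G\<close>, which vanishes almost everywhere outside, so the two norms coincide.\<close>
    have "(\<integral>x. (norm (F x))\<^sup>2 \<partial>restrict_space \<mu> \<O>) = (\<integral>x. (norm (G x))\<^sup>2 \<partial>restrict_space \<mu> \<O>)"
      using FG Fm measurable_restrict_space1[OF Gm, of \<O>] by (intro integral_cong_AE) auto
    also have "\<dots> = (\<integral>x. indicator \<O> x *\<^sub>R (norm (G x))\<^sup>2 \<partial>\<mu>)"
      by (rule integral_restrict_space) (use O in \<open>simp add: space_mu\<close>)
    also have "\<dots> = (\<integral>x. (norm (G x))\<^sup>2 \<partial>\<mu>)"
      using G0 Gm O by (intro integral_cong_AE) (auto simp: indicator_def)
    finally have norm_G: "L2norm (restrict_space \<mu> \<O>) F = L2norm \<mu> G" by (simp add: L2norm_def)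
    have "L2norm (restrict_space \<mu> \<O>) u = L2norm \<mu> (ext_zero \<O> u)" by (rule L2norm_restrict_space[OF O(1)])
    also have "\<dots> \<le> sqrt (1 + 1 / prob (- \<O>)) * L2norm \<mu> (\<lambda>x. ext_zero \<O> u x - expectation (ext_zero \<O> u))"
      by (rule L2norm_le_centred[OF u O(2) pO]) (simp add: ext_zero_def)
    also have "\<dots> \<le> sqrt (1 + 1 / prob (- \<O>)) * (pi * C * L2norm \<mu> G)"
      by (intro mult_left_mono D_H_poincare[OF i(1) C G]) simp
    finally show ?thesis by (simp add: norm_G mult.assoc)
  qed
  then show ?thesis by blast
qed

end
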